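(* Let $\phi$ be a Drinfeld module of rank $r$ over $k$ with height $H$. Then \[\left\lceil\frac{n}{H\cdot d}\right\rceil\leq\frac{[\widetilde{F}:K]}{d},\] with equality if and only if $A[\pi]$ is locally maximal at $\pi$.
   Context: Let $\mathbb{F}_q$ be a finite field, $A=\mathbb{F}_q[T]$, $F=\mathbb{F}_q(T)$, $\mathfrak{p}$ a nonzero prime of $A$ (also denoting its monic generator) of degree $d$, $\mathbb{F}_\mathfrak{p}=A/\mathfrak{p}$, and $k\cong\mathbb{F}_{q^n}$ a finite extension of $\mathbb{F}_\mathfrak{p}$, an $A$-field via $\gamma\colon A\to A/\mathfrak{p}\hookrightarrow k$. Let $k\{\tau\}$ be the twisted polynomial ring with $\tau\alpha=\alpha^q\tau$. A Drinfeld module of rank $r\ge1$ over $k$ is a ring homomorphism $\phi\colon A\to k\{\tau\}$ with $\phi_a=\gamma(a)+g_1(a)\tau+\dots+g_{r\deg a}(a)\tau^{r\deg a}$, $g_{r\deg a}(a)\ne0$. The height $H$ of $\phi$ is the integer such that the lowest-degree nonzero term of $\phi_\mathfrak{p}$ in $\tau$ has degree $Hd$. Let $\pi=\tau^n$ (central in $k\{\tau\}$), $K=\mathbb{F}_q(\pi)$, and $k(\tau)=k\{\tau\}\otimes_{\mathbb{F}_q[\pi]}K$, a division algebra; extend $\phi$ to $F\to k(\tau)$ and identify $A,F$ with $\phi(A),\phi(F)$. Let $\widetilde{F}=F(\pi)\subseteq k(\tau)$, a field, and $A[\pi]=\phi(A)[\pi]$. Let $B$ be the integral closure of $A$ in $\widetilde{F}$;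 there is a unique place $\widetilde{\mathfrak{p}}$ of $\widetilde{F}$ over the place $(\pi)$ of $K$; let $B_{\widetilde{\mathfrak{p}}}$ be the ring of integers of the completion $\widetilde{F}_{\widetilde{\mathfrak{p}}}=\widetilde{F}\otimes_K\mathbb{F}_q((\pi))$. For an $A$-order $R$ in $\widetilde F$ containing $\pi$, set $R_{\widetilde{\mathfrak{p}}}=R\otimes_{\mathbb{F}_q[\pi]}\mathbb{F}_q[[\pi]]\subseteq B_{\widetilde{\mathfrak{p}}}$; $R$ is locally maximal at $\pi$ if $R_{\widetilde{\mathfrak{p}}}=B_{\widetilde{\mathfrak{p}}}$. *)

theory Defs
  imports
    "HOL-Library.Cardinality"
    "HOL-Algebra.Algebra"
    "HOL-Algebra.Free_Abelian_Groups"
    "HOL-Algebra.Algebraic_Closure_Type"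
    "HOL-Computational_Algebra.Computational_Algebra"
begin

text \<open>
  Finite fields are types of class \<open>{finite, field}\<close>. The type \<open>'q poly\<close> serves both as
  \<open>A = F\<^sub>q[T]\<close> and as \<open>F\<^sub>q[\<pi>]\<close>, the type \<open>'q poly fract\<close> is \<open>K = F\<^sub>q(\<pi>)\<close>, and \<open>'q fls\<close> is
  \<open>F\<^sub>q((\<pi>))\<close>. The remaining rings are records as in HOL-Algebra, with
  \<^const>\<open>ring_of_type_algebra\<close> turning a type into such a record. Throughout, \<open>\<gamma> : A \<rightarrow> k\<close> is the
  structure map, \<open>\<phi> : A \<rightarrow> k{\<tau>}\<close>, and \<open>\<pi> = \<tau>\<^sup>n\<close>.
\<close>

section \<open>Tensor product of two algebras over a commutative ring\<close>

text \<open>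
  \<open>M \<otimes>\<^sub>R N\<close> for ring homomorphisms \<open>\<alpha> : R \<rightarrow> M\<close> and \<open>\<beta> : R \<rightarrow> N\<close> with central images: the free
  abelian group on \<open>M \<times> N\<close>, with \<open>(m, x) (m', x') = (m m', x x')\<close>, modulo the additive subgroup
  generated by the bilinearity relations. By centrality this subgroup is a two-sided ideal.
\<close>

definition pair_ring ::
  "('m, 'u) ring_scheme \<Rightarrow> ('n, 'v) ring_scheme \<Rightarrow> (('m \<times> 'n) \<Rightarrow>\<^sub>0 int) ring" where
  "pair_ring M N =
     \<lparr> carrier = {c. Poly_Mapping.keys c \<subseteq> carrier M \<times> carrier N},
       monoid.mult = (\<lambda>c c'. frag_extend (\<lambda>(m, x).
                 frag_extend (\<lambda>(m', x'). frag_of (m \<otimes>\<^bsub>M\<^esub> m', x \<otimes>\<^bsub>N\<^esub> x')) c') c),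
       one = frag_of (\<one>\<^bsub>M\<^esub>, \<one>\<^bsub>N\<^esub>),
       ring.zero = 0,
       add = (+) \<rparr>"

definition tensor_relators ::
  "('r, 'w) ring_scheme \<Rightarrow> ('r \<Rightarrow> 'm) \<Rightarrow> ('r \<Rightarrow> 'n) \<Rightarrow>
   ('m, 'u) ring_scheme \<Rightarrow> ('n, 'v) ring_scheme \<Rightarrow> (('m \<times> 'n) \<Rightarrow>\<^sub>0 int) set" where
  "tensor_relators R \<alpha> \<beta> M N =
     {frag_of (m \<oplus>\<^bsub>M\<^esub> m', x) - frag_of (m, x) - frag_of (m', x) | m m' x.
        m \<in> carrier M \<and> m' \<in> carrier M \<and> x \<in> carrier N} \<union>
     {frag_of (m, x \<oplus>\<^bsub>N\<^esub> x') - frag_of (m, x) - frag_of (m, x') | m x x'.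
        m \<in> carrier M \<and> x \<in> carrier N \<and> x' \<in> carrier N} \<union>
     {frag_of (\<alpha> a \<otimes>\<^bsub>M\<^esub> m, x) - frag_of (m, \<beta> a \<otimes>\<^bsub>N\<^esub> x) | a m x.
        a \<in> carrier R \<and> m \<in> carrier M \<and> x \<in> carrier N}"

definition tensor_ideal ::
  "('r, 'w) ring_scheme \<Rightarrow> ('r \<Rightarrow> 'm) \<Rightarrow> ('r \<Rightarrow> 'n) \<Rightarrow>
   ('m, 'u) ring_scheme \<Rightarrow> ('n, 'v) ring_scheme \<Rightarrow> (('m \<times> 'n) \<Rightarrow>\<^sub>0 int) set" where
  "tensor_ideal R \<alpha> \<beta> M N = generate (add_monoid (pair_ring M N)) (tensor_relators R \<alpha> \<beta> M N)"

definition tensor_ring ::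
  "('r, 'w) ring_scheme \<Rightarrow> ('r \<Rightarrow> 'm) \<Rightarrow> ('r \<Rightarrow> 'n) \<Rightarrow>
   ('m, 'u) ring_scheme \<Rightarrow> ('n, 'v) ring_scheme \<Rightarrow> (('m \<times> 'n) \<Rightarrow>\<^sub>0 int) set ring" where
  "tensor_ring R \<alpha> \<beta> M N = pair_ring M N Quot tensor_ideal R \<alpha> \<beta> M N"

definition pure_tensor ::
  "('r, 'w) ring_scheme \<Rightarrow> ('r \<Rightarrow> 'm) \<Rightarrow> ('r \<Rightarrow> 'n) \<Rightarrow>
   ('m, 'u) ring_scheme \<Rightarrow> ('n, 'v) ring_scheme \<Rightarrow> 'm \<Rightarrow> 'n \<Rightarrow> (('m \<times> 'n) \<Rightarrow>\<^sub>0 int) set" where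
  "pure_tensor R \<alpha> \<beta> M N m x = tensor_ideal R \<alpha> \<beta> M N +>\<^bsub>pair_ring M N\<^esub> frag_of (m, x)"


section \<open>Twisted polynomials and Drinfeld modules\<close>

text \<open>
  \<open>k{\<tau>}\<close> has the additive group of \<open>k[\<tau>]\<close>, and \<open>\<tau> \<alpha> = \<alpha>\<^sup>q \<tau>\<close> gives
  \<open>(a \<tau>\<^sup>i) (b \<tau>\<^sup>j) = a b^(q^i) \<tau>^(i+j)\<close>.
\<close>

definition twisted_mult :: "nat \<Rightarrow> 'k::field poly \<Rightarrow> 'k poly \<Rightarrow> 'k poly" where
  "twisted_mult q f g =
     (\<Sum>i\<le>degree f. \<Sum>j\<le>degree g. monom (coeff f i * coeff g j ^ (q ^ i)) (i + j))"

definition twisted_poly_ring :: "nat \<Rightarrow> 'k::field poly ring" where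
  "twisted_poly_ring q =
     \<lparr> carrier = UNIV, monoid.mult = twisted_mult q, one = 1, ring.zero = 0, add = (+) \<rparr>"

definition drinfeld_module ::
  "('q::{finite,field} poly \<Rightarrow> 'k::{finite,field}) \<Rightarrow> nat \<Rightarrow> ('q poly \<Rightarrow> 'k poly) \<Rightarrow> bool" where
  "drinfeld_module \<gamma> r \<phi> \<longleftrightarrow>
     r \<ge> 1 \<and>
     \<phi> \<in> ring_hom ring_of_type_algebra (twisted_poly_ring CARD('q)) \<and>
     (\<forall>a. coeff (\<phi> a) 0 = \<gamma> a) \<and>
     (\<forall>a. a \<noteq> 0 \<longrightarrow> \<phi> a \<noteq> 0 \<and> degree (\<phi> a) = r * degree a)"

definition has_height :: "('q::{finite,field} poly \<Rightarrow> 'k::{finite,field} poly) \<Rightarrow> 'q poly \<Rightarrow> nat \<Rightarrow> bool"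
  where
  "has_height \<phi> \<pp> H \<longleftrightarrow>
     coeff (\<phi> \<pp>) (H * degree \<pp>) \<noteq> 0 \<and> (\<forall>i < H * degree \<pp>. coeff (\<phi> \<pp>) i = 0)"


section \<open>The division algebra \<open>k(\<tau>)\<close> and its subfields\<close>

text \<open>The inclusion of \<open>F\<^sub>q[\<pi>]\<close> in \<open>k{\<tau>}\<close>, \<open>\<pi> = \<tau>\<^sup>n\<close>; constants embed in \<open>k\<close> through \<open>\<gamma>\<close>.\<close>

definition Fq_pi_incl ::
  "('q::{finite,field} poly \<Rightarrow> 'k::{finite,field}) \<Rightarrow> nat \<Rightarrow> 'q poly \<Rightarrow> 'k poly" where
  "Fq_pi_incl \<gamma> n c = (\<Sum>i\<le>degree c. monom (\<gamma> [:coeff c i:]) (n * i))"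

type_synonym ('q, 'k) ktau = "(('k poly \<times> 'q poly fract) \<Rightarrow>\<^sub>0 int) set"

definition ktau :: "('q::{finite,field} poly \<Rightarrow> 'k::{finite,field}) \<Rightarrow> nat \<Rightarrow> ('q, 'k) ktau ring" where
  "ktau \<gamma> n = tensor_ring ring_of_type_algebra (Fq_pi_incl \<gamma> n) to_fract
     (twisted_poly_ring CARD('q)) ring_of_type_algebra"

definition ktau_tensor ::
  "('q::{finite,field} poly \<Rightarrow> 'k::{finite,field}) \<Rightarrow> nat \<Rightarrow> 'k poly \<Rightarrow> 'q poly fract \<Rightarrow> ('q, 'k) ktau"
  where
  "ktau_tensor \<gamma> n = pure_tensor ring_of_type_algebra (Fq_pi_incl \<gamma> n) to_fract
     (twisted_poly_ring CARD('q)) ring_of_type_algebra"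

definition K_incl ::
  "('q::{finite,field} poly \<Rightarrow> 'k::{finite,field}) \<Rightarrow> nat \<Rightarrow> 'q poly fract \<Rightarrow> ('q, 'k) ktau" where
  "K_incl \<gamma> n x = ktau_tensor \<gamma> n 1 x"

definition K_field :: "('q::{finite,field} poly \<Rightarrow> 'k::{finite,field}) \<Rightarrow> nat \<Rightarrow> ('q, 'k) ktau set" where
  "K_field \<gamma> n = range (K_incl \<gamma> n)"

definition frob :: "('q::{finite,field} poly \<Rightarrow> 'k::{finite,field}) \<Rightarrow> nat \<Rightarrow> ('q, 'k) ktau" where
  "frob \<gamma> n = ktau_tensor \<gamma> n (monom 1 n) 1"

definition phi_A ::
  "('q::{finite,field} poly \<Rightarrow> 'k::{finite,field}) \<Rightarrow> nat \<Rightarrow> ('q poly \<Rightarrow> 'k poly) \<Rightarrow> ('q, 'k) ktau set"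
  where
  "phi_A \<gamma> n \<phi> = range (\<lambda>a. ktau_tensor \<gamma> n (\<phi> a) 1)"

definition phi_F ::
  "('q::{finite,field} poly \<Rightarrow> 'k::{finite,field}) \<Rightarrow> nat \<Rightarrow> ('q poly \<Rightarrow> 'k poly) \<Rightarrow> ('q, 'k) ktau set"
  where
  "phi_F \<gamma> n \<phi> = {ktau_tensor \<gamma> n (\<phi> a) 1 \<otimes>\<^bsub>ktau \<gamma> n\<^esub> inv\<^bsub>ktau \<gamma> n\<^esub> (ktau_tensor \<gamma> n (\<phi> b) 1)
                    | a b. b \<noteq> 0}"

text \<open>\<open>A[\<pi>]\<close> and \<open>F(\<pi>)\<close>, as subsets of \<open>k(\<tau>)\<close>.\<close>

definition A_pi ::
  "('q::{finite,field} poly \<Rightarrow> 'k::{finite,field}) \<Rightarrow> nat \<Rightarrow> ('q poly \<Rightarrow> 'k poly) \<Rightarrow> ('q, 'k) ktau set"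
  where
  "A_pi \<gamma> n \<phi> = generate_ring (ktau \<gamma> n) (insert (frob \<gamma> n) (phi_A \<gamma> n \<phi>))"

definition F_tilde ::
  "('q::{finite,field} poly \<Rightarrow> 'k::{finite,field}) \<Rightarrow> nat \<Rightarrow> ('q poly \<Rightarrow> 'k poly) \<Rightarrow> ('q, 'k) ktau set"
  where
  "F_tilde \<gamma> n \<phi> = generate_field (ktau \<gamma> n) (insert (frob \<gamma> n) (phi_F \<gamma> n \<phi>))"

definition F_tilde_ring ::
  "('q::{finite,field} poly \<Rightarrow> 'k::{finite,field}) \<Rightarrow> nat \<Rightarrow> ('q poly \<Rightarrow> 'k poly) \<Rightarrow> ('q, 'k) ktau ring"
  where
  "F_tilde_ring \<gamma> n \<phi> = (ktau \<gamma> n)\<lparr>carrier := F_tilde \<gamma> n \<phi>\<rparr>"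

definition F_tilde_degree ::
  "('q::{finite,field} poly \<Rightarrow> 'k::{finite,field}) \<Rightarrow> nat \<Rightarrow> ('q poly \<Rightarrow> 'k poly) \<Rightarrow> nat" where
  "F_tilde_degree \<gamma> n \<phi> = ring.dim (ktau \<gamma> n) (K_field \<gamma> n) (F_tilde \<gamma> n \<phi>)"


section \<open>The completion at the place above \<open>(\<pi>)\<close>\<close>

text \<open>The embedding of \<open>F\<^sub>q(\<pi>)\<close> in its completion \<open>F\<^sub>q((\<pi>))\<close>.\<close>

definition fract_to_fls :: "'q::field poly fract \<Rightarrow> 'q fls" where
  "fract_to_fls x =
     (case SOME (a, b). b \<noteq> 0 \<and> x = Fract a b of
        (a, b) \<Rightarrow> fps_to_fls (fps_of_poly a) / fps_to_fls (fps_of_poly b))"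

lemma fract_to_fls_Fract:
  fixes a b :: "'q::field poly"
  assumes "b \<noteq> 0"
  shows "fract_to_fls (Fract a b) = fps_to_fls (fps_of_poly a) / fps_to_fls (fps_of_poly b)"
proof -
  define P where "P = (\<lambda>(a', b'). b' \<noteq> 0 \<and> Fract a b = Fract a' b')"
  obtain a' b' where ab: "Eps P = (a', b')"
    by (rule prod.exhaust)
  have "P (a, b)"
    using assms by (simp add: P_def)
  then have "P (Eps P)"
    by (rule someI)
  then have b': "b' \<noteq> 0" and "Fract a b = Fract a' b'"
    unfolding ab by (simp_all add: P_def)
  then have "a * b' = a' * b"
    using assms by (simp add: eq_fract)
  then have "fps_to_fls (fps_of_poly a) * fps_to_fls (fps_of_poly b') =
             fps_to_fls (fps_of_poly a') * fps_to_fls (fps_of_poly b)"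
    by (simp flip: fls_times_fps_to_fls fps_of_poly_mult)
  then show ?thesis
    using assms b' ab by (simp add: fract_to_fls_def P_def frac_eq_eq)
qed

type_synonym ('q, 'k) completed = "((('q, 'k) ktau \<times> 'q fls) \<Rightarrow>\<^sub>0 int) set"

definition completion ::
  "('q::{finite,field} poly \<Rightarrow> 'k::{finite,field}) \<Rightarrow> nat \<Rightarrow> ('q poly \<Rightarrow> 'k poly) \<Rightarrow>
   ('q, 'k) completed ring" where
  "completion \<gamma> n \<phi> = tensor_ring ring_of_type_algebra (K_incl \<gamma> n) fract_to_fls
     (F_tilde_ring \<gamma> n \<phi>) ring_of_type_algebra"

definition completion_tensor ::
  "('q::{finite,field} poly \<Rightarrow> 'k::{finite,field}) \<Rightarrow> nat \<Rightarrow> ('q poly \<Rightarrow> 'k poly) \<Rightarrow>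
   ('q, 'k) ktau \<Rightarrow> 'q fls \<Rightarrow> ('q, 'k) completed" where
  "completion_tensor \<gamma> n \<phi> = pure_tensor ring_of_type_algebra (K_incl \<gamma> n) fract_to_fls
     (F_tilde_ring \<gamma> n \<phi>) ring_of_type_algebra"

definition valuation_subring :: "'a set \<Rightarrow> ('a, 'u) ring_scheme \<Rightarrow> bool" where
  "valuation_subring V L \<longleftrightarrow> subring V L \<and> (\<forall>x \<in> carrier L. x \<notin> V \<longrightarrow> inv\<^bsub>L\<^esub> x \<in> V)"

text \<open>
  The ring of integers of the completion is the ring of the valuation that extends the one of
  \<open>F\<^sub>q((\<pi>))\<close>, that is, the valuation ring lying over \<open>F\<^sub>q[[\<pi>]]\<close>. It is unique because
  \<open>F\<^sub>q((\<pi>))\<close> is complete.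
\<close>

definition completion_integers ::
  "('q::{finite,field} poly \<Rightarrow> 'k::{finite,field}) \<Rightarrow> nat \<Rightarrow> ('q poly \<Rightarrow> 'k poly) \<Rightarrow>
   ('q, 'k) completed set" where
  "completion_integers \<gamma> n \<phi> =
     (THE V. valuation_subring V (completion \<gamma> n \<phi>) \<and>
        V \<inter> range (completion_tensor \<gamma> n \<phi> \<one>\<^bsub>ktau \<gamma> n\<^esub>) =
          range (\<lambda>f. completion_tensor \<gamma> n \<phi> \<one>\<^bsub>ktau \<gamma> n\<^esub> (fps_to_fls f)))"

text \<open>
  \<open>R \<otimes> F\<^sub>q[[\<pi>]]\<close> over \<open>F\<^sub>q[\<pi>]\<close>, for an order \<open>R\<close> containing \<open>\<pi>\<close>, regarded as a subset of the
  completion: all finite sums of pure tensors. The natural map from the tensor product onto this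
  subset is injective because \<open>F\<^sub>q[[\<pi>]]\<close> is flat over \<open>F\<^sub>q[\<pi>]\<close>.
\<close>

definition order_completion ::
  "('q::{finite,field} poly \<Rightarrow> 'k::{finite,field}) \<Rightarrow> nat \<Rightarrow> ('q poly \<Rightarrow> 'k poly) \<Rightarrow>
   ('q, 'k) ktau set \<Rightarrow> ('q, 'k) completed set" where
  "order_completion \<gamma> n \<phi> R =
     generate (add_monoid (completion \<gamma> n \<phi>))
       {completion_tensor \<gamma> n \<phi> x (fps_to_fls f) | x f. x \<in> R}"

definition locally_maximal ::
  "('q::{finite,field} poly \<Rightarrow> 'k::{finite,field}) \<Rightarrow> nat \<Rightarrow> ('q poly \<Rightarrow> 'k poly) \<Rightarrow>
   ('q, 'k) ktau set \<Rightarrow> bool" where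
  "locally_maximal \<gamma> n \<phi> R \<longleftrightarrow> order_completion \<gamma> n \<phi> R = completion_integers \<gamma> n \<phi>"

end

(*
  Let P be the minimal polynomial of T over K. It is monic over F_q[pi], because k{tau} is a finite
  F_q[pi]-module, and its degree N is [F~ : K]. The tau-adic valuation v on F~ extends to the
  completion, which is F_q((pi))[x] / P; there v(pi) = n, v(pp) = Hd and v vanishes on the
  polynomials in T over F_q that are prime to pp. If W is the part of P mod pi that is prime to pp,
  so that P mod pi = pp^s W, then powers of pp^s are divisible in k{tau} by arbitrarily high powers of pi,
  which is only possible if W = 1. Hence N = s d, and pp^s is divisible by pi, so s H d >= n.

  Finally, A[pi] is maximal at pi if and only if (s - 1) H d < n, that is, s = ceiling (n / (H d)).
  If (s - 1) H d >= n, then pp^(s-1) / pi is integral but does not lie in the completed order.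
  Otherwise every nonzero u in F_q[T] of degree less than N satisfies v(u) <= (s - 1) H d < n, so an
  element of F_q[[pi]][T] of valuation at least n is divisible by pi.
*)
theory Submission
  imports Defs
begin

text \<open>The obstacle is that k((tau)) is not commutative, while F(pi) and its completion are.
  Everything is therefore expressed by polynomials in a variable that stands for T: the additive map
  \<open>Phi\<close> sends g over F_q((pi)) to g(T) in k((tau)), its kernel is an ideal, and F(pi),
  A[pi], the completion and the completed order come from polynomials over K, F_q[pi], F_q((pi)) and
  F_q[[pi]]. The decisive input is saturation: for some constant c, a polynomial g of degree less
  than N over F_q[pi] or F_q[[pi]] is divisible by pi as soon as g(T) has order at least n c. This
  yields the independence of the powers of T over F_q((pi)), the bound on denominators of integral
  elements, and W = 1: the remainder of pp^(s c) modulo P is divisible by pi, so P mod pi divides a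
  power of pp. The monic equation for T and the constant c both come from counting leading
  coefficients in the finite field k. The ring of integers is a definite description over all
  valuation rings above F_q[[pi]], so uniqueness is proved for an arbitrary one of them.\<close>

unbundle fps_syntax

section \<open>Twisted polynomials\<close>

text \<open>Multiplication by a nonzero \<open>x\<close> permutes the nonzero elements, so the
  factor x^(q-1) leaves their product unchanged.\<close>

lemma power_CARD_eq_self: "x ^ CARD('a::{finite,field}) = (x::'a)"
proof (cases "x = 0")
  case False
  have q: "CARD('a) > 0" by (simp add: finite_UNIV_card_ge_0)
  have "x * (\<Prod>y\<in>UNIV-{0}. x * y) = x * x ^ (CARD('a) - 1) * \<Prod>(UNIV-{0})"
    by (simp add: prod.distrib mult_ac card_Diff_singleton)
  also have "x * x ^ (CARD('a) - 1) = x ^ CARD('a)"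
    using q by (metis power_eq_if not_gr_zero)
  also have "(\<Prod>y\<in>UNIV-{0}. x * y) = (\<Prod>y\<in>UNIV-{0}. y)"
    by (rule prod.reindex_bij_witness[of _ "\<lambda>y. y / x" "\<lambda>y. x * y"]) (use False in auto)
  finally show ?thesis
    by simp
qed (auto simp: finite_UNIV_card_ge_0)

text \<open>The polynomial (X + 1)^q - X^q - 1 has degree less than q and vanishes at all q elements
  of the field, so it is zero; its coefficients are these binomials.\<close>

lemma binomial_CARD_eq_0:
  assumes "0 < i" "i < CARD('q::{finite,field})"
  shows "of_nat (CARD('q) choose i) = (0::'q)"
proof -
  let ?q = "CARD('q)"
  have q: "?q > 0" by (simp add: finite_UNIV_card_ge_0)
  define p where "p = (\<Sum>j\<in>{0<..<?q}. monom (of_nat (?q choose j) :: 'q) j)"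
  have fq: "x ^ ?q = x" for x :: 'q
    by (rule power_CARD_eq_self)
  have root: "poly p x = 0" for x
  proof -
    have "x + 1 = (x + 1) ^ ?q" by (simp add: fq)
    also have "\<dots> = (\<Sum>j\<le>?q. of_nat (?q choose j) * x ^ j)"
      by (subst binomial_ring) simp
    also have "{..?q} = insert 0 (insert ?q {0<..<?q})" using q by auto
    also have "(\<Sum>j\<in>\<dots>. of_nat (?q choose j) * x ^ j) = 1 + (x + poly p x)"
      using q by (simp add: fq p_def poly_sum poly_monom)
    finally show ?thesis by simp
  qed
  have "p = 0"
  proof (rule ccontr)
    assume "p \<noteq> 0"
    have "UNIV \<subseteq> {x. poly p x = 0}" using root by auto
    then have "?q \<le> card {x. poly p x = 0}" by (intro card_mono) auto
    also have "\<dots> \<le> degree p" using \<open>p \<noteq> 0\<close> by (rule card_poly_roots_bound)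
    also have "degree p < ?q" unfolding p_def
      by (intro degree_sum_less) (use q in \<open>auto intro: le_less_trans[OF degree_monom_le]\<close>)
    finally show False by simp
  qed
  then have "coeff p i = 0" by simp
  then show ?thesis
    using assms by (simp add: p_def coeff_sum if_distrib sum.delta cong: if_cong)
qed

text \<open>Additivity of the q-th power is what makes the twisted product distributive and
  associative; for k it is established in \<open>frob_additive\<close>.\<close>

locale frobenius =
  fixes q :: nat and K :: "'k::field itself"
  assumes q_pos: "q > 0"
    and frob_add: "(x + y :: 'k) ^ q = x ^ q + y ^ q"
begin

abbreviation tw :: "'k poly \<Rightarrow> 'k poly \<Rightarrow> 'k poly" where "tw \<equiv> twisted_mult q"

lemma frob_add': "(x + y :: 'k) ^ (q ^ i) = x ^ (q ^ i) + y ^ (q ^ i)"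
proof (induction i)
  case (Suc i)
  then show ?case by (simp add: mult.commute[of q] power_mult frob_add)
qed simp

lemma frob_0 [simp]: "(0 :: 'k) ^ (q ^ i) = 0"
  using q_pos by simp

lemma frob_sum: "(\<Sum>a\<in>A. f a :: 'k) ^ (q ^ i) = (\<Sum>a\<in>A. f a ^ (q ^ i))"
  by (induction A rule: infinite_finite_induct) (simp_all add: frob_add')

lemma frob_comp: "((x :: 'k) ^ (q ^ i)) ^ (q ^ j) = x ^ (q ^ (i + j))"
  by (simp add: power_add power_mult)

lemma coeff_tw: "coeff (tw f g) m = (\<Sum>i\<le>m. coeff f i * coeff g (m - i) ^ (q ^ i))"
proof -
  have "coeff (tw f g) m = (\<Sum>i\<le>degree f. \<Sum>j\<le>degree g. if j + i = m then coeff f i * coeff g j ^ (q ^ i) else 0)"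
    by (simp add: twisted_mult_def coeff_sum add.commute)
  also have "\<dots> = (\<Sum>i\<le>degree f. if i \<le> m then coeff f i * coeff g (m - i) ^ (q ^ i) else 0)"
  proof (rule sum.cong[OF refl])
    fix i
    show "(\<Sum>j\<le>degree g. if j + i = m then coeff f i * coeff g j ^ (q ^ i) else 0)
        = (if i \<le> m then coeff f i * coeff g (m - i) ^ (q ^ i) else 0)"
    proof (cases "i \<le> m")
      case True
      then have "j + i = m \<longleftrightarrow> j = m - i" for j by auto
      then show ?thesis using True by (auto simp: coeff_eq_0)
    qed auto
  qed
  also have "\<dots> = (\<Sum>i\<in>{..degree f} \<inter> {..m}. coeff f i * coeff g (m - i) ^ (q ^ i))"
    by (subst sum.inter_restrict) auto
  also have "\<dots> = (\<Sum>i\<le>m. coeff f i * coeff g (m - i) ^ (q ^ i))"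
    by (rule sum.mono_neutral_left) (auto simp: coeff_eq_0)
  finally show ?thesis .
qed

lemma tw_add_left: "tw (f + g) h = tw f h + tw g h"
  by (rule poly_eqI) (simp add: coeff_tw algebra_simps sum.distrib)

lemma tw_add_right: "tw f (g + h) = tw f g + tw f h"
  by (rule poly_eqI) (simp add: coeff_tw algebra_simps sum.distrib frob_add')

lemma tw_0_left [simp]: "tw 0 f = 0" and tw_0_right [simp]: "tw f 0 = 0"
  by (rule poly_eqI; simp add: coeff_tw)+

lemma tw_1_left [simp]: "tw 1 f = f"
  by (rule poly_eqI) (simp add: coeff_tw if_distrib[of "\<lambda>x. x * _"] sum.delta' cong: if_cong)

lemma tw_1_right [simp]: "tw f 1 = f"
proof (rule poly_eqI)
  fix m
  have "(\<Sum>i\<le>m. coeff f i * coeff 1 (m - i) ^ (q ^ i)) = (\<Sum>i\<in>{m}. coeff f i * coeff 1 (m - i) ^ (q ^ i))"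
    by (rule sum.mono_neutral_right) auto
  then show "coeff (tw f 1) m = coeff f m" by (simp add: coeff_tw)
qed

lemma tw_assoc: "tw (tw f g) h = tw f (tw g h)"
proof (rule poly_eqI)
  fix m
  have "coeff (tw (tw f g) h) m =
     (\<Sum>j=0..m. \<Sum>i=0..j. coeff f i * coeff g (j - i) ^ (q ^ i) * coeff h (m - j) ^ (q ^ j))"
    by (simp add: coeff_tw sum_distrib_right atMost_atLeast0)
  \<comment> \<open>Writing \<open>j\<close> as \<open>i + (j - i)\<close> turns the summand into a
    function of the indices i, j - i and m - j, the shape that the reindexing of the triple sum
    expects.\<close>
  also have "\<dots> = (\<Sum>j=0..m. \<Sum>i=0..j. coeff f i * coeff g (j - i) ^ (q ^ i) * coeff h (m - j) ^ (q ^ (i + (j - i))))"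
    by (intro sum.cong refl) simp
  also have "\<dots> = (\<Sum>j=0..m. \<Sum>i=0..m - j. coeff f j * coeff g i ^ (q ^ j) * coeff h (m - j - i) ^ (q ^ (j + i)))"
    by (rule fps_mult_assoc_lemma[where k = m and n = m and f = "\<lambda>i l k. coeff f i * coeff g l ^ (q ^ i) * coeff h k ^ (q ^ (i + l))"])
  also have "\<dots> = coeff (tw f (tw g h)) m"
    by (simp add: coeff_tw frob_sum power_mult_distrib sum_distrib_left frob_comp atMost_atLeast0
         mult.assoc add.commute)
  finally show "coeff (tw (tw f g) h) m = coeff (tw f (tw g h)) m" .
qed

text \<open>The tau-adic order is additive: in degree a + b only the pair (a, b) survives. The twist
  is a power of a field element and cannot make the product of the lowest coefficients
  vanish.\<close>

lemma coeff_tw_low: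
  assumes "\<And>i. i < a \<Longrightarrow> coeff f i = 0" "\<And>i. i < b \<Longrightarrow> coeff g i = 0"
  shows "i < a + b \<Longrightarrow> coeff (tw f g) i = 0"
    and "coeff (tw f g) (a + b) = coeff f a * coeff g b ^ (q ^ a)"
proof -
  have z: "coeff f j * coeff g (i - j) ^ (q ^ j) = 0" if "i < a + b \<or> i = a + b \<and> j \<noteq> a" "j \<le> i" for i j
  proof (cases "j < a")
    case False
    then have "i - j < b" using that by auto
    then show ?thesis using assms by simp
  qed (simp add: assms)
  show "coeff (tw f g) i = 0" if "i < a + b"
    unfolding coeff_tw by (rule sum.neutral) (use that in \<open>auto simp del: mult_eq_0_iff intro: z\<close>)
  have "(\<Sum>i\<le>a + b. coeff f i * coeff g (a + b - i) ^ (q ^ i)) = (\<Sum>i\<in>{a}. coeff f i * coeff g (a + b - i) ^ (q ^ i))"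
    by (rule sum.mono_neutral_right) (auto simp del: mult_eq_0_iff intro: z)
  then show "coeff (tw f g) (a + b) = coeff f a * coeff g b ^ (q ^ a)"
    by (simp add: coeff_tw)
qed

end

section \<open>Polynomials over Laurent series\<close>

definition map_fls :: "('a::zero \<Rightarrow> 'b::zero) \<Rightarrow> 'a fls \<Rightarrow> 'b fls" where
  "map_fls h f = Abs_fls (\<lambda>m. h (f $$ m))"

lemma nth_map_fls:
  assumes "h 0 = 0"
  shows "map_fls h f $$ m = h (f $$ m)"
  unfolding map_fls_def by (rule nth_Abs_fls_lower_bound[of "fls_subdegree f"]) (simp add: assms)

text \<open>Injectivity of \<open>h\<close> preserves the subdegree, so the finite convolution sums
  on both sides have the same bounds.\<close>

lemma map_fls_mult:
  fixes h :: "'a::field \<Rightarrow> 'b::field"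
  assumes "h 0 = 0" "\<And>x y. h (x + y) = h x + h y" "\<And>x y. h (x * y) = h x * h y"
    "\<And>x. h x = 0 \<Longrightarrow> x = 0"
  shows "map_fls h (f * g) = map_fls h f * map_fls h g"
proof -
  have sd: "fls_subdegree (map_fls h f) = fls_subdegree f" for f :: "'a fls"
  proof (cases "f = 0")
    case True
    then show ?thesis by (simp add: map_fls_def assms(1) flip: zero_fls_def)
  next
    case False
    then have "h (f $$ fls_subdegree f) \<noteq> 0" using assms(4) by force
    then show ?thesis by (intro fls_subdegree_eqI) (auto simp: nth_map_fls assms(1))
  qed
  have hs: "h (\<Sum>i\<in>A. u i) = (\<Sum>i\<in>A. h (u i))" for u :: "int \<Rightarrow> 'a" and A
    by (induction A rule: infinite_finite_induct) (auto simp: assms)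
  show ?thesis
    by (rule fls_eqI) (simp add: nth_map_fls assms(1) fls_times_nth(2) sd hs assms(3))
qed

text \<open>Used for both variables: it embeds F_q[pi] in F_q((pi)) and the additive group of k{tau}
  in that of k((tau)).\<close>

definition PL :: "'a::comm_ring_1 poly \<Rightarrow> 'a fls" where "PL p = fps_to_fls (fps_of_poly p)"

lemma PL_nth: "PL p $$ m = (if m < 0 then 0 else coeff p (nat m))"
  by (simp add: PL_def)

lemma PL_0 [simp]: "PL 0 = 0" and PL_1 [simp]: "PL 1 = 1"
  and PL_add: "PL (p + p') = PL p + PL p'" and PL_mult: "PL (p * p') = PL p * PL p'"
  and PL_diff: "PL (p - p') = PL p - PL p'"
  and PL_eq_iff: "PL p = PL p' \<longleftrightarrow> p = p'"
  by (simp_all add: PL_def fps_of_poly_add fps_of_poly_mult fps_of_poly_diff fls_times_fps_to_fls)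

lemma PL_sum: "PL (\<Sum>i\<in>A. f i) = (\<Sum>i\<in>A. PL (f i))"
  by (induction A rule: infinite_finite_induct) (simp_all add: PL_add)

definition XL :: "int \<Rightarrow> 'a::field fls" where "XL a = fls_X_intpow a"

lemma XL_times_conv_shift: "XL a * f = fls_shift (- a) f"
  by (simp add: XL_def fls_X_intpow_times_conv_shift)

lemma XL_mult_nth [simp]: "(XL a * f) $$ i = f $$ (i - a)"
  by (simp add: XL_times_conv_shift)

lemma XL_0 [simp]: "XL 0 = 1"
  by (simp add: XL_def)

lemma XL_add: "XL (a + b) = XL a * XL b"
  by (rule fls_eqI) (simp add: XL_times_conv_shift, simp add: XL_def)

lemma XL_nonzero [simp]: "XL a \<noteq> 0"
  by (simp add: XL_def)

lemma XL_int: "XL (int B) = fps_to_fls (fps_X ^ B)"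
  by (rule fls_eqI) (auto simp: XL_def)

text \<open>After evaluation at T, the image of \<open>liftP\<close> gives A[pi] and the image of
  \<open>liftS\<close> gives the completed order.\<close>

abbreviation liftP :: "'a::field poly poly \<Rightarrow> 'a fls poly" where "liftP \<equiv> map_poly PL"
abbreviation liftS :: "'a::field fps poly \<Rightarrow> 'a fls poly" where "liftS \<equiv> map_poly fps_to_fls"

lemma map_poly_hom_add:
  assumes "h 0 = 0" "\<And>x y. h (x + y) = h x + h y"
  shows "map_poly h (p + p') = map_poly h p + map_poly h p'"
  by (rule poly_eqI) (simp add: coeff_map_poly assms)

lemma map_poly_hom_mult:
  fixes h :: "'a::comm_semiring_1 \<Rightarrow> 'b::comm_semiring_1"
  assumes "h 0 = 0" "\<And>x y. h (x + y) = h x + h y" "\<And>x y. h (x * y) = h x * h y"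
  shows "map_poly h (p * p') = map_poly h p * map_poly h p'"
proof (rule poly_eqI)
  have hs: "h (\<Sum>i\<in>A. u i) = (\<Sum>i\<in>A. h (u i))" for u :: "nat \<Rightarrow> 'a" and A
    by (induction A rule: infinite_finite_induct) (auto simp: assms)
  fix i show "coeff (map_poly h (p * p')) i = coeff (map_poly h p * map_poly h p') i"
    by (simp add: coeff_map_poly coeff_mult assms hs)
qed

lemma liftP_add: "liftP (p + p') = liftP p + liftP p'" and liftP_mult: "liftP (p * p') = liftP p * liftP p'"
  by (simp_all add: map_poly_hom_add map_poly_hom_mult PL_add PL_mult)

lemma liftS_add: "liftS (u + u') = liftS u + liftS u'" and liftS_mult: "liftS (u * u') = liftS u * liftS u'"
  by (simp_all add: map_poly_hom_add map_poly_hom_mult fls_times_fps_to_fls)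

lemma liftS_diff: "liftS (u - u') = liftS u - liftS u'"
  by (rule poly_eqI) (simp add: coeff_map_poly)

lemma liftP_conv_liftS: "liftP g = liftS (map_poly fps_of_poly g)"
  by (rule poly_eqI) (simp add: coeff_map_poly PL_def)

lemma degree_liftP [simp]: "degree (liftP g) = degree g"
  by (rule degree_map_poly) (metis PL_0 PL_eq_iff)

lemma degree_liftS [simp]: "degree (liftS g) = degree g"
  by (rule degree_map_poly) simp

lemma liftS_eq_iff: "liftS u = liftS u' \<longleftrightarrow> u = u'"
  by (simp add: poly_eq_iff coeff_map_poly)

text \<open>Every sufficiently large exponent is allowed, so that the coefficients can share one and
  so that it can later be taken above a prescribed bound.\<close>

lemma fls_poly_as_fps_poly:
  "\<exists>a0. \<forall>a\<ge>a0. \<exists>u. (g :: 'a::field fls poly) = smult (XL (- int a)) (liftS u)"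
proof (induction g)
  case 0
  show ?case by (intro exI[of _ 0] allI impI) simp
next
  case (pCons c g)
  then obtain a0 where a0: "\<And>a. a \<ge> a0 \<Longrightarrow> \<exists>u. g = smult (XL (- int a)) (liftS u)" by blast
  show ?case
  proof (intro exI[of _ "max a0 (nat (- fls_subdegree c))"] allI impI)
    fix a assume a: "a \<ge> max a0 (nat (- fls_subdegree c))"
    then obtain u where u: "g = smult (XL (- int a)) (liftS u)" using a0 by auto
    have "- fls_subdegree c \<le> int a" using a by linarith
    then obtain f where f: "c = fls_shift (int a) (fps_to_fls f)" using fls_as_fps by blast
    have "pCons c g = smult (XL (- int a)) (liftS (pCons f u))"
      by (simp add: u f map_poly_pCons XL_times_conv_shift)
    then show "\<exists>u. pCons c g = smult (XL (- int a)) (liftS u)" by blast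
  qed
qed

text \<open>Separates a polynomial part, to which the twisted product of k{tau} applies, from a tail
  of arbitrarily high order.\<close>

lemma liftS_truncate:
  fixes u :: "'a::field fps poly"
  obtains g0 u1 where "liftS u = liftP g0 + smult (XL (int B)) (liftS u1)" "degree g0 \<le> degree u"
proof
  have *: "c = fps_of_poly (truncate_fps B c) + fps_X ^ B * fps_shift B c" for c :: "'a fps"
    by (subst fps_of_poly_truncate, subst add.commute, rule fps_shift_cutoff'[symmetric])
  have **: "fps_to_fls c = PL (truncate_fps B c) + XL (int B) * fps_to_fls (fps_shift B c)" for c :: "'a fps"
    using arg_cong[where f = fps_to_fls, OF *[of c]] by (simp only: PL_def XL_int fps_to_fls_plus fls_times_fps_to_fls)
  show "liftS u = liftP (map_poly (truncate_fps B) u) + smult (XL (int B)) (liftS (map_poly (fps_shift B) u))"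
  proof (rule poly_eqI)
    fix i
    show "coeff (liftS u) i = coeff (liftP (map_poly (truncate_fps B) u) + smult (XL (int B)) (liftS (map_poly (fps_shift B) u))) i"
      using **[of "coeff u i"] by (simp add: coeff_map_poly del: XL_mult_nth)
  qed
  show "degree (map_poly (truncate_fps B) u) \<le> degree u"
    by (rule map_poly_degree_leq)
qed

section \<open>Evaluation at \<open>\<phi>\<^sub>T\<close>\<close>

locale drinfeld =
  fixes \<gamma> :: "'q::{finite,field} poly \<Rightarrow> 'k::{finite,field}"
    and \<pp> :: "'q poly" and \<phi> :: "'q poly \<Rightarrow> 'k poly"
    and d n r H :: nat
  assumes prime_pp: "prime_elem \<pp>" and monic_pp: "lead_coeff \<pp> = 1" and deg_pp: "degree \<pp> = d"
    and \<gamma>_hom: "\<gamma> \<in> ring_hom ring_of_type_algebra ring_of_type_algebra"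
    and \<gamma>_ker: "\<forall>a. \<gamma> a = 0 \<longleftrightarrow> \<pp> dvd a"
    and card_k: "CARD('k) = CARD('q) ^ n"
    and drin: "drinfeld_module \<gamma> r \<phi>"
    and height: "has_height \<phi> \<pp> H"
begin

lemma \<gamma>_add: "\<gamma> (a + b) = \<gamma> a + \<gamma> b" and \<gamma>_mult: "\<gamma> (a * b) = \<gamma> a * \<gamma> b" and \<gamma>_1: "\<gamma> 1 = 1"
  using ring_hom_add[OF \<gamma>_hom] ring_hom_mult[OF \<gamma>_hom] ring_hom_one[OF \<gamma>_hom]
  by (auto simp: ring_of_type_algebra_def)

definition c0 :: "'q \<Rightarrow> 'k" where "c0 c = \<gamma> [:c:]"

lemma d_pos: "d > 0"
proof (rule ccontr)
  assume "\<not> d > 0"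
  then have "degree \<pp> = 0" using deg_pp by simp
  then have "\<pp> = 1" using monic_pp by (metis degree_0_id lead_coeff_pCons(2) pCons_one degree_eq_zeroE coeff_pCons_0)
  then show False using prime_pp by simp
qed

lemma pp_nz: "\<pp> \<noteq> 0" using monic_pp by auto

lemma c0_add: "c0 (a + b) = c0 a + c0 b"
  unfolding c0_def using \<gamma>_add[of "[:a:]" "[:b:]"] by simp
lemma c0_mult: "c0 (a * b) = c0 a * c0 b"
  unfolding c0_def using \<gamma>_mult[of "[:a:]" "[:b:]"] by (simp add: mult.commute)
lemma c0_1 [simp]: "c0 1 = 1"
  unfolding c0_def using \<gamma>_1 by (simp add: one_pCons)
lemma c0_0 [simp]: "c0 0 = 0"
  using c0_add[of 0 0] by (metis add_0 add_cancel_right_right)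
lemma c0_eq_0_iff [simp]: "c0 c = 0 \<longleftrightarrow> c = 0"
proof
  assume "c0 c = 0"
  then have "\<pp> dvd [:c:]" using \<gamma>_ker by (simp add: c0_def)
  then show "c = 0" using dvd_imp_degree_le[of \<pp> "[:c:]"] d_pos deg_pp by auto
qed simp
lemma c0_minus: "c0 (- a) = - c0 a"
  using c0_add[of a "- a"] by (simp add: add_eq_0_iff)
lemma c0_diff: "c0 (a - b) = c0 a - c0 b"
  using c0_add[of a "- b"] by (simp add: c0_minus)
lemma c0_power: "c0 (a ^ i) = c0 a ^ i"
  by (induction i) (simp_all add: c0_mult)
lemma c0_of_nat: "c0 (of_nat m) = of_nat m"
  by (induction m) (simp_all add: c0_add)

lemma q_gt0: "CARD('q) > 0" by (simp add: finite_UNIV_card_ge_0)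

text \<open>F_q embeds in k through \<open>c0\<close>, so the binomial coefficients that vanish in
  F_q vanish in k as well.\<close>

lemma frob_additive: "(x + y :: 'k) ^ CARD('q) = x ^ CARD('q) + y ^ CARD('q)"
proof -
  have "(x + y) ^ CARD('q) = (\<Sum>j\<le>CARD('q). of_nat (CARD('q) choose j) * x ^ j * y ^ (CARD('q) - j))"
    by (rule binomial_ring)
  also have "\<dots> = (\<Sum>j\<in>{0,CARD('q)}. of_nat (CARD('q) choose j) * x ^ j * y ^ (CARD('q) - j))"
  proof (rule sum.mono_neutral_right; (intro ballI)?)
    fix j assume "j \<in> {..CARD('q)} - {0, CARD('q)}"
    then have "c0 (of_nat (CARD('q) choose j)) = 0" by (simp add: binomial_CARD_eq_0)
    then have "of_nat (CARD('q) choose j) = (0 :: 'k)" by (simp only: c0_of_nat)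
    then show "of_nat (CARD('q) choose j) * x ^ j * y ^ (CARD('q) - j) = 0" by simp
  qed auto
  also have "\<dots> = x ^ CARD('q) + y ^ CARD('q)" using q_gt0 by simp
  finally show ?thesis .
qed

sublocale frobenius "CARD('q)" "TYPE('k)"
  by unfold_locales (use q_gt0 frob_additive in auto)

lemma n_pos: "n > 0"
proof (rule ccontr)
  assume "\<not> n > 0"
  then have "CARD('k) = 1" using card_k by simp
  then obtain x :: 'k where "UNIV = {x}" by (auto simp: card_1_singleton_iff)
  then have "(0::'k) = 1" by (metis UNIV_I singletonD)
  then show False by simp
qed

text \<open>Together with \<open>frob_n\<close> this makes F_q[pi] central: tau commutes with the
  constants from F_q, and tau^n commutes with all of k.\<close>

lemma c0_frob [simp]: "c0 c ^ (CARD('q) ^ i) = c0 c"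
proof (induction i)
  case (Suc i)
  have "c0 c ^ (CARD('q) ^ Suc i) = (c0 c ^ (CARD('q) ^ i)) ^ CARD('q)"
    by (simp add: mult.commute[of "CARD('q)"] power_mult)
  then show ?case using Suc by (simp add: power_CARD_eq_self flip: c0_power)
qed simp

lemma frob_n [simp]: "(x :: 'k) ^ (CARD('q) ^ (n * i)) = x"
proof (induction i)
  case (Suc i)
  have "x ^ (CARD('q) ^ (n * Suc i)) = (x ^ (CARD('q) ^ (n * i))) ^ (CARD('q) ^ n)"
    by (simp add: power_add mult.commute flip: power_mult)
  then show ?case using Suc by (simp add: power_CARD_eq_self flip: card_k)
qed simp

lemma frob_dvd: "n dvd i \<Longrightarrow> (x :: 'k) ^ (CARD('q) ^ i) = x"
  by auto

section \<open>The embeddings of F_q[pi] and F_q((pi)) given by pi = tau^n\<close>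

definition iota :: "'q poly \<Rightarrow> 'k poly" where "iota c = Fq_pi_incl \<gamma> n c"

lemma coeff_iota: "coeff (iota c) m = (if n dvd m then c0 (coeff c (m div n)) else 0)"
proof -
  have "coeff (iota c) m = (\<Sum>i\<le>degree c. if n * i = m then c0 (coeff c i) else 0)"
    by (simp add: iota_def Fq_pi_incl_def coeff_sum c0_def cong: if_cong)
  also have "\<dots> = (if n dvd m then c0 (coeff c (m div n)) else 0)"
  proof (cases "n dvd m")
    case True
    then obtain k where k: "m = n * k" by auto
    have "(n * i = m) = (i = k)" for i using n_pos k by simp
    then show ?thesis using n_pos k by (auto simp: coeff_eq_0)
  next
    case False
    then show ?thesis by (auto intro!: sum.neutral)
  qed
  finally show ?thesis .
qed

text \<open>The embedding of F_q((pi)) in k((tau)) with pi = tau^n. It multiplies orders by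
  n.\<close>

definition iotaL :: "'q fls \<Rightarrow> 'k fls" where "iotaL f = fls_compose_power (map_fls c0 f) n"

lemma iotaL_nth: "iotaL f $$ m = (if int n dvd m then c0 (f $$ (m div int n)) else 0)"
  using n_pos by (simp add: iotaL_def fls_nth_compose_power nth_map_fls)

lemma iotaL_add: "iotaL (f + g) = iotaL f + iotaL g"
  by (rule fls_eqI) (simp add: iotaL_nth c0_add)
lemma iotaL_diff: "iotaL (f - g) = iotaL f - iotaL g"
  by (rule fls_eqI) (simp add: iotaL_nth c0_diff)
lemma iotaL_0 [simp]: "iotaL 0 = 0"
  by (rule fls_eqI) (simp add: iotaL_nth)
lemma iotaL_mult: "iotaL (f * g) = iotaL f * iotaL g"
  unfolding iotaL_def by (subst map_fls_mult) (auto simp: c0_add c0_mult)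
lemma iotaL_1 [simp]: "iotaL 1 = 1"
  by (rule fls_eqI) (use n_pos in \<open>auto simp: iotaL_nth elim!: dvdE\<close>)
lemma iotaL_eq_0_iff [simp]: "iotaL f = 0 \<longleftrightarrow> f = 0"
proof
  assume *: "iotaL f = 0"
  have "f $$ m = 0" for m
    using iotaL_nth[of f "int n * m"] n_pos by (simp add: *)
  then show "f = 0" by (intro fls_eqI) simp
qed simp

lemma iotaL_XL: "iotaL (XL a) = XL (int n * a)"
  by (rule fls_eqI) (use n_pos in \<open>auto simp: iotaL_nth XL_def elim!: dvdE\<close>)

lemma iotaL_fps: "\<exists>w. iotaL (fps_to_fls f) = fps_to_fls w"
proof
  show "iotaL (fps_to_fls f) = fps_to_fls (Abs_fps (\<lambda>m. iotaL (fps_to_fls f) $$ int m))"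
  proof (rule fls_eqI)
    fix m :: int
    show "iotaL (fps_to_fls f) $$ m = fps_to_fls (Abs_fps (\<lambda>m. iotaL (fps_to_fls f) $$ int m)) $$ m"
    proof (cases "m < 0")
      case True
      then show ?thesis using n_pos by (simp add: iotaL_nth pos_imp_zdiv_neg_iff)
    next
      case False
      then obtain k where "m = int k" by (metis not_less zero_le_imp_eq_int)
      then show ?thesis by (simp add: iotaL_nth flip: zdiv_int)
    qed
  qed
qed

lemma iotaL_PL: "iotaL (PL c) = PL (iota c)"
proof (rule fls_eqI)
  fix m :: int
  show "iotaL (PL c) $$ m = PL (iota c) $$ m"
  proof (cases "m < 0")
    case True
    then show ?thesis using n_pos by (simp add: iotaL_nth PL_nth pos_imp_zdiv_neg_iff)
  next
    case False
    then obtain k where "m = int k" by (metis not_less zero_le_imp_eq_int)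
    then show ?thesis by (simp add: iotaL_nth PL_nth coeff_iota flip: zdiv_int)
  qed
qed

text \<open>Multiplicativity is inherited from \<open>iotaL\<close>, because \<open>PL\<close> is
  injective and intertwines the two maps.\<close>

lemma iota_add: "iota (a + b) = iota a + iota b" and iota_mult: "iota (a * b) = iota a * iota b"
  and iota_1 [simp]: "iota 1 = 1" and iota_0 [simp]: "iota 0 = 0"
proof -
  show "iota (a * b) = iota a * iota b" using iotaL_mult[of "PL a" "PL b"]
    by (simp add: iotaL_PL PL_eq_iff flip: PL_mult)
  show "iota 1 = 1" using iotaL_1 iotaL_PL[of 1] by (simp add: PL_eq_iff flip: PL_1)
qed (rule poly_eqI; simp add: coeff_iota c0_add)+

lemma iota_const: "iota [:c:] = [:c0 c:]"
  by (rule poly_eqI) (use n_pos in \<open>auto simp: coeff_iota coeff_pCons split: nat.splits elim!: dvdE\<close>)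

lemma iota_X: "iota (monom 1 i) = monom 1 (n * i)"
proof (rule poly_eqI)
  fix m
  show "coeff (iota (monom 1 i)) m = coeff (monom 1 (n * i)) m"
    using n_pos by (cases "n dvd m") (auto simp: coeff_iota elim!: dvdE)
qed

lemma iota_eq_0_iff [simp]: "iota c = 0 \<longleftrightarrow> c = 0"
  using iotaL_eq_0_iff[of "PL c"] by (metis PL_0 PL_eq_iff iotaL_PL)

text \<open>The nonzero coefficients of \<open>iota c\<close> sit in degrees divisible by n, where
  the twist is trivial. In \<open>tw_iota_right\<close> the reason is different: there the
  coefficients lie in F_q and are fixed by the twist.\<close>

lemma tw_iota_left: "tw (iota c) f = iota c * f"
proof (rule poly_eqI)
  fix m
  have "coeff (iota c) i * coeff f (m - i) ^ (CARD('q) ^ i) = coeff (iota c) i * coeff f (m - i)" for i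
    by (simp add: coeff_iota frob_dvd)
  then show "coeff (tw (iota c) f) m = coeff (iota c * f) m"
    by (simp only: coeff_tw coeff_mult)
qed

lemma tw_iota_right: "tw f (iota c) = iota c * f"
proof (rule poly_eqI)
  fix m
  have "coeff (iota c) i ^ (CARD('q) ^ j) = coeff (iota c) i" for i j
    by (simp add: coeff_iota)
  then show "coeff (tw f (iota c)) m = coeff (iota c * f) m"
    unfolding mult.commute[of "iota c"] by (simp add: coeff_tw coeff_mult)
qed

lemma tw_iota_mult: "tw (iota c * f) g = iota c * tw f g" "tw f (iota c * g) = iota c * tw f g"
proof -
  show "tw (iota c * f) g = iota c * tw f g" by (metis tw_iota_left tw_assoc)
  show "tw f (iota c * g) = iota c * tw f g" by (metis tw_iota_left tw_iota_right tw_assoc)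
qed

section \<open>The Drinfeld module and polynomials in T\<close>

lemma \<phi>_add: "\<phi> (a + b) = \<phi> a + \<phi> b" and \<phi>_mult: "\<phi> (a * b) = tw (\<phi> a) (\<phi> b)" and \<phi>_1: "\<phi> 1 = 1"
  and coeff_\<phi>_0: "coeff (\<phi> a) 0 = \<gamma> a"
proof -
  have h: "\<phi> \<in> ring_hom ring_of_type_algebra (twisted_poly_ring CARD('q))" using drin by (simp add: drinfeld_module_def)
  show "\<phi> (a + b) = \<phi> a + \<phi> b" "\<phi> (a * b) = tw (\<phi> a) (\<phi> b)" "\<phi> 1 = 1"
    using ring_hom_add[OF h] ring_hom_mult[OF h] ring_hom_one[OF h]
    by (auto simp: ring_of_type_algebra_def twisted_poly_ring_def)
  show "coeff (\<phi> a) 0 = \<gamma> a" using drin by (simp add: drinfeld_module_def)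
qed

lemma \<phi>_0 [simp]: "\<phi> 0 = 0"
  using \<phi>_add[of 0 0] by (metis add_0 add_cancel_right_right)

text \<open>The degree formula makes the value a constant, and its constant coefficient is known
  from the structure map.\<close>

lemma \<phi>_const: "\<phi> [:c:] = iota [:c:]"
proof -
  have "degree (\<phi> [:c:]) = 0" using drin by (cases "c = 0") (auto simp: drinfeld_module_def)
  then have "\<phi> [:c:] = [:coeff (\<phi> [:c:]) 0:]" by (metis degree_eq_zeroE coeff_pCons_0)
  then show ?thesis by (simp add: coeff_\<phi>_0 c0_def iota_const)
qed

definition T :: "nat \<Rightarrow> 'k poly" where "T j = \<phi> (monom 1 j)"

lemma T_0 [simp]: "T 0 = 1" by (simp add: T_def \<phi>_1 monom_0 flip: one_pCons)
lemma T_Suc: "T (Suc j) = tw (\<phi> [:0,1:]) (T j)" by (simp add: T_def monom_Suc flip: \<phi>_mult)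

text \<open>\<open>ev g = g(\<phi>\<^sub>T)\<close>; the commutative product agrees with the twisted one here because \<open>iota\<close> has
  central values.\<close>

definition ev :: "'q poly poly \<Rightarrow> 'k poly" where
  "ev g = (\<Sum>j\<le>degree g. iota (coeff g j) * T j)"

lemma ev_bound: "degree g \<le> m \<Longrightarrow> ev g = (\<Sum>j\<le>m. iota (coeff g j) * T j)"
  unfolding ev_def by (rule sum.mono_neutral_left) (auto simp: coeff_eq_0)

lemma ev_add: "ev (g + h) = ev g + ev h"
proof -
  define m where "m = max (degree g) (degree h)"
  have "degree g \<le> m" "degree h \<le> m" "degree (g + h) \<le> m"
    by (simp_all add: m_def degree_add_le_max)
  then show ?thesis
    by (simp only: ev_bound coeff_add iota_add distrib_right sum.distrib)
qed

lemma ev_0 [simp]: "ev 0 = 0" by (simp add: ev_def)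
lemma ev_minus: "ev (- g) = - ev g" using ev_add[of g "- g"] by (simp add: add_eq_0_iff)
lemma ev_diff: "ev (g - h) = ev g - ev h" using ev_add[of g "- h"] by (simp add: ev_minus)
lemma ev_smult: "ev (smult c g) = iota c * ev g"
  using ev_bound[of "smult c g" "degree g"] by (simp add: ev_def sum_distrib_left iota_mult mult.assoc)

lemma tw_sum_right: "tw f (\<Sum>i\<in>A. g i) = (\<Sum>i\<in>A. tw f (g i))"
  by (induction A rule: infinite_finite_induct) (simp_all add: tw_add_right)

lemma ev_pCons: "ev (pCons a g) = iota a + tw (\<phi> [:0,1:]) (ev g)"
proof -
  have "ev (pCons a g) = (\<Sum>j\<le>Suc (degree g). iota (coeff (pCons a g) j) * T j)"
    by (rule ev_bound) (simp add: degree_pCons_eq_if)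
  also have "\<dots> = iota a + (\<Sum>j\<le>degree g. iota (coeff g j) * tw (\<phi> [:0,1:]) (T j))"
    by (subst sum.atMost_Suc_shift) (simp add: T_Suc)
  also have "(\<Sum>j\<le>degree g. iota (coeff g j) * tw (\<phi> [:0,1:]) (T j)) = tw (\<phi> [:0,1:]) (ev g)"
    by (simp add: ev_def tw_sum_right tw_iota_mult)
  finally show ?thesis .
qed

text \<open>Multiplicative although k{tau} is not commutative: the coefficients are central, and the
  Horner form \<open>ev_pCons\<close> reduces the claim to associativity.\<close>

lemma ev_mult: "ev (g * h) = tw (ev g) (ev h)"
  by (induction g)
     (simp_all add: ev_add ev_smult ev_pCons tw_add_left tw_iota_left tw_assoc)

lemma ev_1 [simp]: "ev 1 = 1" by (simp add: ev_def)

lemma ev_const: "ev [:c:] = iota c" by (simp add: ev_def)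

lemma ev_lift: "ev (map_poly (\<lambda>c. [:c:]) a) = \<phi> a"
proof (induction a)
  case (pCons c a)
  have "pCons c a = [:c:] + [:0, 1:] * a" by simp
  then have "\<phi> (pCons c a) = iota [:c:] + tw (\<phi> [:0,1:]) (\<phi> a)" by (simp only: \<phi>_add \<phi>_mult \<phi>_const)
  then show ?case using pCons by (simp add: map_poly_pCons ev_pCons)
qed simp

text \<open>The values \<open>g(\<phi>\<^sub>T)\<close> in \<open>k((\<tau>))\<close>, as elements of the commutative ring \<open>'k fls\<close>: since
  \<open>F\<^sub>q((\<pi>))\<close> is central, multiplication by its elements is the same in both rings, and \<open>Phi\<close> is
  linear. It is not multiplicative for the commutative product; the valuation of a product is
  obtained in \<open>Phi_mult_low\<close> by approximation with polynomials.\<close>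

definition Phi :: "'q fls poly \<Rightarrow> 'k fls" where
  "Phi g = (\<Sum>j\<le>degree g. iotaL (coeff g j) * PL (T j))"

lemma Phi_bound: "degree g \<le> m \<Longrightarrow> Phi g = (\<Sum>j\<le>m. iotaL (coeff g j) * PL (T j))"
  unfolding Phi_def by (rule sum.mono_neutral_left) (auto simp: coeff_eq_0)

lemma Phi_add: "Phi (g + h) = Phi g + Phi h"
proof -
  define m where "m = max (degree g) (degree h)"
  have "degree g \<le> m" "degree h \<le> m" "degree (g + h) \<le> m"
    by (simp_all add: m_def degree_add_le_max)
  then show ?thesis
    by (simp only: Phi_bound coeff_add iotaL_add distrib_right sum.distrib)
qed

lemma Phi_0 [simp]: "Phi 0 = 0" by (simp add: Phi_def)
lemma Phi_minus: "Phi (- g) = - Phi g" using Phi_add[of g "- g"] by (simp add: add_eq_0_iff)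
lemma Phi_diff: "Phi (g - h) = Phi g - Phi h" using Phi_add[of g "- h"] by (simp add: Phi_minus)
lemma Phi_smult: "Phi (smult c g) = iotaL c * Phi g"
  using Phi_bound[of "smult c g" "degree g"] by (simp add: Phi_def sum_distrib_left iotaL_mult mult.assoc)
lemma Phi_const: "Phi [:c:] = iotaL c" by (simp add: Phi_def)
lemma Phi_monom: "Phi (monom c j) = iotaL c * PL (T j)"
  by (cases "c = 0") (simp_all add: Phi_def degree_monom_eq if_distrib if_distribR sum.delta cong: if_cong)

lemma Phi_liftP: "Phi (liftP g) = PL (ev g)"
  by (simp add: Phi_def ev_def PL_sum PL_mult iotaL_PL coeff_map_poly)

lemma Phi_liftS_nth: "i < 0 \<Longrightarrow> Phi (liftS u) $$ i = 0"
proof -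
  obtain w where w: "\<And>f. iotaL (fps_to_fls f) = fps_to_fls (w f)" using iotaL_fps by metis
  have "Phi (liftS u) = fps_to_fls (\<Sum>j\<le>degree u. w (coeff u j) * fps_of_poly (T j))"
  proof -
    have s: "fps_to_fls (\<Sum>j\<in>A. v j) = (\<Sum>j\<in>A. fps_to_fls (v j))" for A and v :: "nat \<Rightarrow> 'k fps"
      by (induction A rule: infinite_finite_induct) simp_all
    show ?thesis by (simp add: Phi_def s coeff_map_poly w PL_def fls_times_fps_to_fls)
  qed
  then show "Phi (liftS u) $$ i = 0" if "i < 0" using that by simp
qed

end

section \<open>Valuations of products\<close>

text \<open>For a monic divisor the multiplier in pseudo-division is 1, so the division is available
  over any domain, in particular over F_q[pi] and F_q[[pi]].\<close>

lemma monic_division: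
  fixes P f :: "'a::idom poly"
  assumes "lead_coeff P = 1" "degree P > 0"
  obtains s t where "f = P * s + t" "degree t < degree P"
proof -
  obtain s t where st: "pseudo_divmod f P = (s, t)" by force
  have "P \<noteq> 0" using assms by auto
  from pseudo_divmod[OF this st] assms show ?thesis
    by (intro that[of s t]) auto
qed

section \<open>Finiteness arguments over a finite field\<close>

lemma finite_poly_degree_less: "finite {p :: 'a::{finite,zero} poly. degree p < E}"
proof (rule finite_subset)
  show "{p :: 'a poly. degree p < E} \<subseteq> Poly ` {xs. set xs \<subseteq> UNIV \<and> length xs \<le> E}"
  proof
    fix p :: "'a poly" assume "p \<in> {p. degree p < E}"
    then have "length (coeffs p) \<le> E" by (cases "p = 0") (simp_all add: length_coeffs_degree)
    then show "p \<in> Poly ` {xs. set xs \<subseteq> UNIV \<and> length xs \<le> E}"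
      by (intro image_eqI[of _ _ "coeffs p"]) simp_all
  qed
  show "finite (Poly ` {xs :: 'a list. set xs \<subseteq> UNIV \<and> length xs \<le> E})"
    by (intro finite_imageI finite_lists_length_le) simp
qed

lemma finite_uniform_bound:
  assumes "finite S" "\<And>x. x \<in> S \<Longrightarrow> \<exists>c::nat. Q c x" "\<And>c c' x. Q c x \<Longrightarrow> c \<le> c' \<Longrightarrow> Q c' x"
  shows "\<exists>c. \<forall>x\<in>S. Q c x"
  using assms(1,2)
proof (induction S rule: finite_induct)
  case (insert x S)
  then obtain c c' where "\<forall>y\<in>S. Q c y" "Q c' x" by blast
  then have "\<forall>y\<in>insert x S. Q (max c c') y" using assms(3) by auto
  then show ?case by blast
qed auto

lemma bounded_incseq_stationary:
  fixes f :: "nat \<Rightarrow> nat"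
  assumes "\<And>e. f e \<le> f (Suc e)" "\<And>e. f e \<le> b"
  shows "\<exists>E. \<forall>e\<ge>E. f (Suc e) = f e"
proof -
  have fin: "finite (range f)" by (rule finite_subset[of _ "{..b}"]) (use assms(2) in auto)
  then have "Max (range f) \<in> range f" by (intro Max_in) auto
  then obtain E where E: "f E = Max (range f)" by (metis imageE)
  have eq: "f e = f E" if "e \<ge> E" for e
  proof (rule le_antisym)
    show "f e \<le> f E" unfolding E using fin by (intro Max_ge) auto
    show "f E \<le> f e" using that using lift_Suc_mono_le[of f E e] assms(1) by simp
  qed
  show ?thesis
  proof (intro exI allI impI)
    fix e assume "E \<le> e"
    then show "f (Suc e) = f e" using eq[of e] eq[of "Suc e"] by linarith
  qed
qed

text \<open>The sets of leading coefficients in a given degree increase along each residue class modulo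
  \<open>n\<close>, so they stabilise because the field is finite.\<close>

lemma shift_closed_generated:
  fixes M :: "'a::{finite,field} poly set"
  assumes n: "n > 0" and diff: "\<And>x y. x \<in> M \<Longrightarrow> y \<in> M \<Longrightarrow> x - y \<in> M"
    and shift: "\<And>x. x \<in> M \<Longrightarrow> monom 1 n * x \<in> M"
  shows "\<exists>E. \<forall>G. (\<forall>x\<in>G. \<forall>y\<in>G. x + y \<in> G) \<longrightarrow> (\<forall>x\<in>G. monom 1 n * x \<in> G) \<longrightarrow>
           {x\<in>M. degree x < E} \<subseteq> G \<longrightarrow> M \<subseteq> G"
proof -
  define LC where "LC e = {coeff x e | x. x \<in> M \<and> degree x \<le> e}" for e
  have LC_mono: "LC e \<subseteq> LC (e + n)" for e
  proof
    fix c assume "c \<in> LC e"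
    then obtain x where x: "x \<in> M" "degree x \<le> e" "c = coeff x e" by (auto simp: LC_def)
    have "degree (monom 1 n * x) \<le> e + n"
      using degree_mult_le[of "monom 1 n" x] degree_monom_le[of "1::'a" n] x by linarith
    moreover have "coeff (monom 1 n * x) (e + n) = c" using x by (simp add: coeff_monom_mult)
    ultimately show "c \<in> LC (e + n)" using shift[OF x(1)] unfolding LC_def by blast
  qed
  \<comment> \<open>Passing from e to e + 1 replaces \<open>card (LC e)\<close> by
    \<open>card (LC (e + n))\<close>, so this single bounded monotone sequence controls all residue
    classes modulo n at once.\<close>
  define f where "f e = (\<Sum>j<n. card (LC (e + j)))" for e
  have f_Suc: "f (Suc e) + card (LC e) = f e + card (LC (e + n))" for e
  proof -
    have "f (Suc e) = (\<Sum>j<n. card (LC (e + Suc j)))" by (simp add: f_def)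
    then have "f (Suc e) + card (LC e) = (\<Sum>j<Suc n. card (LC (e + j)))"
      by (subst sum.lessThan_Suc_shift) simp
    then show ?thesis by (simp add: f_def)
  qed
  have card_le: "card (LC e) \<le> card (LC (e + n))" for e
    using LC_mono by (intro card_mono) auto
  have "\<exists>E. \<forall>e\<ge>E. f (Suc e) = f e"
  proof (rule bounded_incseq_stationary)
    show "f e \<le> f (Suc e)" for e using f_Suc[of e] card_le[of e] by linarith
    have "card (LC (e + j)) \<le> CARD('a)" for e j by (rule card_mono) auto
    then have "f e \<le> (\<Sum>j<n. CARD('a))" for e unfolding f_def by (intro sum_mono) auto
    then show "f e \<le> n * CARD('a)" for e by simp
  qed
  then obtain E where E: "\<And>e. e \<ge> E \<Longrightarrow> f (Suc e) = f e" by blast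
  have LC_eq: "LC (e + n) = LC e" if "e \<ge> E" for e
    using f_Suc[of e] E[OF that] LC_mono[of e] by (metis add_left_cancel card_subset_eq finite)
  show ?thesis
  \<comment> \<open>An element of degree at least E + n has degree e + n with e >= E, and there its
    leading coefficient already occurs in degree e.\<close>
  proof (intro exI[of _ "E + n"] allI impI subsetI)
    fix G x
    assume add: "\<forall>x\<in>G. \<forall>y\<in>G. x + y \<in> G" and sh: "\<forall>x\<in>G. monom 1 n * x \<in> G"
      and base: "{x\<in>M. degree x < E + n} \<subseteq> G" and "x \<in> M"
    from \<open>x \<in> M\<close> show "x \<in> G"
    proof (induction "degree x" arbitrary: x rule: less_induct)
      case less
      show ?case
      proof (cases "degree x < E + n")
        case True
        then show ?thesis using base less.prems by auto
      next
        case False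
        define e where "e = degree x - n"
        have e: "degree x = e + n" "e \<ge> E" using False by (auto simp: e_def)
        have "coeff x (e + n) \<in> LC (e + n)" using less.prems e unfolding LC_def by auto
        then have "coeff x (e + n) \<in> LC e" using LC_eq e by simp
        then obtain y where y: "y \<in> M" "degree y \<le> e" "coeff x (e + n) = coeff y e" by (auto simp: LC_def)
        \<comment> \<open>The shifted \<open>y\<close> cancels the top coefficient; both
          \<open>y\<close> and \<open>z\<close> have smaller degree than \<open>x\<close>.\<close>
        define z where "z = x - monom 1 n * y"
        have z: "z \<in> M" unfolding z_def by (intro diff shift less.prems y)
        have dz: "degree z \<le> e + n" unfolding z_def
          by (rule degree_diff_le) (use e y degree_mult_le[of "monom 1 n" y] degree_monom_le[of "1::'a" n] in linarith)+
        have "coeff z (e + n) = 0" using y by (simp add: z_def coeff_monom_mult)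
        then have "degree z < e + n"
          using dz n by (metis add_gr_0 degree_0 leading_coeff_0_iff le_neq_implies_less)
        then have "z \<in> G" using less.hyps z e by simp
        moreover have "y \<in> G" using less.hyps[of y] y n e by simp
        ultimately have "z + monom 1 n * y \<in> G" using add sh by blast
        then show ?thesis by (simp add: z_def)
      qed
    qed
  qed
qed

text \<open>A divisor of least positive degree cannot be split further.\<close>

lemma exists_irreducible_divisor:
  fixes c :: "'a::field poly"
  assumes "degree c > 0"
  obtains l where "Factorial_Ring.irreducible l" "l dvd c" "degree l > 0"
proof -
  define l where "l = arg_min degree (\<lambda>l. l dvd c \<and> degree l > 0)"
  have l: "l dvd c" "degree l > 0" and min: "\<And>a. a dvd c \<Longrightarrow> degree a > 0 \<Longrightarrow> degree l \<le> degree a"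
    using arg_min_natI[of "\<lambda>l. l dvd c \<and> degree l > 0" c degree]
      arg_min_nat_le[of "\<lambda>l. l dvd c \<and> degree l > 0" _ degree] assms
    by (auto simp: l_def)
  have "Factorial_Ring.irreducible l"
  proof (rule Factorial_Ring.irreducibleI)
    show "l \<noteq> 0" using l(2) by auto
    then show "\<not> l dvd 1" using l(2) is_unit_iff_degree[of l] by simp
    fix a b assume ab: "l = a * b"
    show "a dvd 1 \<or> b dvd 1"
    proof (rule ccontr)
      assume "\<not> (a dvd 1 \<or> b dvd 1)"
      moreover have nz: "a \<noteq> 0" "b \<noteq> 0" using ab l by auto
      ultimately have "degree a > 0" "degree b > 0" by (auto simp: is_unit_iff_degree)
      moreover have "degree l = degree a + degree b" using ab nz by (simp add: degree_mult_eq)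
      moreover have "a dvd c" using ab l by (metis dvd_mult_left)
      ultimately show False using min[of a] by simp
    qed
  qed
  with l show ?thesis using that by blast
qed

section \<open>Additivity of the tau-adic order on values of polynomials at T\<close>

context drinfeld
begin

text \<open>Clearing denominators and cutting the coefficients off at pi^B changes nothing up to the
  degree of interest. There \<open>ev (g0 * h0)\<close> is a genuine twisted product, to which
  \<open>coeff_tw_low\<close> applies.\<close>

lemma Phi_mult_low:
  assumes "\<And>i. i < m \<Longrightarrow> Phi g $$ i = 0" "\<And>i. i < m' \<Longrightarrow> Phi h $$ i = 0"
  shows "i < m + m' \<Longrightarrow> Phi (g * h) $$ i = 0"
    and "Phi (g * h) $$ (m + m') = 0 \<longleftrightarrow> Phi g $$ m = 0 \<or> Phi h $$ m' = 0"
proof -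
  have rep: "\<exists>a u. g = smult (XL (- int a)) (liftS u) \<and> m + int (n * a) \<ge> 0" for g m
  proof -
    obtain a0 where a0: "\<forall>a\<ge>a0. \<exists>u. g = smult (XL (- int a)) (liftS u)" using fls_poly_as_fps_poly by blast
    \<comment> \<open>At least |m|, so that multiplication by pi^a raises the order m to a natural
      number.\<close>
    define a where "a = max a0 (nat \<bar>m\<bar>)"
    have "int (n * a) \<ge> int (1 * nat \<bar>m\<bar>)"
      using n_pos unfolding of_nat_le_iff by (intro mult_mono) (auto simp: a_def)
    moreover obtain u where "g = smult (XL (- int a)) (liftS u)"
      using a0[rule_format, of a] by (auto simp: a_def)
    ultimately show ?thesis by (intro exI[of _ a] exI[of _ u]) auto
  qed
  obtain a u where g: "g = smult (XL (- int a)) (liftS u)" and a: "m + int (n * a) \<ge> 0" using rep by blast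
  obtain a' u' where h: "h = smult (XL (- int a')) (liftS u')" and a': "m' + int (n * a') \<ge> 0" using rep by blast
  define s s' where "s = nat (m + int (n * a))" and "s' = nat (m' + int (n * a'))"
  \<comment> \<open>This gives n B > s + s', so all tails start above the decisive degree s +
    s'.\<close>
  define B where "B = s + s' + 1"
  have sI: "int s = m + int (n * a)" and s'I: "int s' = m' + int (n * a')" using a a' by (simp_all add: s_def s'_def)
  have "s + s' < n * B" using n_pos unfolding B_def by (cases n) auto
  then have nB: "int s + int s' < int (n * B)" by linarith
  have naa: "int (n * (a + a')) = int (n * a) + int (n * a')" by (simp add: algebra_simps)
  obtain g0 u1 where u: "liftS u = liftP g0 + smult (XL (int B)) (liftS u1)" using liftS_truncate by blast
  obtain h0 u1' where u': "liftS u' = liftP h0 + smult (XL (int B)) (liftS u1')" using liftS_truncate by blast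
  have trunc: "Phi (liftP v + smult (XL (int B)) (liftS w)) $$ i = PL (ev v) $$ i" if "i < int (n * B)" for v w i
    using that by (simp add: Phi_add Phi_liftP Phi_smult iotaL_XL Phi_liftS_nth)
  have sc: "Phi (smult (XL (- int b)) v) $$ i = Phi v $$ (i + int (n * b))" for b v i
    by (simp add: Phi_smult iotaL_XL)
  have gi: "Phi g $$ i = PL (ev g0) $$ (i + int (n * a))" if "i \<le> m" for i
    unfolding g sc u by (rule trunc) (use that nB sI in linarith)
  have hi: "Phi h $$ i = PL (ev h0) $$ (i + int (n * a'))" if "i \<le> m'" for i
    unfolding h sc u' by (rule trunc) (use that nB s'I in linarith)
  have g0: "coeff (ev g0) i = 0" if "i < s" for i
    using gi[of "int i - int (n * a)"] assms(1)[of "int i - int (n * a)"] that by (simp add: PL_nth s_def)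
  have h0: "coeff (ev h0) i = 0" if "i < s'" for i
    using hi[of "int i - int (n * a')"] assms(2)[of "int i - int (n * a')"] that by (simp add: PL_nth s'_def)
  have gs: "coeff (ev g0) s = Phi g $$ m" using gi[of m] a by (simp add: PL_nth s_def)
  have hs: "coeff (ev h0) s' = Phi h $$ m'" using hi[of m'] a' by (simp add: PL_nth s'_def)
  define w where "w = map_poly fps_of_poly g0 * u1' + u1 * u'"
  have prod: "liftS u * liftS u' = liftP (g0 * h0) + smult (XL (int B)) (liftS w)"
  proof -
    have "liftS u * liftS u' = liftP g0 * liftS u' + smult (XL (int B)) (liftS u1 * liftS u')"
      by (subst u) (simp add: distrib_right)
    also have "liftP g0 * liftS u' = liftP (g0 * h0) + smult (XL (int B)) (liftP g0 * liftS u1')"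
      by (subst u') (simp add: distrib_left liftP_mult)
    also have "liftP g0 * liftS u1' = liftS (map_poly fps_of_poly g0 * u1')"
      by (simp add: liftS_mult liftP_conv_liftS)
    finally show ?thesis by (simp add: w_def liftS_add liftS_mult smult_add_right add.assoc)
  qed
  have "g * h = smult (XL (- int (a + a'))) (liftS u * liftS u')"
    by (simp add: g h mult.commute add.commute flip: XL_add)
  then have gh: "Phi (g * h) $$ i = PL (tw (ev g0) (ev h0)) $$ (i + int (n * (a + a')))" if "i \<le> m + m'" for i
    unfolding prod
    by (simp only: sc) (subst trunc, use that nB sI s'I naa in linarith, simp only: ev_mult)
  show "Phi (g * h) $$ i = 0" if "i < m + m'"
  proof -
    have "Phi (g * h) $$ i = PL (tw (ev g0) (ev h0)) $$ (i + int (n * (a + a')))" using that by (intro gh) simp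
    also have "\<dots> = 0"
      using coeff_tw_low(1)[of s "ev g0" s' "ev h0" "nat (i + int (n * (a + a')))", OF g0 h0] that a a'
      by (simp add: PL_nth s_def s'_def nat_less_iff algebra_simps)
    finally show ?thesis .
  qed
  have "Phi (g * h) $$ (m + m') = PL (tw (ev g0) (ev h0)) $$ (int (s + s'))"
    using gh[of "m + m'"] a a' by (simp add: s_def s'_def algebra_simps)
  also have "\<dots> = coeff (ev g0) s * coeff (ev h0) s' ^ (CARD('q) ^ s)"
    using coeff_tw_low(2)[of s "ev g0" s' "ev h0", OF g0 h0] by (simp add: PL_nth flip: of_nat_add)
  finally show "Phi (g * h) $$ (m + m') = 0 \<longleftrightarrow> Phi g $$ m = 0 \<or> Phi h $$ m' = 0"
    using q_gt0 by (simp add: gs hs)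
qed

end

section \<open>The minimal polynomial of \<open>\<phi>\<^sub>T\<close>\<close>

lemma liftS_smult: "liftS (smult f u) = smult (fps_to_fls f) (liftS u)"
  by (rule poly_eqI) (simp add: coeff_map_poly fls_times_fps_to_fls)

lemma liftP_smult: "liftP (smult f u) = smult (PL f) (liftP u)"
  by (rule poly_eqI) (simp add: coeff_map_poly PL_mult)

lemma PL_monom: "PL (monom 1 i) = XL (int i)"
  by (simp add: PL_def XL_int fps_of_poly_monom')

lemma smult_left_cancel:
  fixes x y :: "'a::idom poly"
  shows "smult l x = smult l y \<Longrightarrow> l \<noteq> 0 \<Longrightarrow> x = y"
  by (simp add: poly_eq_iff)

context drinfeld
begin

lemma iota_monom_mult_ev: "monom 1 (n * i) * ev g = ev (smult (monom 1 i) g)"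
  by (simp add: ev_smult iota_X)

text \<open>The finiteness lemma is applied to the image of \<open>ev\<close> itself. Its finitely
  many generators over F_q[pi] involve only powers of T up to some J, hence so does every element,
  and expressing T^(J+1) in this way is a monic relation.\<close>

lemma ex_monic_annihilator: "\<exists>P. lead_coeff P = 1 \<and> ev P = 0"
proof -
  have "\<exists>E. \<forall>G. (\<forall>x\<in>G. \<forall>y\<in>G. x + y \<in> G) \<longrightarrow> (\<forall>x\<in>G. monom 1 n * x \<in> G) \<longrightarrow>
           {x\<in>range ev. degree x < E} \<subseteq> G \<longrightarrow> range ev \<subseteq> G"
  proof (rule shift_closed_generated[OF n_pos])
    show "x - y \<in> range ev" if "x \<in> range ev" "y \<in> range ev" for x y
      using that by (auto simp flip: ev_diff)
    show "monom 1 n * x \<in> range ev" if "x \<in> range ev" for x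
      using that iota_monom_mult_ev[of 1] by auto
  qed
  then obtain E where E: "\<And>G. (\<forall>x\<in>G. \<forall>y\<in>G. x + y \<in> G) \<Longrightarrow> (\<forall>x\<in>G. monom 1 n * x \<in> G) \<Longrightarrow>
           {x\<in>range ev. degree x < E} \<subseteq> G \<Longrightarrow> range ev \<subseteq> G" by blast
  have "finite {x\<in>range ev. degree x < E}"
    by (rule finite_subset[OF _ finite_poly_degree_less[of E]]) auto
  then have "\<exists>J. \<forall>x\<in>{x\<in>range ev. degree x < E}. \<exists>g. x = ev g \<and> degree g \<le> J"
    by (rule finite_uniform_bound[where Q = "\<lambda>J x. \<exists>g. x = ev g \<and> degree g \<le> J"]) (auto intro: order_trans)
  then obtain J where J: "\<forall>x\<in>{x\<in>range ev. degree x < E}. \<exists>g. x = ev g \<and> degree g \<le> J" by blast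
  define G where "G = {ev g | g. degree g \<le> J}"
  have "range ev \<subseteq> G"
  proof (rule E)
    have "ev g + ev h \<in> G" if "degree g \<le> J" "degree h \<le> J" for g h
      using that degree_add_le[of g J h] unfolding G_def ev_add[symmetric] by blast
    then show "\<forall>x\<in>G. \<forall>y\<in>G. x + y \<in> G" unfolding G_def by blast
    have "monom 1 n * ev g \<in> G" if "degree g \<le> J" for g
      using iota_monom_mult_ev[of 1 g] that degree_smult_le[of "monom 1 1" g] order_trans
      unfolding G_def by (metis (mono_tags, lifting) mem_Collect_eq mult.right_neutral)
    then show "\<forall>x\<in>G. monom 1 n * x \<in> G" unfolding G_def by blast
    show "{x\<in>range ev. degree x < E} \<subseteq> G" using J unfolding G_def by blast
  qed
  then obtain g where g: "ev (monom 1 (Suc J)) = ev g" "degree g \<le> J" unfolding G_def by blast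
  define P where "P = monom 1 (Suc J) - g"
  have cP: "coeff P (Suc J) = 1" using g(2) by (simp add: P_def coeff_eq_0)
  have "degree P \<le> Suc J" unfolding P_def by (rule degree_diff_le) (use g(2) in \<open>auto simp: degree_monom_le\<close>)
  moreover have "degree P \<ge> Suc J" using cP by (intro le_degree) simp
  ultimately have "lead_coeff P = 1" using cP by simp
  moreover have "ev P = 0" using g(1) by (simp add: P_def ev_diff)
  ultimately show ?thesis by blast
qed

text \<open>The coefficients range over F_q[pi]; by clearing denominators this is also the degree of
  T over K, as used in \<open>dim_F_tilde\<close>.\<close>

definition N :: nat where "N = (LEAST m. \<exists>g. g \<noteq> 0 \<and> degree g = m \<and> ev g = 0)"

lemma ev_inj: "degree g < N \<Longrightarrow> ev g = 0 \<Longrightarrow> g = 0"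
  using not_less_Least unfolding N_def by blast

text \<open>Gauss's lemma: an annihilator of minimal degree whose leading coefficient also has minimal
  degree divides a monic one over \<open>F\<^sub>q(\<pi>)\<close>, and every prime dividing the denominator could be
  cancelled.\<close>

lemma ex_minimal_monic: "\<exists>P. lead_coeff P = 1 \<and> ev P = 0 \<and> degree P = N"
proof -
  obtain P0 where P0: "lead_coeff P0 = 1" "ev P0 = 0" using ex_monic_annihilator by blast
  then have P0_nz: "P0 \<noteq> 0" by auto
  define S where "S g \<longleftrightarrow> g \<noteq> 0 \<and> degree g = N \<and> ev g = 0" for g
  have "\<exists>m g. g \<noteq> 0 \<and> degree g = m \<and> ev g = 0" using P0 P0_nz by blast
  from LeastI_ex[OF this] have "\<exists>g. S g" unfolding S_def N_def .
  then obtain g where g: "S g" and gmin: "\<And>g'. S g' \<Longrightarrow> degree (lead_coeff g) \<le> degree (lead_coeff g')"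
    using ex_has_least_nat[of S _ "\<lambda>g. degree (lead_coeff g)"] by blast
  \<comment> \<open>The admissible \<open>c\<close> are the common denominators of the quotient of
    \<open>P0\<close> by \<open>g\<close> over K.\<close>
  define Q where "Q c \<longleftrightarrow> c \<noteq> 0 \<and> (\<exists>h. smult c P0 = g * h)" for c
  obtain s t where st: "pseudo_divmod P0 g = (s, t)" by force
  have "g \<noteq> 0" using g by (simp add: S_def)
  from pseudo_divmod[OF this st] obtain c where c: "smult c P0 = g * s + t" "t = 0 \<or> degree t < degree g" "c \<noteq> 0"
    using \<open>g \<noteq> 0\<close> by (metis leading_coeff_0_iff power_not_zero)
  have "ev (g * s + t) = 0" unfolding c(1)[symmetric] by (simp add: ev_smult P0)
  then have "ev t = 0" using g by (simp add: ev_add ev_mult S_def)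
  then have "t = 0" using c(2) ev_inj[of t] g by (auto simp: S_def)
  then have "Q c" using c by (auto simp: Q_def)
  then obtain c where c: "Q c" and cmin: "\<And>c'. Q c' \<Longrightarrow> degree c \<le> degree c'"
    using ex_has_least_nat[of Q _ degree] by blast
  then obtain h where h: "smult c P0 = g * h" by (auto simp: Q_def)
  have "degree c = 0"
  proof (rule ccontr)
    assume "degree c \<noteq> 0"
    then obtain l where l: "Factorial_Ring.irreducible l" "l dvd c" "degree l > 0"
      using exists_irreducible_divisor[of c] by auto
    then have l_nz: "l \<noteq> 0" by auto
    have pr: "prime_elem [:l:]" using l(1) by (intro lift_prime_elem_poly field_poly_irreducible_imp_prime)
    obtain c' where c': "c = l * c'" using l(2) by blast
    have "g * h = [:l:] * smult c' P0" unfolding h[symmetric] c' by (simp add: mult.commute)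
    then have "[:l:] dvd g * h" by (rule dvdI)
    \<comment> \<open>A prime dividing \<open>g\<close> would leave an annihilator with smaller
      leading coefficient; one dividing \<open>h\<close> would leave a smaller denominator.\<close>
    then consider "[:l:] dvd g" | "[:l:] dvd h" using pr by (auto simp: prime_elem_dvd_mult_iff)
    then show False
    proof cases
      case 1
      then obtain g' where g': "g = smult l g'" by (auto simp: dvd_def)
      have "S g'" using g g' l_nz by (auto simp: S_def ev_smult)
      then have "degree (lead_coeff g) \<le> degree (lead_coeff g')" by (rule gmin)
      moreover have "g' \<noteq> 0" using \<open>S g'\<close> by (simp add: S_def)
      then have "lead_coeff g' \<noteq> 0" by simp
      ultimately have "degree (l * lead_coeff g') \<le> degree (lead_coeff g')" "lead_coeff g' \<noteq> 0" using l_nz by (simp_all add: g')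
      then show False using l(3) l_nz by (simp add: degree_mult_eq)
    next
      case 2
      then obtain h' where h': "h = smult l h'" by (auto simp: dvd_def)
      have "smult l (smult c' P0) = smult l (g * h')" using h by (simp add: h' c')
      then have "smult c' P0 = g * h'" by (rule smult_left_cancel[OF _ l_nz])
      then have "Q c'" using c c' by (auto simp: Q_def)
      then have "degree c \<le> degree c'" by (rule cmin)
      then show False using c c' l(3) by (auto simp: Q_def degree_mult_eq)
    qed
  qed
  have "lead_coeff (smult c P0) = lead_coeff g * lead_coeff h" by (simp add: h lead_coeff_mult)
  moreover have c_nz: "c \<noteq> 0" using c by (simp add: Q_def)
  \<comment> \<open>Since \<open>c\<close> is constant, so is \<open>lead_coeff g\<close>, and
    \<open>g\<close> can be made monic without changing its degree.\<close>
  ultimately have *: "c = lead_coeff g * lead_coeff h" using P0 by simp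
  have "lead_coeff g \<noteq> 0" "lead_coeff h \<noteq> 0" using c_nz * by (metis mult_zero_left, metis mult_zero_right)
  then have "degree c = degree (lead_coeff g) + degree (lead_coeff h)" by (subst *) (rule degree_mult_eq)
  then have "degree (lead_coeff g) = 0" using \<open>degree c = 0\<close> by simp
  then obtain u where u: "lead_coeff g = [:u:]" by (metis degree_eq_zeroE)
  then have "u \<noteq> 0" using \<open>g \<noteq> 0\<close> by auto
  have "S (smult [:inverse u:] g)" using g \<open>u \<noteq> 0\<close> by (simp add: S_def ev_smult)
  moreover have "lead_coeff (smult [:inverse u:] g) = 1" using u \<open>u \<noteq> 0\<close> by (simp add: one_pCons)
  ultimately show ?thesis unfolding S_def by blast
qed

definition P :: "'q poly poly" where "P = (SOME P. lead_coeff P = 1 \<and> ev P = 0 \<and> degree P = N)"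

lemma monic_P: "lead_coeff P = 1" and ev_P: "ev P = 0" and degree_P: "degree P = N"
  using someI_ex[OF ex_minimal_monic] unfolding P_def by auto

lemma N_pos: "N > 0"
proof (rule ccontr)
  assume "\<not> N > 0"
  then have "P = 1" using monic_P degree_P by (metis degree_eq_zeroE gr0I lead_coeff_pCons(2) one_pCons)
  then show False using ev_P by simp
qed

text \<open>The elements that some power of pi carries into the image of \<open>ev\<close> are
  generated over F_q[pi] by finitely many of them, so one exponent c serves for all. If
  \<open>ev u\<close> is divisible by pi^(c+1), then dividing it by pi stays in the image, and
  injectivity below degree N transfers the divisibility to \<open>u\<close>.\<close>

lemma ev_saturated:
  "\<exists>c. \<forall>u. degree u < N \<longrightarrow> (\<forall>i < n * c. coeff (ev u) i = 0) \<longrightarrow> (\<exists>v. u = smult (monom 1 1) v)"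
proof -
  define G where "G c = {y. monom 1 (n * c) * y \<in> range ev}" for c
  have G_mono: "y \<in> G c'" if yc: "y \<in> G c" "c \<le> c'" for y c c'
  proof -
    obtain g where "monom 1 (n * c) * y = ev g" using yc(1) unfolding G_def by blast
    moreover have "monom 1 (n * c') = monom 1 (n * (c' - c)) * (monom 1 (n * c) :: 'k poly)"
      using yc(2) by (simp add: mult_monom flip: distrib_left)
    ultimately have "monom 1 (n * c') * y = ev (smult (monom 1 (c' - c)) g)"
      by (simp add: mult.assoc flip: iota_monom_mult_ev)
    then show ?thesis by (simp add: G_def)
  qed
  have G_diff: "x - y \<in> G c" and G_add: "x + y \<in> G c" if xy: "x \<in> G c" "y \<in> G c" for x y c
  proof -
    obtain g g' where "monom 1 (n * c) * x = ev g" "monom 1 (n * c) * y = ev g'"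
      using xy unfolding G_def by blast
    then have "monom 1 (n * c) * (x - y) = ev (g - g')" "monom 1 (n * c) * (x + y) = ev (g + g')"
      by (simp_all add: ev_diff ev_add right_diff_distrib distrib_left)
    then show "x - y \<in> G c" "x + y \<in> G c" unfolding G_def by blast+
  qed
  have G_shift: "monom 1 n * x \<in> G c" if xc: "x \<in> G c" for x c
  proof -
    obtain g where "monom 1 (n * c) * x = ev g" using xc unfolding G_def by blast
    then have "monom 1 (n * c) * (monom 1 n * x) = ev (smult (monom 1 1) g)"
      using iota_monom_mult_ev[of 1 g] by (simp add: mult.left_commute)
    then show ?thesis by (simp add: G_def)
  qed
  define S where "S = (\<Union>c. G c)"
  have "\<exists>E. \<forall>G. (\<forall>x\<in>G. \<forall>y\<in>G. x + y \<in> G) \<longrightarrow> (\<forall>x\<in>G. monom 1 n * x \<in> G) \<longrightarrow>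
           {x\<in>S. degree x < E} \<subseteq> G \<longrightarrow> S \<subseteq> G"
  proof (rule shift_closed_generated[OF n_pos])
    show "x - y \<in> S" if "x \<in> S" "y \<in> S" for x y
    proof -
      obtain c c' where "x \<in> G c" "y \<in> G c'" using \<open>x \<in> S\<close> \<open>y \<in> S\<close> by (auto simp: S_def)
      then have "x - y \<in> G (max c c')" using G_mono by (intro G_diff) auto
      then show ?thesis by (auto simp: S_def)
    qed
    show "monom 1 n * x \<in> S" if "x \<in> S" for x using that G_shift by (auto simp: S_def)
  qed
  then obtain E where E: "\<And>G. (\<forall>x\<in>G. \<forall>y\<in>G. x + y \<in> G) \<Longrightarrow> (\<forall>x\<in>G. monom 1 n * x \<in> G) \<Longrightarrow>
           {x\<in>S. degree x < E} \<subseteq> G \<Longrightarrow> S \<subseteq> G" by blast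
  have "finite {x\<in>S. degree x < E}"
    by (rule finite_subset[OF _ finite_poly_degree_less[of E]]) auto
  then have "\<exists>c. \<forall>x\<in>{x\<in>S. degree x < E}. x \<in> G c"
    by (rule finite_uniform_bound[where Q = "\<lambda>c x. x \<in> G c"]) (auto simp: S_def intro: G_mono)
  then obtain c where c: "{x\<in>S. degree x < E} \<subseteq> G c" by blast
  have S_le: "S \<subseteq> G c" by (rule E) (use c G_add G_shift in auto)
  show ?thesis
  \<comment> \<open>The extra factor pi is the one to be divided out: pi^c \<open>y\<close> already
    is a value of \<open>ev\<close>, and reducing its preimage modulo \<open>P\<close> makes the
    degrees comparable.\<close>
  proof (intro exI[of _ "Suc c"] allI impI)
    fix u assume u: "degree u < N" "\<forall>i < n * Suc c. coeff (ev u) i = 0"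
    then obtain y where y: "ev u = monom 1 (n * Suc c) * y"
      by (metis monom_1_dvd_iff' dvdE)
    then have "y \<in> G (Suc c)" unfolding G_def by (metis mem_Collect_eq rangeI)
    then have "y \<in> G c" using S_le by (auto simp: S_def)
    then obtain v where v: "monom 1 (n * c) * y = ev v" by (auto simp: G_def)
    obtain w v' where v': "v = P * w + v'" "degree v' < degree P"
      using monic_division[of P v] monic_P degree_P N_pos by auto
    have "ev v = ev v'" by (simp add: v' ev_add ev_mult ev_P)
    have "ev u = monom 1 n * (monom 1 (n * c) * y)" unfolding y by (simp add: mult_monom flip: mult.assoc)
    also have "\<dots> = ev (smult (monom 1 1) v')"
      using iota_monom_mult_ev[of 1 v'] \<open>ev v = ev v'\<close> v by simp
    finally have "ev (u - smult (monom 1 1) v') = 0" by (simp add: ev_diff)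
    moreover have "degree (u - smult (monom 1 1) v') < N"
      using u(1) v'(2) degree_P degree_smult_le[of "monom 1 1" v'] by (intro degree_diff_less) auto
    ultimately have "u - smult (monom 1 1) v' = 0" using ev_inj by blast
    then show "\<exists>v. u = smult (monom 1 1) v" by auto
  qed
qed

lemma Phi_saturated:
  "\<exists>c. \<forall>u. degree u < N \<longrightarrow> (\<forall>i < int (n * c). Phi (liftS u) $$ i = 0) \<longrightarrow> (\<exists>v. u = smult fps_X v)"
proof -
  obtain c where c: "\<And>u. degree u < N \<Longrightarrow> (\<forall>i < n * c. coeff (ev u) i = 0) \<Longrightarrow> \<exists>v. u = smult (monom 1 1) v"
    using ev_saturated by blast
  show ?thesis
  proof (intro exI[of _ c] allI impI)
    fix u :: "'q fps poly" assume u: "degree u < N" "\<forall>i < int (n * c). Phi (liftS u) $$ i = 0"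
    \<comment> \<open>Cutting off at pi^(c+1) instead of pi^c leaves a tail divisible by pi even if
      c = 0. The polynomial part is handled by \<open>ev_saturated\<close>.\<close>
    obtain g0 u1 where g0: "liftS u = liftP g0 + smult (XL (int (Suc c))) (liftS u1)" "degree g0 \<le> degree u"
      using liftS_truncate by blast
    have "\<exists>v. g0 = smult (monom 1 1) v"
    proof (intro c allI impI)
      show "degree g0 < N" using g0(2) u(1) by simp
      fix i assume i: "i < n * c"
      then have "int i < int n * int c" by (metis of_nat_less_iff of_nat_mult)
      moreover have "int n * int c \<le> int n * (1 + int c)" by (simp add: algebra_simps)
      ultimately have "int i < int n * (1 + int c)" by linarith
      then show "coeff (ev g0) i = 0"
        using u(2)[rule_format, of "int i"] i unfolding g0(1)
        by (simp add: Phi_add Phi_liftP PL_nth Phi_smult iotaL_XL Phi_liftS_nth del: of_nat_mult)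
    qed
    then obtain v where v: "g0 = smult (monom 1 1) v" by blast
    have "liftS u = smult (XL 1) (liftP v) + smult (XL (1 + int c)) (liftS u1)"
      unfolding g0(1) v by (simp add: liftP_smult PL_monom)
    also have "\<dots> = liftS (smult fps_X (map_poly fps_of_poly v + smult (fps_X ^ c) u1))"
      unfolding XL_add using XL_int[of 1, where ?'a = 'q] XL_int[of c, where ?'a = 'q]
      by (simp add: liftS_smult liftS_add liftP_conv_liftS smult_add_right fls_times_fps_to_fls)
    finally show "\<exists>v. u = smult fps_X v" unfolding liftS_eq_iff by blast
  qed
qed

lemma Phi_XL_smult: "Phi (smult (XL b) g) $$ i = Phi g $$ (i - int n * b)"
  by (simp add: Phi_smult iotaL_XL)

text \<open>If \<open>Phi\<close> kills \<open>u\<close>, saturation extracts a factor pi and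
  \<open>Phi\<close> kills the quotient too; the order of the leading coefficient would decrease
  forever. So the powers of T below N stay independent over F_q((pi)).\<close>

lemma Phi_inj:
  assumes "degree g < N" "Phi g = 0"
  shows "g = 0"
proof -
  obtain c where c: "\<And>u. degree u < N \<Longrightarrow> (\<forall>i < int (n * c). Phi (liftS u) $$ i = 0) \<Longrightarrow> \<exists>v. u = smult fps_X v"
    using Phi_saturated by blast
  have *: "u = 0" if "degree u < N" "Phi (liftS u) = 0" for u
    using that
  proof (induction "subdegree (lead_coeff u)" arbitrary: u rule: less_induct)
    case less
    show ?case
    proof (rule ccontr)
      assume nz: "u \<noteq> 0"
      obtain v where v: "u = smult fps_X v" using c[of u] less.prems by auto
      then have v_nz: "v \<noteq> 0" using nz by auto
      have "Phi (liftS v) = 0" using less.prems(2) unfolding v liftS_smult Phi_smult by simp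
      moreover have "degree v < N" using less.prems v by simp
      moreover have "subdegree (lead_coeff v) < subdegree (lead_coeff u)" using v v_nz by simp
      ultimately show False using less.hyps[of v] v_nz by blast
    qed
  qed
  obtain a u where u: "g = smult (XL (- int a)) (liftS u)" using fls_poly_as_fps_poly[of g] by blast
  have "degree u < N" using assms(1) by (simp add: u)
  moreover have "Phi (liftS u) = 0" using assms(2) by (simp add: u Phi_smult)
  ultimately have "u = 0" by (rule *)
  then show ?thesis by (simp add: u)
qed

text \<open>As long as the exponent of the denominator exceeds c, the numerator has order at least n
  c and saturation cancels a factor pi. The uniformity of c is what makes the pigeonhole argument in
  \<open>valuation_unique\<close> work.\<close>

lemma Phi_integral_bound:
  "\<exists>c. \<forall>g. degree g < N \<longrightarrow> (\<forall>i<0. Phi g $$ i = 0) \<longrightarrow> (\<exists>u. g = smult (XL (- int c)) (liftS u))"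
proof -
  obtain c where c: "\<And>u. degree u < N \<Longrightarrow> (\<forall>i < int (n * c). Phi (liftS u) $$ i = 0) \<Longrightarrow> \<exists>v. u = smult fps_X v"
    using Phi_saturated by blast
  show ?thesis
  proof (intro exI[of _ c] allI impI)
    fix g assume g: "degree g < N" "\<forall>i<0. Phi g $$ i = 0"
    obtain a u where "g = smult (XL (- int a)) (liftS u)" using fls_poly_as_fps_poly[of g] by blast
    then show "\<exists>u. g = smult (XL (- int c)) (liftS u)"
    proof (induction a arbitrary: u)
      case 0
      then have "g = smult (XL (- int c)) (liftS (smult (fps_X ^ c) u))"
        by (simp add: liftS_smult flip: XL_int XL_add)
      then show ?case by blast
    next
      case (Suc a)
      show ?case
      proof (cases "Suc a \<le> c")
        case True
        have "(XL (- int (Suc a)) :: 'q fls) = XL (- int c) * XL (int (c - Suc a))" using True by (simp flip: XL_add)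
        then have "g = smult (XL (- int c)) (liftS (smult (fps_X ^ (c - Suc a)) u))"
          using Suc.prems by (simp add: liftS_smult XL_int)
        then show ?thesis by blast
      next
        case False
        have "\<exists>v. u = smult fps_X v"
        proof (intro c allI impI)
          show "degree u < N" using g(1) Suc.prems by simp
          fix i assume i: "i < int (n * c)"
          also have "int (n * c) \<le> int (n * Suc a)" using False by (intro iffD2[OF of_nat_le_iff] mult_le_mono) auto
          finally have "i - int (n * Suc a) < 0" by simp
          then have "Phi g $$ (i - int (n * Suc a)) = 0" using g(2) by blast
          then show "Phi (liftS u) $$ i = 0" unfolding Suc.prems Phi_XL_smult by (simp add: algebra_simps)
        qed
        then obtain v where v: "u = smult fps_X v" by blast
        have "g = smult (XL (- int a)) (liftS v)"
          unfolding Suc.prems v liftS_smult using XL_int[of 1, where ?'a = 'q, symmetric]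
          by (simp del: fps_X_to_fls flip: XL_add)
        then show ?thesis by (rule Suc.IH)
      qed
    qed
  qed
qed

section \<open>The kernel of \<open>Phi\<close>\<close>

lemma Phi_mult_eq_0:
  assumes "Phi g = 0"
  shows "Phi (g * h) = 0"
proof (rule fls_eqI)
  fix i
  have "Phi (g * h) $$ i = 0"
    \<comment> \<open>As \<open>Phi g\<close> is zero, any bound for its order is valid; this one is
      chosen to put \<open>i\<close> just below the order of the product.\<close>
    by (rule Phi_mult_low(1)[of "i - fls_subdegree (Phi h) + 1" g "fls_subdegree (Phi h)" h]) (auto simp: assms)
  then show "Phi (g * h) $$ i = 0 $$ i" by simp
qed

lemma Phi_no_zero_divisors:
  assumes "Phi (g * h) = 0"
  shows "Phi g = 0 \<or> Phi h = 0"
proof (rule ccontr)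
  assume "\<not> (Phi g = 0 \<or> Phi h = 0)"
  then have "Phi (g * h) $$ (fls_subdegree (Phi g) + fls_subdegree (Phi h)) \<noteq> 0"
    by (subst Phi_mult_low(2)) auto
  then show False using assms by simp
qed

lemma Phi_P: "Phi (liftP P) = 0"
  by (simp add: Phi_liftP ev_P)

lemma Phi_mod: "Phi (g mod liftP P) = Phi g" and degree_mod_P: "degree (g mod liftP P) < N"
proof -
  have "Phi g = Phi (g div liftP P * liftP P + g mod liftP P)" by (simp only: div_mult_mod_eq)
  also have "\<dots> = Phi (g mod liftP P)" unfolding Phi_add mult.commute[of _ "liftP P"]
    by (simp add: Phi_mult_eq_0 Phi_P)
  finally show "Phi (g mod liftP P) = Phi g" ..
  have "liftP P \<noteq> 0" using N_pos by (metis degree_0 degree_P degree_liftP less_irrefl)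
  then show "degree (g mod liftP P) < N"
    using degree_mod_less[of "liftP P" g] N_pos by (auto simp: degree_P)
qed

text \<open>With \<open>Phi_no_zero_divisors\<close> this says that P stays irreducible over
  F_q((pi)), in accordance with there being one place above (pi).\<close>

lemma Phi_eq_0_iff: "Phi g = 0 \<longleftrightarrow> liftP P dvd g"
  using Phi_inj[OF degree_mod_P, of g] by (auto simp: Phi_mod mod_eq_0_iff_dvd Phi_mult_eq_0 Phi_P elim!: dvdE)

end

section \<open>Reduction modulo \<open>\<pi>\<close>\<close>

lemma prime_power_decomposition:
  fixes a p :: "'a::field poly"
  assumes "prime_elem p" "a \<noteq> 0"
  obtains j w where "a = p ^ j * w" "\<not> p dvd w"
proof -
  have "\<exists>j w. a = p ^ j * w \<and> \<not> p dvd w" using assms(2)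
  proof (induction "degree a" arbitrary: a rule: less_induct)
    case less
    show ?case
    proof (cases "p dvd a")
      case False
      then show ?thesis by (intro exI[of _ 0] exI[of _ a]) simp
    next
      case True
      then obtain b where b: "a = p * b" by blast
      have "p \<noteq> 0" "\<not> p dvd 1" using assms(1) by auto
      then have "degree p > 0" by (auto simp: is_unit_iff_degree)
      moreover have "b \<noteq> 0" using less.prems b by auto
      ultimately have "degree b < degree a" using \<open>p \<noteq> 0\<close> by (simp add: b degree_mult_eq)
      with less.hyps \<open>b \<noteq> 0\<close> obtain j w where "b = p ^ j * w" "\<not> p dvd w" by blast
      then show ?thesis by (intro exI[of _ "Suc j"] exI[of _ w]) (simp add: b)
    qed
  qed
  then show ?thesis using that by blast
qed

lemma coprime_dvd_prime_power_imp_unit: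
  fixes p w :: "'a::idom"
  assumes "prime_elem p" "\<not> p dvd w" "w * z = p ^ m"
  shows "w dvd 1"
  using assms(3)
proof (induction m arbitrary: z)
  case (Suc m)
  have "p dvd w * z" by (simp add: Suc.prems)
  then have "p dvd z" using assms(1,2) by (simp add: prime_elem_dvd_mult_iff)
  then obtain y where "z = p * y" by blast
  then have "p * (w * y) = p * p ^ m" using Suc.prems by (simp add: algebra_simps)
  then have "w * y = p ^ m" using assms(1) by simp
  then show ?case by (rule Suc.IH)
qed (metis dvd_triv_left power_0)

context drinfeld
begin

text \<open>Each factor pp contributes H d to the order, and the remaining cofactor has constant
  coefficient \<open>\<gamma> w\<close>, which vanishes exactly when pp divides
  \<open>w\<close>.\<close>

lemma coeff_\<phi>_prime_power:
  "i < j * (H * d) \<Longrightarrow> coeff (\<phi> (\<pp> ^ j * w)) i = 0"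
  "coeff (\<phi> (\<pp> ^ j * w)) (j * (H * d)) = 0 \<longleftrightarrow> \<pp> dvd w"
proof -
  have "(\<forall>i < j * (H * d). coeff (\<phi> (\<pp> ^ j * w)) i = 0) \<and>
    (coeff (\<phi> (\<pp> ^ j * w)) (j * (H * d)) = 0 \<longleftrightarrow> \<pp> dvd w)"
  proof (induction j)
    case 0
    then show ?case using \<gamma>_ker by (simp add: coeff_\<phi>_0)
  next
    case (Suc j)
    have e: "\<phi> (\<pp> ^ Suc j * w) = tw (\<phi> \<pp>) (\<phi> (\<pp> ^ j * w))"
      by (simp add: mult.assoc flip: \<phi>_mult)
    have h: "\<And>i. i < H * d \<Longrightarrow> coeff (\<phi> \<pp>) i = 0" "coeff (\<phi> \<pp>) (H * d) \<noteq> 0"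
      using height deg_pp by (auto simp: has_height_def)
    have l: "\<And>i. i < j * (H * d) \<Longrightarrow> coeff (\<phi> (\<pp> ^ j * w)) i = 0" using Suc.IH by blast
    show ?case
      using coeff_tw_low[of "H * d" "\<phi> \<pp>" "j * (H * d)" "\<phi> (\<pp> ^ j * w)", OF h(1) l] Suc.IH h(2) q_gt0
      unfolding e by simp
  qed
  then show "i < j * (H * d) \<Longrightarrow> coeff (\<phi> (\<pp> ^ j * w)) i = 0"
    and "coeff (\<phi> (\<pp> ^ j * w)) (j * (H * d)) = 0 \<longleftrightarrow> \<pp> dvd w" by blast+
qed

lemma Hd_pos: "H * d > 0"
proof (rule ccontr)
  assume "\<not> H * d > 0"
  then have "coeff (\<phi> \<pp>) 0 \<noteq> 0" using height deg_pp by (auto simp: has_height_def)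
  then show False using \<gamma>_ker by (simp add: coeff_\<phi>_0)
qed

text \<open>In \<open>'q poly poly\<close> the inner variable is pi and the outer one is T. The left
  inverse \<open>map_poly (\<lambda>c. coeff c 0)\<close> of this inclusion of F_q[T] is reduction
  modulo pi.\<close>

abbreviation cst :: "'q poly \<Rightarrow> 'q poly poly" where "cst \<equiv> map_poly (\<lambda>c. [:c:])"

lemma cst_coeff_0: "g = cst (map_poly (\<lambda>c. coeff c 0) g) + smult (monom 1 1) (map_poly (poly_shift 1) g)"
proof (rule poly_eqI)
  fix i
  have "c = [:coeff c 0:] + monom 1 1 * poly_shift 1 c" for c :: "'q poly"
    by (rule poly_eqI) (auto simp: coeff_poly_shift coeff_monom_mult coeff_pCons split: nat.splits)
  from this[of "coeff g i"]
  show "coeff g i = coeff (cst (map_poly (\<lambda>c. coeff c 0) g) + smult (monom 1 1) (map_poly (poly_shift 1) g)) i"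
    by (simp add: coeff_map_poly)
qed

lemma ex_prime_power_degree: "\<exists>s. N = s * d \<and> n \<le> s * (H * d)"
proof -
  define r0 where "r0 = map_poly (\<lambda>c :: 'q poly. coeff c 0)"
  have r0_mult: "r0 (a * b) = r0 a * r0 b" and r0_add: "r0 (a + b) = r0 a + r0 b" for a b
    unfolding r0_def by (rule map_poly_hom_mult map_poly_hom_add; simp add: coeff_mult_0)+
  have r0_cst: "r0 (cst a) = a" for a
    unfolding r0_def by (rule poly_eqI) (simp add: coeff_map_poly)
  define Q where "Q = r0 P"
  have cQ: "coeff Q N = 1" using monic_P by (simp add: Q_def r0_def coeff_map_poly degree_P)
  have "degree Q \<le> N" unfolding Q_def r0_def degree_P[symmetric] by (rule map_poly_degree_leq)
  moreover have "N \<le> degree Q" by (rule le_degree) (simp add: cQ)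
  ultimately have dQ: "degree Q = N" by simp
  have "Q \<noteq> 0" using cQ by auto
  obtain s W where sW: "Q = \<pp> ^ s * W" "\<not> \<pp> dvd W"
    using prime_power_decomposition[OF prime_pp \<open>Q \<noteq> 0\<close>] by blast
  \<comment> \<open>This is \<open>ev P = 0\<close> with \<open>P\<close> split into its reduction
    \<open>Q\<close> and a multiple of pi. Thus tau^n divides \<open>\<phi> Q\<close>, whose exact
    order is s H d.\<close>
  have "\<phi> Q + monom 1 n * ev (map_poly (poly_shift 1) P) = 0"
    using cst_coeff_0[of P] iota_monom_mult_ev[of 1 "map_poly (poly_shift 1) P"] ev_P
    by (metis Q_def ev_add ev_lift mult.right_neutral r0_def)
  then have "coeff (\<phi> Q) i = 0" if "i < n" for i
    using that by (metis add.right_neutral coeff_add coeff_0 coeff_monom_mult not_less)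
  then have ns: "n \<le> s * (H * d)"
    using coeff_\<phi>_prime_power(2)[of s W] sW by (metis not_le)
  obtain c where c: "\<And>u. degree u < N \<Longrightarrow> (\<forall>i < n * c. coeff (ev u) i = 0) \<Longrightarrow> \<exists>v. u = smult (monom 1 1) v"
    using ev_saturated by blast
  \<comment> \<open>The exponent s c gives order s c H d >= n c, the depth at which saturation makes
    the remainder \<open>u\<close> divisible by pi. Modulo pi, the polynomial \<open>Q\<close> then
    divides pp^(s c).\<close>
  obtain w u where wu: "cst (\<pp> ^ (s * c)) = P * w + u" "degree u < degree P"
    using monic_division[of P "cst (\<pp> ^ (s * c))"] monic_P degree_P N_pos by auto
  have "\<phi> (\<pp> ^ (s * c)) = ev u"
    using arg_cong[where f = ev, OF wu(1)] by (simp add: ev_lift ev_add ev_mult ev_P)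
  moreover have "coeff (\<phi> (\<pp> ^ (s * c))) i = 0" if "i < n * c" for i
  proof -
    have "n * c \<le> s * c * (H * d)" using mult_le_mono1[OF ns, of c] by (simp add: algebra_simps)
    with that have "i < s * c * (H * d)" by (rule less_le_trans)
    then show ?thesis using coeff_\<phi>_prime_power(1)[of i "s * c" 1] by simp
  qed
  ultimately obtain v where v: "u = smult (monom 1 1) v" using c[of u] wu(2) degree_P by auto
  have "r0 u = 0" unfolding v r0_def by (rule poly_eqI) (simp add: coeff_map_poly coeff_mult_0)
  then have "\<pp> ^ (s * c) = Q * r0 w" using arg_cong[where f = r0, OF wu(1)] by (simp add: r0_cst r0_add r0_mult Q_def)
  then have "W * (\<pp> ^ s * r0 w) = \<pp> ^ (s * c)" by (simp add: sW algebra_simps)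
  then have "W dvd 1" by (rule coprime_dvd_prime_power_imp_unit[OF prime_pp sW(2)])
  moreover from this have "W \<noteq> 0" by auto
  ultimately have "degree W = 0" "W \<noteq> 0" using is_unit_iff_degree[of W] by simp_all
  then have "degree Q = s * d" using pp_nz by (simp add: sW degree_mult_eq degree_power_eq deg_pp)
  then show ?thesis using dQ ns by auto
qed

section \<open>The numerical criterion for maximality at pi\<close>

definition s :: nat where "s = (SOME s. N = s * d \<and> n \<le> s * (H * d))"

lemma N_eq: "N = s * d" and n_le: "n \<le> s * (H * d)"
  using someI_ex[OF ex_prime_power_degree] unfolding s_def by auto

lemma s_pos: "s > 0" using N_pos N_eq by (cases s) auto

text \<open>Maximality at pi in terms of representatives of degree less than N: integral elements
  have power series coordinates in the basis 1, T, ..., T^(N-1). The link with the abstract notion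
  is \<open>locally_maximal_iff\<close>.\<close>

definition integrally_closed :: bool where
  "integrally_closed \<longleftrightarrow> (\<forall>g. degree g < N \<longrightarrow> (\<forall>i<0. Phi g $$ i = 0) \<longrightarrow> g \<in> range liftS)"

lemma Phi_low_imp_dvd:
  assumes "(s - 1) * (H * d) < n" "degree u < N" "\<And>i. i < int n \<Longrightarrow> Phi (liftS u) $$ i = 0"
  shows "\<exists>v. u = smult fps_X v"
proof -
  \<comment> \<open>The reduction of \<open>u\<close> modulo pi, an element of F_q[T] of degree less
    than N.\<close>
  define b where "b = map_poly (\<lambda>f. f $ 0) u"
  define u' where "u' = map_poly (fps_shift 1) u"
  have *: "f = fps_const (f $ 0) + fps_X * fps_shift 1 f" for f :: "'q fps"
    by (rule fps_ext) (auto simp: fps_eq_iff)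
  have u: "u = map_poly fps_const b + smult fps_X u'"
  proof (rule poly_eqI)
    fix i show "coeff u i = coeff (map_poly fps_const b + smult fps_X u') i"
      using *[of "coeff u i"] by (simp add: coeff_map_poly b_def u'_def)
  qed
  have "liftP (cst b) = liftS (map_poly fps_const b)"
    by (rule poly_eqI) (simp add: coeff_map_poly PL_def fps_of_poly_const del: fps_const_to_fls)
  then have lu: "liftS u = liftP (cst b) + smult (XL 1) (liftS u')"
    using XL_int[of 1, where ?'a = 'q] by (subst u) (simp add: liftS_add liftS_smult)
  have "b = 0"
  proof (rule ccontr)
    assume "b \<noteq> 0"
    then obtain j w where jw: "b = \<pp> ^ j * w" "\<not> \<pp> dvd w"
      using prime_power_decomposition[OF prime_pp] by blast
    have "w \<noteq> 0" using jw(2) by auto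
    then have "j * d \<le> degree b" using pp_nz by (simp add: jw degree_mult_eq degree_power_eq deg_pp)
    also have "degree b \<le> degree u" unfolding b_def by (rule map_poly_degree_leq)
    also have "degree u < s * d" using assms(2) N_eq by (simp only:)
    finally have "j * d < s * d" .
    then have "j < s" by simp
    then have "j \<le> s - 1" by linarith
    then have "j * (H * d) \<le> (s - 1) * (H * d)" by (rule mult_le_mono1)
    from this assms(1) have jn: "j * (H * d) < n" by (rule le_less_trans)
    \<comment> \<open>The part divisible by pi starts in degree n > j H d, so only \<open>b\<close>
      contributes here.\<close>
    have "Phi (liftS u) $$ int (j * (H * d)) = coeff (\<phi> b) (j * (H * d))"
      using jn unfolding lu
      by (simp add: Phi_add Phi_liftP ev_lift PL_nth Phi_XL_smult Phi_liftS_nth del: of_nat_mult)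
    also have "\<dots> \<noteq> 0" using coeff_\<phi>_prime_power(2)[of j w] jw by simp
    finally show False using assms(3)[of "int (j * (H * d))"] jn by linarith
  qed
  then have "u = smult fps_X u'" using u by simp
  then show ?thesis by blast
qed

lemma integrally_closed_iff: "integrally_closed \<longleftrightarrow> (s - 1) * (H * d) < n"
proof
  assume lt: "(s - 1) * (H * d) < n"
  show integrally_closed unfolding integrally_closed_def
  proof (intro allI impI)
    fix g assume g: "degree g < N" "\<forall>i<0. Phi g $$ i = 0"
    obtain a u where "g = smult (XL (- int a)) (liftS u)" using fls_poly_as_fps_poly[of g] by blast
    then show "g \<in> range liftS"
    proof (induction a arbitrary: u)
      case (Suc a)
      have "\<exists>v. u = smult fps_X v"
      proof (rule Phi_low_imp_dvd[OF lt])
        show "degree u < N" using g(1) Suc.prems by simp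
        fix i assume i: "i < int n"
        have "int n \<le> int (n * Suc a)" by simp
        with i have "i - int (n * Suc a) < 0" by linarith
        then have "Phi g $$ (i - int (n * Suc a)) = 0" using g(2) by blast
        then show "Phi (liftS u) $$ i = 0" unfolding Suc.prems Phi_XL_smult by (simp add: algebra_simps)
      qed
      then obtain v where v: "u = smult fps_X v" by blast
      have "g = smult (XL (- int a)) (liftS v)"
        unfolding Suc.prems v liftS_smult using XL_int[of 1, where ?'a = 'q, symmetric]
        by (simp del: fps_X_to_fls flip: XL_add)
      then show ?case by (rule Suc.IH)
    qed auto
  qed
next
  assume ic: integrally_closed
  show "(s - 1) * (H * d) < n"
  proof (rule ccontr)
    assume *: "\<not> (s - 1) * (H * d) < n"
    define g where "g = smult (XL (- 1)) (liftP (cst (\<pp> ^ (s - 1))))"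
    have dc: "degree (cst a) = degree a" for a by (rule degree_map_poly) simp
    have dg: "degree g = (s - 1) * d" using pp_nz by (simp add: g_def dc degree_power_eq deg_pp)
    have "degree g < N" unfolding dg N_eq using s_pos d_pos by simp
    moreover have "Phi g $$ i = 0" if "i < 0" for i
      using coeff_\<phi>_prime_power(1)[of "nat (i + int n)" "s - 1" 1] * that
      by (simp add: g_def Phi_XL_smult Phi_liftP ev_lift PL_nth)
    ultimately obtain u where "g = liftS u" using ic unfolding integrally_closed_def by blast
    then have "coeff g (degree g) $$ (- 1) = 0" by (simp add: coeff_map_poly)
    \<comment> \<open>Since pp is monic, the denominator pi is visible in the leading coefficient,
      which therefore is not a power series.\<close>
    moreover have "coeff g (degree g) = XL (- 1)"
    proof -
      have "coeff (\<pp> ^ (s - 1)) ((s - 1) * d) = 1"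
        using monic_pp by (metis deg_pp degree_power_eq lead_coeff_power pp_nz power_one)
      then show ?thesis unfolding dg by (simp add: g_def coeff_map_poly flip: one_pCons)
    qed
    ultimately show False by (simp add: XL_def)
  qed
qed

text \<open>N / d is the integer s, so equality with the ceiling amounts to s - 1 < n / (H
  d).\<close>

lemma ceiling_le_and_eq_iff:
  "real_of_int \<lceil>real n / real (H * d)\<rceil> \<le> real N / real d"
  "real_of_int \<lceil>real n / real (H * d)\<rceil> = real N / real d \<longleftrightarrow> integrally_closed"
proof -
  have Nd: "real N / real d = real_of_int (int s)" using d_pos by (simp add: N_eq)
  have "real n / real (H * d) \<le> real_of_int (int s)"
    using n_le Hd_pos by (simp add: pos_divide_le_eq flip: of_nat_mult)
  then have le: "\<lceil>real n / real (H * d)\<rceil> \<le> int s" by (simp add: ceiling_le_iff)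
  then show "real_of_int \<lceil>real n / real (H * d)\<rceil> \<le> real N / real d" unfolding Nd by simp
  have "\<lceil>real n / real (H * d)\<rceil> = int s \<longleftrightarrow> real_of_int (int s) - 1 < real n / real (H * d)"
    using le by linarith
  also have "\<dots> \<longleftrightarrow> real ((s - 1) * (H * d)) < real n"
    using s_pos Hd_pos by (simp add: pos_less_divide_eq of_nat_diff)
  finally show "real_of_int \<lceil>real n / real (H * d)\<rceil> = real N / real d \<longleftrightarrow> integrally_closed"
    unfolding Nd integrally_closed_iff of_int_eq_iff of_nat_less_iff .
qed

end

section \<open>Extension of the valuation\<close>

text \<open>In a domain that is finite over a field, every nonzero element is invertible; here the domain
  is the quotient of a polynomial ring by an ideal \<open>{g. Z g}\<close> whose nonzero elements have degree at
  least \<open>degree p\<close>.\<close>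

lemma ex_inverse_mod_ideal:
  fixes Z :: "'f::field poly \<Rightarrow> bool"
  assumes p: "Z p" "p \<noteq> 0" and add: "\<And>a b. Z a \<Longrightarrow> Z b \<Longrightarrow> Z (a + b)" and mult: "\<And>a b. Z a \<Longrightarrow> Z (b * a)"
    and dom: "\<And>a b. Z (a * b) \<Longrightarrow> Z a \<or> Z b" and deg: "\<And>a. Z a \<Longrightarrow> degree a < degree p \<Longrightarrow> a = 0"
    and g: "\<not> Z g"
  shows "\<exists>u. Z (u * g - 1)"
proof -
  have diff: "Z (a - b)" if "Z a" "Z b" for a b using add[OF that(1) mult[OF that(2), of "- 1"]] by simp
  \<comment> \<open>These are the elements outside the ideal that are multiples of \<open>g\<close>
    modulo it; one of least degree will turn out to be constant.\<close>
  define S where "S t \<longleftrightarrow> \<not> Z t \<and> (\<exists>u. Z (u * g - t))" for t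
  have "Z 0" using mult[OF p(1), of 0] by simp
  then have "S g" using g unfolding S_def by (auto intro!: exI[of _ 1])
  then obtain t where t: "S t" and min: "\<And>t'. S t' \<Longrightarrow> degree t \<le> degree t'"
    using ex_has_least_nat[of S _ degree] by blast
  obtain u where u: "Z (u * g - t)" and nt: "\<not> Z t" using t by (auto simp: S_def)
  have "t \<noteq> 0" using nt \<open>Z 0\<close> by auto
  have *: "Z (t mod p)" if "degree t \<ge> degree p"
  proof (rule ccontr)
    assume "\<not> Z (t mod p)"
    moreover have eq: "u * g - t mod p = (u * g - t) + (t div p) * p"
      using div_mult_mod_eq[of t p] by (simp add: algebra_simps)
    have "Z (u * g - t mod p)" unfolding eq by (rule add[OF u mult[OF p(1)]])
    ultimately have "S (t mod p)" by (auto simp: S_def)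
    then have le: "degree t \<le> degree (t mod p)" by (rule min)
    have "t mod p \<noteq> 0" using \<open>\<not> Z (t mod p)\<close> \<open>Z 0\<close> by auto
    then have "degree (t mod p) < degree p" using degree_mod_less[OF p(2), of t] by auto
    then show False using le that by simp
  qed
  have lt: "degree t < degree p"
  proof (rule ccontr)
    assume "\<not> degree t < degree p"
    then have "Z (t mod p)" using * by simp
    then have "Z ((t div p) * p + t mod p)" using mult[OF p(1)] add by blast
    then show False using nt by simp
  qed
  \<comment> \<open>Modulo the ideal \<open>p mod t\<close> is again a multiple of \<open>g\<close>;
    were it outside the ideal, its degree would contradict the choice of \<open>t\<close>.\<close>
  have zm: "Z (p mod t)"
  proof (rule ccontr)
    assume n: "\<not> Z (p mod t)"
    have eq: "(- (p div t) * u) * g - p mod t = - (p div t) * (u * g - t) - p"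
      using mult_div_mod_eq[of t p] by (simp add: algebra_simps)
    have "Z ((- (p div t) * u) * g - p mod t)" unfolding eq by (rule diff[OF mult[OF u] p(1)])
    then have "S (p mod t)" using n unfolding S_def by blast
    then have "degree t \<le> degree (p mod t)" by (rule min)
    moreover have "p mod t \<noteq> 0" using n \<open>Z 0\<close> by auto
    ultimately show False using degree_mod_less[OF \<open>t \<noteq> 0\<close>, of p] by auto
  qed
  have "p mod t = 0 \<or> degree (p mod t) < degree t" using degree_mod_less[OF \<open>t \<noteq> 0\<close>] by auto
  then have "p mod t = 0" using deg[OF zm] lt by auto
  then have pt: "p = p div t * t" by (metis add.right_neutral div_mult_mod_eq)
  \<comment> \<open>The ideal is prime and \<open>t\<close> lies outside it, so the cofactor lies
    inside and has at least the degree of \<open>p\<close>. This leaves degree 0 for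
    \<open>t\<close>.\<close>
  then have "Z (p div t)" using dom[of "p div t" t] p(1) nt by auto
  moreover have "p div t \<noteq> 0" using pt p(2) by auto
  ultimately have "\<not> degree (p div t) < degree p" using deg by blast
  moreover have "degree p = degree (p div t) + degree t"
    using \<open>p div t \<noteq> 0\<close> \<open>t \<noteq> 0\<close> by (subst pt) (rule degree_mult_eq)
  ultimately have "degree t = 0" by linarith
  then obtain c where c: "t = [:c:]" by (metis degree_eq_zeroE)
  then have "c \<noteq> 0" using \<open>t \<noteq> 0\<close> by auto
  have "[:inverse c:] * (u * g - t) = ([:inverse c:] * u) * g - 1"
    using \<open>c \<noteq> 0\<close> by (simp add: c algebra_simps one_pCons)
  then show ?thesis using mult[OF u, of "[:inverse c:]"] by metis
qed

context drinfeld
begin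

section \<open>Inverses and the tau-adic valuation ring\<close>

lemma Phi_1 [simp]: "Phi 1 = 1"
  using Phi_const[of 1] by (simp add: one_pCons)

lemma liftP_P_nonzero: "liftP P \<noteq> 0"
  using N_pos by (metis degree_0 degree_P degree_liftP less_irrefl)

lemma ex_Phi_inverse:
  assumes "Phi g \<noteq> 0"
  shows "\<exists>u. Phi (u * g) = 1"
proof -
  have "\<exists>u. Phi (u * g - 1) = 0"
  proof (rule ex_inverse_mod_ideal[where p = "liftP P" and Z = "\<lambda>g. Phi g = 0"])
    show "Phi (b * a) = 0" if "Phi a = 0" for a b using Phi_mult_eq_0[OF that, of b] by (simp add: mult.commute)
    show "Phi a = 0 \<or> Phi b = 0" if "Phi (a * b) = 0" for a b using Phi_no_zero_divisors[OF that] .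
    show "a = 0" if "Phi a = 0" "degree a < degree (liftP P)" for a using Phi_inj that by (simp add: degree_P)
  qed (use assms in \<open>auto simp: Phi_P Phi_add liftP_P_nonzero\<close>)
  then show ?thesis by (auto simp: Phi_diff)
qed

text \<open>\<open>Phi\<close> is not multiplicative, but its kernel is an ideal. This rule replaces
  multiplicativity in all computations modulo P below.\<close>

lemma Phi_cong_mult:
  assumes "Phi a = Phi a'" "Phi b = Phi b'"
  shows "Phi (a * b) = Phi (a' * b')"
proof -
  have "Phi ((a - a') * b) = 0" "Phi ((b - b') * a') = 0" using assms by (simp_all add: Phi_mult_eq_0 Phi_diff)
  then show ?thesis by (simp add: algebra_simps Phi_diff)
qed

text \<open>The filtration by the tau-adic valuation; \<open>low 0\<close> will be the ring of
  integers of the completion.\<close>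

definition low :: "int \<Rightarrow> 'q fls poly \<Rightarrow> bool" where "low m g \<longleftrightarrow> (\<forall>i<m. Phi g $$ i = 0)"

lemma low_mult: "low m g \<Longrightarrow> low m' h \<Longrightarrow> low (m + m') (g * h)"
  unfolding low_def using Phi_mult_low(1) by blast

lemma low_add: "low m g \<Longrightarrow> low m h \<Longrightarrow> low m (g + h)"
  by (simp add: low_def Phi_add)

lemma low_1: "low 0 1" by (simp add: low_def)

lemma low_power: "low m g \<Longrightarrow> low (int k * m) (g ^ k)"
proof (induction k)
  case (Suc k)
  then have "low (m + int k * m) (g * g ^ k)" by (intro low_mult) auto
  then show ?case by (simp add: algebra_simps)
qed (simp add: low_1)

lemma low_XL: "low m (smult (XL a) g) \<longleftrightarrow> low (m - int n * a) g"
proof -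
  have "(\<forall>i<m. Phi g $$ (i - int n * a) = 0) \<longleftrightarrow> (\<forall>i<m - int n * a. Phi g $$ i = 0)"
    by (metis add_diff_cancel_right' diff_add_cancel diff_less_eq less_diff_eq)
  then show ?thesis by (simp add: low_def Phi_XL_smult)
qed

lemma low_liftS: "low 0 (liftS w)"
  by (simp add: low_def Phi_liftS_nth)

lemma low_const_iff: "low 0 [:f:] \<longleftrightarrow> f \<in> range fps_to_fls"
proof
  assume *: "low 0 [:f:]"
  have "f $$ i = 0" if "i < 0" for i
    using *[unfolded low_def Phi_const, rule_format, of "int n * i"] that n_pos
    by (simp add: iotaL_nth mult_pos_neg)
  then have "f = fps_to_fls (Abs_fps (\<lambda>i. f $$ int i))"
    by (intro fls_eqI) auto
  then show "f \<in> range fps_to_fls" by (metis rangeI)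
next
  assume "f \<in> range fps_to_fls"
  then obtain w where "f = fps_to_fls w" by blast
  then have "[:f:] = liftS [:w:]" by (simp add: map_poly_pCons)
  then show "low 0 [:f:]" using low_liftS by metis
qed

lemma ex_Phi_inverse_low:
  assumes "Phi y $$ m \<noteq> 0" "low m y"
  shows "\<exists>u. Phi (u * y) = 1 \<and> low (- m) u"
proof -
  have "Phi y \<noteq> 0" using assms(1) by auto
  then obtain u where u: "Phi (u * y) = 1" using ex_Phi_inverse by blast
  then have nz: "Phi u \<noteq> 0" using Phi_mult_eq_0[of u y] by auto
  define l where "l = fls_subdegree (Phi u)"
  have "Phi (u * y) $$ (l + m) \<noteq> 0"
    by (subst Phi_mult_low(2)) (use assms nz in \<open>auto simp: l_def low_def\<close>)
  then have "l = - m" unfolding u by (auto split: if_splits)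
  then have "low (- m) u" unfolding low_def l_def by (auto intro: fls_eq0_below_subdegree)
  then show ?thesis using u by blast
qed

lemma low_valuation: "\<not> low 0 g \<Longrightarrow> \<exists>u. low 0 u \<and> Phi (u * g) = 1"
proof -
  assume *: "\<not> low 0 g"
  define m where "m = fls_subdegree (Phi g)"
  have "Phi g \<noteq> 0" using * by (auto simp: low_def)
  then have nz: "Phi g $$ m \<noteq> 0" "low m g" by (auto simp: m_def low_def)
  have "m < 0" using * unfolding m_def low_def by (metis fls_eq0_below_subdegree not_less order_less_le_trans)
  obtain u where "Phi (u * g) = 1" "low (- m) u" using ex_Phi_inverse_low[OF nz] by blast
  moreover from this have "low 0 u" using \<open>m < 0\<close> by (auto simp: low_def)
  ultimately show ?thesis by blast
qed

text \<open>Uniqueness of the extension of a complete discrete valuation. If \<open>y\<close> has nonnegative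
  valuation, then two of its powers are congruent modulo a high power of \<open>\<pi>\<close>; comparing the
  inverse of \<open>y\<close> with \<open>\<pi>\<close> in the valuation ring then forces \<open>y\<close> to lie in it.\<close>

lemma valuation_unique:
  assumes v_add: "\<And>g h. v g \<Longrightarrow> v h \<Longrightarrow> v (g + h)" and v_minus: "\<And>g. v g \<Longrightarrow> v (- g)"
    and v_mult: "\<And>g h. v g \<Longrightarrow> v h \<Longrightarrow> v (g * h)" and v_cong: "\<And>g h. Phi g = Phi h \<Longrightarrow> v g \<Longrightarrow> v h"
    and v_const: "\<And>f. v [:f:] \<longleftrightarrow> f \<in> range fps_to_fls"
    and v_val: "\<And>g. \<not> v g \<Longrightarrow> \<exists>u. v u \<and> Phi (u * g) = 1"
  shows "v g \<longleftrightarrow> low 0 g"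
proof -
  have v1: "v 1" using v_const[of 1] by (metis fps_one_to_fls one_pCons rangeI)
  have v_power: "v (u ^ k)" if "v u" for u k by (induction k) (auto intro: v1 v_mult that)
  have v_c: "v [:fps_to_fls f:]" for f using v_const by blast
  have not_v: "\<not> v [:XL (- 1):]"
  proof
    assume "v [:XL (- 1):]"
    then have "XL (- 1) \<in> range (fps_to_fls :: 'q fps \<Rightarrow> _)" using v_const by simp
    then obtain f :: "'q fps" where f: "XL (- 1) = fps_to_fls f" by blast
    have "(XL (- 1) :: 'q fls) $$ (- 1) = 1" by (simp add: XL_def)
    then show False unfolding f by simp
  qed
  \<comment> \<open>T is integral over F_q[[pi]] because P is monic: if T were not in the ring, its
    inverse \<open>u\<close> would be, and P(T) = 0 multiplied by u^(N-1) would express T as a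
    polynomial in \<open>u\<close> with power series coefficients.\<close>
  have vx: "v [:0, 1:]"
  proof (rule ccontr)
    assume nv: "\<not> v [:0, 1:]"
    then obtain u where u: "v u" "Phi (u * [:0, 1:]) = 1" using v_val by blast
    have *: "v (u ^ m * liftS w)" if "degree w \<le> m" for w m
      using that
    proof (induction w arbitrary: m)
      case 0
      have "v [:0:]" using v_c[of 0] by simp
      then show ?case by simp
    next
      case (pCons a w)
      show ?case
      proof (cases "w = 0")
        case True
        then have "u ^ m * liftS (pCons a w) = u ^ m * [:fps_to_fls a:]" by (simp add: map_poly_pCons)
        then show ?thesis using v_mult[OF v_power[OF u(1)] v_c] by simp
      next
        case False
        then obtain k where k: "m = Suc k" "degree w \<le> k" using pCons.prems by (cases m) auto
        have "u ^ m * liftS (pCons a w) = u ^ m * [:fps_to_fls a:] + (u ^ k * liftS w) * (u * [:0, 1:])"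
          by (simp add: map_poly_pCons k algebra_simps)
        moreover have "Phi ((u ^ k * liftS w) * (u * [:0, 1:])) = Phi ((u ^ k * liftS w) * 1)"
          by (rule Phi_cong_mult) (simp_all only: u Phi_1)
        ultimately have "Phi (u ^ m * [:fps_to_fls a:] + u ^ k * liftS w) = Phi (u ^ m * liftS (pCons a w))"
          by (simp add: Phi_add)
        moreover have "v (u ^ m * [:fps_to_fls a:] + u ^ k * liftS w)"
          using pCons.IH[OF k(2)] v_mult[OF v_power[OF u(1)] v_c] v_add by blast
        ultimately show ?thesis using v_cong by blast
      qed
    qed
    define P' where "P' = P - monom 1 N"
    have "degree P' \<le> N - 1"
    proof (rule degree_le, intro allI impI)
      fix i assume "N - 1 < i"
      then show "coeff P' i = 0" using monic_P by (cases "i = N") (auto simp: P'_def degree_P coeff_eq_0)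
    qed
    then have "degree (map_poly fps_of_poly P') \<le> N - 1"
      using map_poly_degree_leq order_trans by blast
    then have vP': "v (u ^ (N - 1) * liftP P')" unfolding liftP_conv_liftS by (rule *)
    have "[:0, 1:] ^ N = (monom 1 N :: 'q fls poly)" by (simp add: monom_altdef)
    then have "liftP P = liftP P' + [:0, 1:] ^ N" by (simp add: P'_def map_poly_monom flip: liftP_add)
         (simp add: P'_def poly_eq_iff coeff_map_poly PL_diff)
    then have eq: "u ^ (N - 1) * liftP P = u ^ (N - 1) * liftP P' + (u * [:0, 1:]) ^ (N - 1) * [:0, 1:]"
    proof -
      obtain k where k: "N = Suc k" using N_pos gr0_implies_Suc by blast
      have "u ^ k * [:0, 1:] ^ Suc k = (u * [:0, 1:]) ^ k * [:0, 1:]"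
        by (simp only: power_mult_distrib power_Suc mult_ac)
      then show ?thesis using \<open>liftP P = _\<close> by (simp only: k distrib_left diff_Suc_1)
    qed
    have "Phi ((u * [:0, 1:]) ^ k) = 1" for k
    proof (induction k)
      case (Suc k)
      have "Phi (u * [:0, 1:] * (u * [:0, 1:]) ^ k) = Phi (1 * 1)"
        by (rule Phi_cong_mult) (simp_all only: u Suc Phi_1)
      then show ?case by simp
    qed simp
    then have "Phi ((u * [:0, 1:]) ^ (N - 1) * [:0, 1:]) = Phi (1 * [:0, 1:])"
      by (intro Phi_cong_mult) simp_all
    moreover have "Phi (u ^ (N - 1) * liftP P) = 0" unfolding mult.commute[of _ "liftP P"] by (rule Phi_mult_eq_0[OF Phi_P])
    ultimately have "Phi (u ^ (N - 1) * liftP P') + Phi [:0, 1:] = 0"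
      unfolding eq by (simp add: Phi_add)
    then have "Phi (- (u ^ (N - 1) * liftP P')) = Phi [:0, 1:]"
      unfolding Phi_minus by (rule minus_unique)
    then show False using v_cong v_minus[OF vP'] nv by blast
  qed
  have v_liftS: "v (liftS w)" for w
  proof (induction w)
    case 0
    then show ?case using v_c[of 0] by simp
  next
    case (pCons a w)
    have "v ([:fps_to_fls a:] + [:0, 1:] * liftS w)" by (intro v_add v_mult v_c vx pCons)
    then show ?case by (simp add: map_poly_pCons)
  qed
  have low_imp_v: "v y" if y: "low 0 y" for y
  proof (rule ccontr)
    assume nv: "\<not> v y"
    then obtain u where u: "v u" "Phi (u * y) = 1" using v_val by blast
    obtain c where c: "\<And>g. degree g < N \<Longrightarrow> low 0 g \<Longrightarrow> \<exists>w. g = smult (XL (- int c)) (liftS w)"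
      using Phi_integral_bound unfolding low_def by blast
    \<comment> \<open>Only finitely many lists occur, so two powers of \<open>y\<close> agree below
      degree n (c + 1). Their difference is pi^(c+1) times an integral element, whose denominator is
      at most pi^c by \<open>Phi_integral_bound\<close>; one factor pi survives.\<close>
    define f where "f k = map (\<lambda>j. Phi (y ^ k) $$ int j) [0..<n * Suc c]" for k
    have "range f \<subseteq> {xs. set xs \<subseteq> UNIV \<and> length xs = n * Suc c}" by (auto simp: f_def)
    then have "finite (range f)" by (rule finite_subset) (intro finite_lists_length_eq, simp)
    then have "\<not> inj f" using finite_imageD infinite_UNIV_nat by blast
    then obtain i j where ij: "i < j" "f i = f j" unfolding inj_def by (metis linorder_neqE_nat)
    have "low (int (n * Suc c)) (y ^ j - y ^ i)" unfolding low_def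
    proof (intro allI impI)
      fix l assume l: "l < int (n * Suc c)"
      show "Phi (y ^ j - y ^ i) $$ l = 0"
      proof (cases "l < 0")
        case True
        then show ?thesis using low_power[OF y] by (simp add: low_def Phi_diff)
      next
        case False
        then obtain l' where l': "l = int l'" "l' < n * Suc c" using l by (metis not_less of_nat_less_iff zero_le_imp_eq_int)
        have "f i ! l' = f j ! l'" using ij by simp
        then show ?thesis using l' by (simp add: f_def Phi_diff del: mult_Suc_right upt_Suc)
      qed
    qed
    then have "low 0 (smult (XL (- int (Suc c))) (y ^ j - y ^ i))" by (simp add: low_XL algebra_simps)
    then have "low 0 (smult (XL (- int (Suc c))) (y ^ j - y ^ i) mod liftP P)" by (simp add: low_def Phi_mod)
    then obtain w where "smult (XL (- int (Suc c))) (y ^ j - y ^ i) mod liftP P = smult (XL (- int c)) (liftS w)"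
      using c degree_mod_P by blast
    then have *: "Phi (smult (XL (- int (Suc c))) (y ^ j - y ^ i)) = Phi (smult (XL (- int c)) (liftS w))"
      by (metis Phi_mod)
    have eq: "Phi (y ^ j - y ^ i) = Phi (smult (XL 1) (liftS w))"
    proof (rule fls_eqI)
      fix l
      show "Phi (y ^ j - y ^ i) $$ l = Phi (smult (XL 1) (liftS w)) $$ l"
        using arg_cong[where f = "\<lambda>f. f $$ (l - int n * int (Suc c))", OF *]
        unfolding Phi_XL_smult by (simp add: algebra_simps)
    qed
    have pow: "Phi (u ^ k * y ^ k) = 1" for k
    proof (induction k)
      case (Suc k)
      have "Phi (u * y * (u ^ k * y ^ k)) = Phi (1 * 1)" by (rule Phi_cong_mult) (simp_all only: u Suc Phi_1)
      then show ?case by (simp add: mult_ac)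
    qed simp
    obtain k where k: "j = i + Suc k" using ij(1) less_iff_Suc_add by auto
    define W where "W = u ^ j * liftS w"
    have vW: "v W" unfolding W_def by (intro v_mult v_power u v_liftS)
    \<comment> \<open>Multiplying y^j - y^i = pi w(T) by u^j, where u is the inverse of y, gives 1 -
      u^(k+1) = pi W.\<close>
    have one: "Phi (u * u ^ k + smult (XL 1) W) = 1"
    proof -
      have "Phi (u ^ j * (y ^ j - y ^ i)) = Phi (u ^ j * smult (XL 1) (liftS w))"
        by (rule Phi_cong_mult[OF refl eq])
      moreover have "Phi (u ^ j * y ^ i) = Phi (u ^ Suc k * 1)"
        using Phi_cong_mult[of "u ^ Suc k" "u ^ Suc k" "u ^ i * y ^ i" 1] pow[of i]
        by (simp add: k power_add mult_ac)
      ultimately show ?thesis using pow[of j] by (simp add: right_diff_distrib Phi_diff Phi_add W_def algebra_simps)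
    qed
    show False
    \<comment> \<open>If pi y is in the ring, multiplying the relation by y gives y = u^k + (pi y) W
      in the ring. Otherwise the inverse u' of pi y is in the ring, u = pi u', and the relation
      becomes 1/pi = u' u^k + W, which \<open>not_v\<close> excludes.\<close>
    proof (cases "v (smult (XL 1) y)")
      case True
      have "Phi (y * (u * u ^ k + smult (XL 1) W)) = Phi (y * 1)" by (rule Phi_cong_mult) (simp_all add: one)
      then have "Phi (u * y * u ^ k + smult (XL 1) y * W) = Phi y" by (simp add: algebra_simps)
      moreover have "Phi (u * y * u ^ k) = Phi (1 * u ^ k)" by (rule Phi_cong_mult) (simp_all add: u)
      ultimately have "Phi (u ^ k + smult (XL 1) y * W) = Phi y" by (simp add: Phi_add)
      moreover have "v (u ^ k + smult (XL 1) y * W)" by (intro v_add v_mult v_power u True vW)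
      ultimately show False using v_cong nv by blast
    next
      case False
      then obtain u' where u': "v u'" "Phi (u' * smult (XL 1) y) = 1" using v_val by blast
      have "Phi (u * (u' * smult (XL 1) y)) = Phi (u * 1)" by (rule Phi_cong_mult) (simp_all only: u' Phi_1)
      moreover have "Phi (smult (XL 1) u' * (u * y)) = Phi (smult (XL 1) u' * 1)" by (rule Phi_cong_mult) (simp_all add: u)
      ultimately have uu': "Phi u = Phi (smult (XL 1) u')" by (simp add: mult_ac)
      have "Phi (u * u ^ k) = Phi (smult (XL 1) u' * u ^ k)" by (rule Phi_cong_mult[OF uu' refl])
      with one have "Phi (smult (XL 1) (u' * u ^ k + W)) = 1" by (simp add: Phi_add smult_add_right)
      then have "Phi (smult (XL (- 1)) 1) = Phi (smult (XL (- 1)) (smult (XL 1) (u' * u ^ k + W)))"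
        by (simp only: Phi_smult Phi_1)
      then have "Phi (u' * u ^ k + W) = Phi [:XL (- 1):]" by (simp add: one_pCons flip: XL_add)
      moreover have "v (u' * u ^ k + W)" by (intro v_add v_mult v_power u u' vW)
      ultimately show False using v_cong not_v by blast
    qed
  qed
  \<comment> \<open>If y had negative order, its inverse u would have positive order. Then u^n / pi
    is integral, hence in the ring by \<open>low_imp_v\<close>, and multiplying it by y^n gives
    1/pi.\<close>
  have v_imp_low: "low 0 y" if y: "v y" for y
  proof (rule ccontr)
    assume nl: "\<not> low 0 y"
    define m where "m = fls_subdegree (Phi y)"
    have "Phi y \<noteq> 0" using nl by (auto simp: low_def)
    then have nz: "Phi y $$ m \<noteq> 0" "low m y" by (auto simp: m_def low_def)
    have "m < 0" using nl unfolding m_def low_def by (metis fls_eq0_below_subdegree not_less order_less_le_trans)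
    obtain u where u: "Phi (u * y) = 1" "low (- m) u" using ex_Phi_inverse_low[OF nz] by blast
    have "low (int n * (- m)) (u ^ n)" by (rule low_power[OF u(2)])
    moreover have "int n \<le> int n * (- m)" using \<open>m < 0\<close> mult_left_mono[of 1 "- m" "int n"] by simp
    ultimately have "low (int n) (u ^ n)" unfolding low_def by auto
    then have "low 0 (smult (XL (- 1)) (u ^ n))" by (simp add: low_XL)
    then have "v (smult (XL (- 1)) (u ^ n) * y ^ n)" by (intro v_mult v_power y low_imp_v)
    moreover have "Phi ((u * y) ^ k) = 1" for k
    proof (induction k)
      case (Suc k)
      have "Phi (u * y * (u * y) ^ k) = Phi (1 * 1)" by (rule Phi_cong_mult) (simp_all only: u Suc Phi_1)
      then show ?case by simp
    qed simp
    then have "Phi ([:XL (- 1):] * (u * y) ^ n) = Phi ([:XL (- 1):] * 1)" by (intro Phi_cong_mult) simp_all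
    then have "Phi (smult (XL (- 1)) (u ^ n) * y ^ n) = Phi [:XL (- 1):]"
      by (simp add: power_mult_distrib)
    ultimately show False using v_cong not_v by blast
  qed
  show ?thesis using low_imp_v v_imp_low by blast
qed

text \<open>P is monic, so division by it keeps power series coefficients, and representatives of
  any degree may be used.\<close>

lemma integrally_closed_iff_Phi: "integrally_closed \<longleftrightarrow> (\<forall>g. low 0 g \<longrightarrow> (\<exists>w. Phi g = Phi (liftS w)))"
proof
  assume ic: integrally_closed
  show "\<forall>g. low 0 g \<longrightarrow> (\<exists>w. Phi g = Phi (liftS w))"
  proof (intro allI impI)
    fix g assume "low 0 g"
    then have "g mod liftP P \<in> range liftS"
      using ic degree_mod_P unfolding integrally_closed_def low_def by (simp add: Phi_mod)
    then obtain w where "g mod liftP P = liftS w" by blast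
    then show "\<exists>w. Phi g = Phi (liftS w)" by (metis Phi_mod)
  qed
next
  assume *: "\<forall>g. low 0 g \<longrightarrow> (\<exists>w. Phi g = Phi (liftS w))"
  show integrally_closed unfolding integrally_closed_def
  proof (intro allI impI)
    fix g assume g: "degree g < N" "\<forall>i<0. Phi g $$ i = 0"
    then obtain w where w: "Phi g = Phi (liftS w)" using * unfolding low_def by blast
    let ?P = "map_poly fps_of_poly P"
    have dP: "degree ?P = N" using degree_map_poly[of fps_of_poly P] by (simp add: degree_P)
    have "lead_coeff ?P = 1" using monic_P by (simp add: dP coeff_map_poly degree_P)
    then obtain s t where st: "w = ?P * s + t" "degree t < degree ?P" using monic_division[of ?P w] N_pos dP by auto
    have "liftS w = liftP P * liftS s + liftS t" by (simp add: st(1) liftS_add liftS_mult liftP_conv_liftS)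
    then have "Phi (g - liftS t) = 0" by (simp add: Phi_diff w Phi_add Phi_mult_eq_0 Phi_P)
    moreover have "degree (g - liftS t) < N" using g(1) st(2) dP by (intro degree_diff_less) auto
    ultimately have "g - liftS t = 0" using Phi_inj by blast
    then show "g \<in> range liftS" by auto
  qed
qed

end

section \<open>Tensor products\<close>

lemma frag_extend_fun_add:
  "frag_extend (\<lambda>x. f x + g x) c = frag_extend f c + frag_extend g c"
  by (simp add: frag_extend_def frag_cmul_distrib2 sum.distrib)

lemma frag_extend_fun_0: "frag_extend (\<lambda>x. 0) c = 0"
  by (simp add: frag_extend_def)

text \<open>The additive extension of \<open>b\<close> from the basis of the free abelian group;
  maps out of tensor products are built from it.\<close>

definition frag_sum :: "('a \<Rightarrow> 'b::ring_1) \<Rightarrow> ('a \<Rightarrow>\<^sub>0 int) \<Rightarrow> 'b" where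
  "frag_sum b c = (\<Sum>k\<in>Poly_Mapping.keys c. of_int (Poly_Mapping.lookup c k) * b k)"

lemma frag_sum_superset:
  "finite F \<Longrightarrow> Poly_Mapping.keys c \<subseteq> F \<Longrightarrow> frag_sum b c = (\<Sum>k\<in>F. of_int (Poly_Mapping.lookup c k) * b k)"
  unfolding frag_sum_def by (rule sum.mono_neutral_left) (auto simp: in_keys_iff)

lemma frag_sum_add: "frag_sum b (c + c') = frag_sum b c + frag_sum b c'"
proof -
  let ?F = "Poly_Mapping.keys c \<union> Poly_Mapping.keys c'"
  have "Poly_Mapping.keys (c + c') \<subseteq> ?F" by (rule Poly_Mapping.keys_add)
  then show ?thesis
    by (simp add: frag_sum_superset[of ?F] lookup_add distrib_right sum.distrib)
qed

lemma frag_sum_0 [simp]: "frag_sum b 0 = 0" by (simp add: frag_sum_def)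
lemma frag_sum_of [simp]: "frag_sum b (frag_of x) = b x" by (simp add: frag_sum_def)
lemma frag_sum_minus: "frag_sum b (- c) = - frag_sum b c"
  using frag_sum_add[of b c "- c"] by (simp add: eq_neg_iff_add_eq_0 add.commute)
lemma frag_sum_diff: "frag_sum b (c - c') = frag_sum b c - frag_sum b c'"
  using frag_sum_add[of b c "- c'"] by (simp add: frag_sum_minus)

text \<open>Instantiated twice: k{tau} and K over F_q[pi] give k(tau), and F(pi) and F_q((pi)) over
  K give the completion.\<close>

locale tensor_product =
  fixes R :: "('r, 'w) ring_scheme" and \<alpha> :: "'r \<Rightarrow> 'm" and \<beta> :: "'r \<Rightarrow> 'n"
    and M :: "('m, 'u) ring_scheme" and N :: "('n, 'v) ring_scheme"
  assumes M: "ring M" and N: "ring N"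
    and \<alpha>_closed: "a \<in> carrier R \<Longrightarrow> \<alpha> a \<in> carrier M" and \<beta>_closed: "a \<in> carrier R \<Longrightarrow> \<beta> a \<in> carrier N"
    and \<alpha>_central: "a \<in> carrier R \<Longrightarrow> m \<in> carrier M \<Longrightarrow> \<alpha> a \<otimes>\<^bsub>M\<^esub> m = m \<otimes>\<^bsub>M\<^esub> \<alpha> a"
    and \<beta>_central: "a \<in> carrier R \<Longrightarrow> x \<in> carrier N \<Longrightarrow> \<beta> a \<otimes>\<^bsub>N\<^esub> x = x \<otimes>\<^bsub>N\<^esub> \<beta> a"
begin

interpretation M: ring M by (rule M)
interpretation N: ring N by (rule N)

abbreviation A where "A \<equiv> pair_ring M N"
abbreviation I where "I \<equiv> tensor_ideal R \<alpha> \<beta> M N"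
abbreviation Q where "Q \<equiv> tensor_ring R \<alpha> \<beta> M N"
abbreviation pure where "pure \<equiv> pure_tensor R \<alpha> \<beta> M N"

lemma carrier_A: "carrier A = {c. Poly_Mapping.keys c \<subseteq> carrier M \<times> carrier N}"
  and add_A: "x \<oplus>\<^bsub>A\<^esub> y = x + y" and zero_A: "\<zero>\<^bsub>A\<^esub> = 0" and one_A: "\<one>\<^bsub>A\<^esub> = frag_of (\<one>\<^bsub>M\<^esub>, \<one>\<^bsub>N\<^esub>)"
  by (simp_all add: pair_ring_def)

lemma mult_A: "c \<otimes>\<^bsub>A\<^esub> c' = frag_extend (\<lambda>p. frag_extend (\<lambda>p'. frag_of (fst p \<otimes>\<^bsub>M\<^esub> fst p', snd p \<otimes>\<^bsub>N\<^esub> snd p')) c') c"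
  by (simp add: pair_ring_def case_prod_beta')

lemma mult_A_add_left: "(a + b) \<otimes>\<^bsub>A\<^esub> c = a \<otimes>\<^bsub>A\<^esub> c + b \<otimes>\<^bsub>A\<^esub> c"
  by (simp add: mult_A frag_extend_add)
lemma mult_A_add_right: "c \<otimes>\<^bsub>A\<^esub> (a + b) = c \<otimes>\<^bsub>A\<^esub> a + c \<otimes>\<^bsub>A\<^esub> b"
  by (simp add: mult_A frag_extend_add frag_extend_fun_add)
lemma mult_A_0_left: "0 \<otimes>\<^bsub>A\<^esub> c = 0" by (simp add: mult_A)
lemma mult_A_0_right: "c \<otimes>\<^bsub>A\<^esub> 0 = 0" by (simp add: mult_A frag_extend_fun_0)
lemma mult_A_diff_left: "(a - b) \<otimes>\<^bsub>A\<^esub> c = a \<otimes>\<^bsub>A\<^esub> c - b \<otimes>\<^bsub>A\<^esub> c"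
  using mult_A_add_left[of "a - b" b c] by simp
lemma mult_A_diff_right: "c \<otimes>\<^bsub>A\<^esub> (a - b) = c \<otimes>\<^bsub>A\<^esub> a - c \<otimes>\<^bsub>A\<^esub> b"
  using mult_A_add_right[of c "a - b" b] by simp
lemma mult_A_of: "frag_of (m, x) \<otimes>\<^bsub>A\<^esub> frag_of (m', x') = frag_of (m \<otimes>\<^bsub>M\<^esub> m', x \<otimes>\<^bsub>N\<^esub> x')"
  by (simp add: mult_A)

lemma carrier_A_induct [consumes 1, case_names zero of diff]:
  assumes "c \<in> carrier A" "P 0" "\<And>m x. m \<in> carrier M \<Longrightarrow> x \<in> carrier N \<Longrightarrow> P (frag_of (m, x))"
    "\<And>a b. P a \<Longrightarrow> P b \<Longrightarrow> P (a - b)"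
  shows "P c"
  using frag_induction[of c "carrier M \<times> carrier N" P] assms by (auto simp: carrier_A)

lemma of_closed: "m \<in> carrier M \<Longrightarrow> x \<in> carrier N \<Longrightarrow> frag_of (m, x) \<in> carrier A"
  by (simp add: carrier_A)

lemma diff_closed: "a \<in> carrier A \<Longrightarrow> b \<in> carrier A \<Longrightarrow> a - b \<in> carrier A"
  using keys_diff[of a b] by (auto simp: carrier_A)

lemma mult_A_closed:
  assumes "a \<in> carrier A" "b \<in> carrier A"
  shows "a \<otimes>\<^bsub>A\<^esub> b \<in> carrier A"
  using assms
proof (induction a rule: carrier_A_induct)
  case (of m x)
  from of(3) show ?case
  proof (induction b rule: carrier_A_induct)
    case (of m' x')
    then show ?case using \<open>m \<in> carrier M\<close> \<open>x \<in> carrier N\<close> by (simp add: mult_A_of of_closed)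
  qed (simp_all add: mult_A_0_right mult_A_diff_right diff_closed, simp add: carrier_A)
qed (simp_all add: mult_A_0_left mult_A_diff_left diff_closed, simp add: carrier_A)

lemma ring_A: "ring A"
proof (rule ringI)
  show "abelian_group A"
  proof (rule abelian_groupI)
    fix x assume "x \<in> carrier A"
    then show "\<exists>y\<in>carrier A. y \<oplus>\<^bsub>A\<^esub> x = \<zero>\<^bsub>A\<^esub>"
      by (intro bexI[of _ "- x"]) (auto simp: carrier_A add_A zero_A keys_minus)
  next
    fix x y assume "x \<in> carrier A" "y \<in> carrier A"
    then show "x \<oplus>\<^bsub>A\<^esub> y \<in> carrier A" using Poly_Mapping.keys_add[of x y] by (auto simp: carrier_A add_A)
  qed (auto simp: carrier_A add_A zero_A)
  show "monoid A"
  proof (rule monoidI)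
    fix a b c assume "a \<in> carrier A" "b \<in> carrier A" "c \<in> carrier A"
    then show "a \<otimes>\<^bsub>A\<^esub> b \<otimes>\<^bsub>A\<^esub> c = a \<otimes>\<^bsub>A\<^esub> (b \<otimes>\<^bsub>A\<^esub> c)"
    proof (induction a rule: carrier_A_induct)
      case (of m x)
      from of(3,4) show ?case
      proof (induction b rule: carrier_A_induct)
        case (of m' x')
        from of(3) show ?case
        proof (induction c rule: carrier_A_induct)
          case (of m'' x'')
          then show ?case
            using \<open>m \<in> carrier M\<close> \<open>x \<in> carrier N\<close> \<open>m' \<in> carrier M\<close> \<open>x' \<in> carrier N\<close>
            by (simp add: mult_A_of M.m_assoc N.m_assoc)
        qed (simp_all add: mult_A_0_right mult_A_diff_right)
      qed (simp_all add: mult_A_0_right mult_A_diff_right mult_A_0_left mult_A_diff_left)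
    qed (simp_all add: mult_A_0_left mult_A_diff_left)
  next
    fix a assume "a \<in> carrier A"
    then show "\<one>\<^bsub>A\<^esub> \<otimes>\<^bsub>A\<^esub> a = a"
      by (induction a rule: carrier_A_induct) (simp_all add: one_A mult_A_of mult_A_0_right mult_A_diff_right)
  next
    fix a assume "a \<in> carrier A"
    then show "a \<otimes>\<^bsub>A\<^esub> \<one>\<^bsub>A\<^esub> = a"
      by (induction a rule: carrier_A_induct) (simp_all add: one_A mult_A_of mult_A_0_left mult_A_diff_left)
  qed (simp_all add: mult_A_closed one_A of_closed)
qed (simp_all add: add_A mult_A_add_left mult_A_add_right)

interpretation A: ring A by (rule ring_A)

lemma minus_A: "a \<in> carrier A \<Longrightarrow> \<ominus>\<^bsub>A\<^esub> a = - a"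
  by (rule A.minus_equality) (auto simp: add_A zero_A carrier_A keys_minus)

lemma diff_A: "a \<in> carrier A \<Longrightarrow> b \<in> carrier A \<Longrightarrow> a \<ominus>\<^bsub>A\<^esub> b = a - b"
  by (simp add: a_minus_def minus_A add_A)

lemma relators_closed: "tensor_relators R \<alpha> \<beta> M N \<subseteq> carrier A"
  unfolding tensor_relators_def
  by (auto intro!: diff_closed of_closed simp: \<alpha>_closed \<beta>_closed)

lemma I_induct [consumes 1, case_names zero rel minus add]:
  assumes "c \<in> I" "P 0" "\<And>c. c \<in> tensor_relators R \<alpha> \<beta> M N \<Longrightarrow> P c" "\<And>a. P a \<Longrightarrow> P (- a)"
    "\<And>a b. P a \<Longrightarrow> P b \<Longrightarrow> P (a + b)"
  shows "P c"
  using assms(1) unfolding tensor_ideal_def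
proof (induction rule: generate.induct)
  case one
  then show ?case using assms(2) by (simp add: zero_A)
next
  case (inv h)
  then have "inv\<^bsub>add_monoid A\<^esub> h = - h" using minus_A relators_closed by (auto simp: a_inv_def)
  then show ?case using assms(3,4) inv by simp
qed (use assms in \<open>auto simp: add_A\<close>)

lemma I_subgroup: "subgroup I (add_monoid A)"
  unfolding tensor_ideal_def by (rule A.add.generate_is_subgroup) (use relators_closed in auto)

lemma I_carrier: "c \<in> I \<Longrightarrow> c \<in> carrier A"
  using subgroup.subset[OF I_subgroup] by auto

lemma I_zero: "0 \<in> I" using subgroup.one_closed[OF I_subgroup] by (simp add: zero_A)
lemma I_add: "a \<in> I \<Longrightarrow> b \<in> I \<Longrightarrow> a + b \<in> I"
  using subgroup.m_closed[OF I_subgroup] by (simp add: add_A)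
lemma I_minus: "a \<in> I \<Longrightarrow> - a \<in> I"
  using subgroup.m_inv_closed[OF I_subgroup, of a] minus_A[OF I_carrier, of a] by (simp add: a_inv_def)
lemma I_diff: "a \<in> I \<Longrightarrow> b \<in> I \<Longrightarrow> a - b \<in> I"
  using I_add[OF _ I_minus] by fastforce
lemma I_rel: "c \<in> tensor_relators R \<alpha> \<beta> M N \<Longrightarrow> c \<in> I"
  unfolding tensor_ideal_def by (rule generate.incl)

lemma rel_addM: "m \<in> carrier M \<Longrightarrow> m' \<in> carrier M \<Longrightarrow> x \<in> carrier N \<Longrightarrow>
    frag_of (m \<oplus>\<^bsub>M\<^esub> m', x) - frag_of (m, x) - frag_of (m', x) \<in> I"
  and rel_addN: "m \<in> carrier M \<Longrightarrow> x \<in> carrier N \<Longrightarrow> x' \<in> carrier N \<Longrightarrow>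
    frag_of (m, x \<oplus>\<^bsub>N\<^esub> x') - frag_of (m, x) - frag_of (m, x') \<in> I"
  and rel_scal: "a \<in> carrier R \<Longrightarrow> m \<in> carrier M \<Longrightarrow> x \<in> carrier N \<Longrightarrow>
    frag_of (\<alpha> a \<otimes>\<^bsub>M\<^esub> m, x) - frag_of (m, \<beta> a \<otimes>\<^bsub>N\<^esub> x) \<in> I"
  by (rule I_rel; unfold tensor_relators_def; blast)+

text \<open>A relator times a basis pair is a relator again; for the scalar relation this is where
  centrality enters.\<close>

lemma rel_mult:
  assumes "c \<in> tensor_relators R \<alpha> \<beta> M N" "p \<in> carrier M" "y \<in> carrier N"
  shows "frag_of (p, y) \<otimes>\<^bsub>A\<^esub> c \<in> I" "c \<otimes>\<^bsub>A\<^esub> frag_of (p, y) \<in> I"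
proof -
  have "frag_of (p, y) \<otimes>\<^bsub>A\<^esub> c \<in> I \<and> c \<otimes>\<^bsub>A\<^esub> frag_of (p, y) \<in> I"
    using assms(1) unfolding tensor_relators_def Un_iff mem_Collect_eq
  proof (elim disjE exE conjE)
    fix m m' x
    assume "m \<in> carrier M" "m' \<in> carrier M" "x \<in> carrier N"
      "c = frag_of (m \<oplus>\<^bsub>M\<^esub> m', x) - frag_of (m, x) - frag_of (m', x)"
    then show ?thesis using assms(2,3)
      by (simp add: mult_A_diff_left mult_A_diff_right mult_A_of M.l_distr M.r_distr rel_addM)
  next
    fix m x x'
    assume "m \<in> carrier M" "x \<in> carrier N" "x' \<in> carrier N"
      "c = frag_of (m, x \<oplus>\<^bsub>N\<^esub> x') - frag_of (m, x) - frag_of (m, x')"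
    then show ?thesis using assms(2,3)
      by (simp add: mult_A_diff_left mult_A_diff_right mult_A_of N.l_distr N.r_distr rel_addN)
  next
    fix a m x
    assume *: "a \<in> carrier R" "m \<in> carrier M" "x \<in> carrier N"
      "c = frag_of (\<alpha> a \<otimes>\<^bsub>M\<^esub> m, x) - frag_of (m, \<beta> a \<otimes>\<^bsub>N\<^esub> x)"
    have "p \<otimes>\<^bsub>M\<^esub> (\<alpha> a \<otimes>\<^bsub>M\<^esub> m) = \<alpha> a \<otimes>\<^bsub>M\<^esub> (p \<otimes>\<^bsub>M\<^esub> m)"
      using * assms(2,3) \<alpha>_closed \<alpha>_central[of a p] by (simp flip: M.m_assoc)
    moreover have "y \<otimes>\<^bsub>N\<^esub> (\<beta> a \<otimes>\<^bsub>N\<^esub> x) = \<beta> a \<otimes>\<^bsub>N\<^esub> (y \<otimes>\<^bsub>N\<^esub> x)"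
      using * assms(2,3) \<beta>_closed \<beta>_central[of a y] by (simp flip: N.m_assoc)
    ultimately show ?thesis using * assms(2,3) \<alpha>_closed \<beta>_closed
      by (simp add: mult_A_diff_left mult_A_diff_right mult_A_of M.m_assoc N.m_assoc rel_scal)
  qed
  then show "frag_of (p, y) \<otimes>\<^bsub>A\<^esub> c \<in> I" "c \<otimes>\<^bsub>A\<^esub> frag_of (p, y) \<in> I" by blast+
qed

lemma mult_A_minus_left: "(- a) \<otimes>\<^bsub>A\<^esub> c = - (a \<otimes>\<^bsub>A\<^esub> c)" and mult_A_minus_right: "c \<otimes>\<^bsub>A\<^esub> (- a) = - (c \<otimes>\<^bsub>A\<^esub> a)"
  using mult_A_diff_left[of 0 a c] mult_A_diff_right[of c 0 a] by (simp_all add: mult_A_0_left mult_A_0_right)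

lemma ideal_I: "ideal I A"
proof (rule idealI[OF ring_A I_subgroup])
  fix a x assume a: "a \<in> I" and x: "x \<in> carrier A"
  from a show "x \<otimes>\<^bsub>A\<^esub> a \<in> I"
  proof (induction a rule: I_induct)
    case (rel c)
    with x show ?case
      by (induction x rule: carrier_A_induct) (simp_all add: mult_A_0_left I_zero mult_A_diff_left I_diff rel_mult)
  qed (simp_all add: mult_A_0_right mult_A_minus_right mult_A_add_right I_zero I_add I_minus)
  from a show "a \<otimes>\<^bsub>A\<^esub> x \<in> I"
  proof (induction a rule: I_induct)
    case (rel c)
    with x show ?case
      by (induction x rule: carrier_A_induct) (simp_all add: mult_A_0_right I_zero mult_A_diff_right I_diff rel_mult)
  qed (simp_all add: mult_A_0_left mult_A_minus_left mult_A_add_left I_zero I_add I_minus)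
qed

lemma ring_Q: "ring Q"
  unfolding tensor_ring_def by (rule ideal.quotient_is_ring[OF ideal_I])

interpretation Q: ring Q by (rule ring_Q)

abbreviation proj where "proj c \<equiv> I +>\<^bsub>A\<^esub> c"

lemma proj_hom: "proj \<in> ring_hom A Q"
  unfolding tensor_ring_def by (rule ideal.rcos_ring_hom[OF ideal_I])

lemma pure_conv_proj: "pure m x = proj (frag_of (m, x))"
  by (simp add: pure_tensor_def)

lemma proj_eq_iff: "a \<in> carrier A \<Longrightarrow> b \<in> carrier A \<Longrightarrow> proj a = proj b \<longleftrightarrow> a - b \<in> I"
  using A.quotient_eq_iff_same_a_r_cos[OF ideal_I, of a b] by (simp add: diff_A)

lemma proj_add: "a \<in> carrier A \<Longrightarrow> b \<in> carrier A \<Longrightarrow> proj (a + b) = proj a \<oplus>\<^bsub>Q\<^esub> proj b"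
  using ring_hom_add[OF proj_hom] by (simp add: add_A)

lemma proj_closed: "a \<in> carrier A \<Longrightarrow> proj a \<in> carrier Q"
  by (rule ring_hom_closed[OF proj_hom])

lemma carrier_Q: "carrier Q = proj ` carrier A"
  by (auto simp: tensor_ring_def FactRing_def A_RCOSETS_def')

lemma proj_zero: "proj 0 = \<zero>\<^bsub>Q\<^esub>"
  using ring_hom_zero[OF proj_hom ring_A ring_Q] by (simp add: zero_A)

lemma proj_minus: "a \<in> carrier A \<Longrightarrow> proj (- a) = \<ominus>\<^bsub>Q\<^esub> proj a"
  using proj_add[of "- a" a] proj_closed[of "- a"] proj_closed[of a] proj_zero Q.minus_equality
  by (simp add: carrier_A keys_minus)

lemma proj_diff: "a \<in> carrier A \<Longrightarrow> b \<in> carrier A \<Longrightarrow> proj (a - b) = proj a \<ominus>\<^bsub>Q\<^esub> proj b"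
  using proj_add[of a "- b"] proj_minus[of b] by (simp add: carrier_A keys_minus a_minus_def)

lemma pure_closed: "m \<in> carrier M \<Longrightarrow> x \<in> carrier N \<Longrightarrow> pure m x \<in> carrier Q"
  by (simp add: pure_conv_proj proj_closed of_closed)

lemma pure_addM:
  assumes "m \<in> carrier M" "m' \<in> carrier M" "x \<in> carrier N"
  shows "pure (m \<oplus>\<^bsub>M\<^esub> m') x = pure m x \<oplus>\<^bsub>Q\<^esub> pure m' x"
proof -
  have "frag_of (m, x) + frag_of (m', x) = frag_of (m, x) - (0 - frag_of (m', x))" by simp
  also have "\<dots> \<in> carrier A" using assms by (intro diff_closed of_closed) (simp_all add: carrier_A)
  finally have "proj (frag_of (m \<oplus>\<^bsub>M\<^esub> m', x)) = proj (frag_of (m, x) + frag_of (m', x))"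
    using assms rel_addM[of m m' x] by (subst proj_eq_iff) (auto intro: of_closed simp: diff_diff_eq)
  then show ?thesis using assms by (simp add: pure_conv_proj proj_add of_closed)
qed

lemma pure_addN:
  assumes "m \<in> carrier M" "x \<in> carrier N" "x' \<in> carrier N"
  shows "pure m (x \<oplus>\<^bsub>N\<^esub> x') = pure m x \<oplus>\<^bsub>Q\<^esub> pure m x'"
proof -
  have "frag_of (m, x) + frag_of (m, x') = frag_of (m, x) - (0 - frag_of (m, x'))" by simp
  also have "\<dots> \<in> carrier A" using assms by (intro diff_closed of_closed) (simp_all add: carrier_A)
  finally have "proj (frag_of (m, x \<oplus>\<^bsub>N\<^esub> x')) = proj (frag_of (m, x) + frag_of (m, x'))"
    using assms rel_addN[of m x x'] by (subst proj_eq_iff) (auto intro: of_closed simp: diff_diff_eq)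
  then show ?thesis using assms by (simp add: pure_conv_proj proj_add of_closed)
qed

lemma pure_scal:
  assumes "a \<in> carrier R" "m \<in> carrier M" "x \<in> carrier N"
  shows "pure (\<alpha> a \<otimes>\<^bsub>M\<^esub> m) x = pure m (\<beta> a \<otimes>\<^bsub>N\<^esub> x)"
  unfolding pure_conv_proj using assms rel_scal[OF assms] \<alpha>_closed \<beta>_closed
  by (subst proj_eq_iff) (auto intro: of_closed)

lemma pure_mult:
  assumes "m \<in> carrier M" "m' \<in> carrier M" "x \<in> carrier N" "x' \<in> carrier N"
  shows "pure m x \<otimes>\<^bsub>Q\<^esub> pure m' x' = pure (m \<otimes>\<^bsub>M\<^esub> m') (x \<otimes>\<^bsub>N\<^esub> x')"
  using assms ring_hom_mult[OF proj_hom, of "frag_of (m, x)" "frag_of (m', x')"]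
  by (simp add: pure_conv_proj of_closed mult_A_of)

lemma pure_one: "pure \<one>\<^bsub>M\<^esub> \<one>\<^bsub>N\<^esub> = \<one>\<^bsub>Q\<^esub>"
  using ring_hom_one[OF proj_hom] by (simp add: pure_conv_proj one_A)

lemma pure_zeroM: "x \<in> carrier N \<Longrightarrow> pure \<zero>\<^bsub>M\<^esub> x = \<zero>\<^bsub>Q\<^esub>"
  using pure_addM[of "\<zero>\<^bsub>M\<^esub>" "\<zero>\<^bsub>M\<^esub>" x] pure_closed[of "\<zero>\<^bsub>M\<^esub>" x] by (simp add: Q.add.r_cancel_one')

lemma pure_minusM: "m \<in> carrier M \<Longrightarrow> x \<in> carrier N \<Longrightarrow> pure (\<ominus>\<^bsub>M\<^esub> m) x = \<ominus>\<^bsub>Q\<^esub> pure m x"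
  using pure_addM[of "\<ominus>\<^bsub>M\<^esub> m" m x] pure_closed[of m x] pure_closed[of "\<ominus>\<^bsub>M\<^esub> m" x]
  by (metis M.a_inv_closed M.l_neg Q.minus_equality pure_zeroM)

text \<open>Sums suffice in place of differences, because the negative of a pure tensor is the pure
  tensor with its first factor negated.\<close>

lemma Q_induct [consumes 1, case_names pure add]:
  assumes "U \<in> carrier Q" and pure: "\<And>m x. m \<in> carrier M \<Longrightarrow> x \<in> carrier N \<Longrightarrow> P (pure m x)"
    and add: "\<And>U V. U \<in> carrier Q \<Longrightarrow> V \<in> carrier Q \<Longrightarrow> P U \<Longrightarrow> P V \<Longrightarrow> P (U \<oplus>\<^bsub>Q\<^esub> V)"
  shows "P U"
proof -
  obtain c where "c \<in> carrier A" and U: "U = proj c" using assms(1) by (auto simp: carrier_Q)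
  from \<open>c \<in> carrier A\<close> have "P (proj c) \<and> P (\<ominus>\<^bsub>Q\<^esub> proj c) \<and> c \<in> carrier A"
  proof (induction c rule: carrier_A_induct)
    case zero
    then show ?case using pure[of "\<zero>\<^bsub>M\<^esub>" "\<zero>\<^bsub>N\<^esub>"] by (simp add: proj_zero pure_zeroM carrier_A)
  next
    case (of m x)
    then show ?case using pure[of m x] pure[of "\<ominus>\<^bsub>M\<^esub> m" x]
      by (simp add: pure_minusM of_closed flip: pure_conv_proj)
  next
    case (diff a b)
    then have ab: "a \<in> carrier A" "b \<in> carrier A" "proj a \<in> carrier Q" "proj b \<in> carrier Q"
      by (simp_all add: proj_closed)
    have "proj (a - b) = proj a \<oplus>\<^bsub>Q\<^esub> \<ominus>\<^bsub>Q\<^esub> proj b" using ab by (simp add: proj_diff a_minus_def)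
    moreover have "\<ominus>\<^bsub>Q\<^esub> proj (a - b) = \<ominus>\<^bsub>Q\<^esub> proj a \<oplus>\<^bsub>Q\<^esub> proj b" using ab by (simp add: calculation Q.minus_add)
    ultimately show ?case using diff ab add by (simp add: diff_closed)
  qed
  then show ?thesis by (simp add: U)
qed

text \<open>The universal property for additive maps only: the targets used are
  \<open>'k fls\<close>, whose commutative product is not the one of k((tau)).\<close>

lemma ex_lift:
  fixes b :: "'m \<Rightarrow> 'n \<Rightarrow> 'g::ring_1"
  assumes addM: "\<And>m m' x. m \<in> carrier M \<Longrightarrow> m' \<in> carrier M \<Longrightarrow> x \<in> carrier N \<Longrightarrow> b (m \<oplus>\<^bsub>M\<^esub> m') x = b m x + b m' x"
    and addN: "\<And>m x x'. m \<in> carrier M \<Longrightarrow> x \<in> carrier N \<Longrightarrow> x' \<in> carrier N \<Longrightarrow> b m (x \<oplus>\<^bsub>N\<^esub> x') = b m x + b m x'"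
    and scal: "\<And>a m x. a \<in> carrier R \<Longrightarrow> m \<in> carrier M \<Longrightarrow> x \<in> carrier N \<Longrightarrow> b (\<alpha> a \<otimes>\<^bsub>M\<^esub> m) x = b m (\<beta> a \<otimes>\<^bsub>N\<^esub> x)"
  shows "\<exists>h. (\<forall>U\<in>carrier Q. \<forall>V\<in>carrier Q. h (U \<oplus>\<^bsub>Q\<^esub> V) = h U + h V) \<and>
             (\<forall>m\<in>carrier M. \<forall>x\<in>carrier N. h (pure m x) = b m x)"
proof -
  let ?f = "frag_sum (\<lambda>(m, x). b m x)"
  have I0: "?f c = 0" if "c \<in> I" for c
    using that
  proof (induction c rule: I_induct)
    case (rel c)
    then show ?case
      unfolding tensor_relators_def by (auto simp: frag_sum_diff addM addN scal)
  qed (simp_all add: frag_sum_minus frag_sum_add)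
  define h where "h U = ?f (SOME c. c \<in> carrier A \<and> proj c = U)" for U
  have h: "h (proj c) = ?f c" if "c \<in> carrier A" for c
  proof -
    let ?c = "SOME c'. c' \<in> carrier A \<and> proj c' = proj c"
    have "?c \<in> carrier A \<and> proj ?c = proj c" by (rule someI[of _ c]) (simp add: that)
    then have "?c - c \<in> I" using that proj_eq_iff by blast
    then have "?f (?c - c) = 0" by (rule I0)
    then show ?thesis by (simp add: h_def frag_sum_diff)
  qed
  show ?thesis
  proof (intro exI[of _ h] conjI ballI)
    fix U V assume "U \<in> carrier Q" "V \<in> carrier Q"
    then obtain c d where "c \<in> carrier A" "U = proj c" "d \<in> carrier A" "V = proj d" by (auto simp: carrier_Q)
    moreover from this have "c + d \<in> carrier A" using A.add.m_closed[of c d] by (simp add: add_A)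
    ultimately show "h (U \<oplus>\<^bsub>Q\<^esub> V) = h U + h V" by (simp add: h frag_sum_add flip: proj_add)
  next
    fix m x assume "m \<in> carrier M" "x \<in> carrier N"
    then show "h (pure m x) = b m x" by (simp add: pure_conv_proj h of_closed)
  qed
qed

end

section \<open>Evaluation of polynomials by Horner's rule\<close>

lemma poly_monom_induct [case_names add monom]:
  fixes p :: "'a::comm_monoid_add poly"
  assumes "\<And>p q. Q p \<Longrightarrow> Q q \<Longrightarrow> Q (p + q)" "\<And>c j. Q (monom c j)"
  shows "Q p"
proof -
  have "Q (\<Sum>i\<le>m. monom (coeff p i) i)" for m
    by (induction m) (auto intro: assms)
  then show ?thesis by (metis poly_as_sum_of_monoms)
qed

definition horner :: "('s, 'u) ring_scheme \<Rightarrow> ('f::zero \<Rightarrow> 's) \<Rightarrow> 's \<Rightarrow> 'f poly \<Rightarrow> 's" where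
  "horner S C t p = fold_coeffs (\<lambda>a y. C a \<oplus>\<^bsub>S\<^esub> t \<otimes>\<^bsub>S\<^esub> y) p \<zero>\<^bsub>S\<^esub>"

text \<open>Only \<open>t\<close> and the coefficients have to commute, not the whole ring. The
  instances are T over K in k(tau) and T over F_q((pi)) in the completion.\<close>

locale horner_map = ring S for S (structure) +
  fixes C :: "'f::comm_ring_1 \<Rightarrow> 'a" and t :: 'a
  assumes C_closed: "C a \<in> carrier S" and t_closed: "t \<in> carrier S"
    and C_add: "C (a + b) = C a \<oplus> C b" and C_mult: "C (a * b) = C a \<otimes> C b" and C_one: "C 1 = \<one>"
    and C_comm: "C a \<otimes> t = t \<otimes> C a"
begin

abbreviation hor where "hor \<equiv> horner S C t"

lemma C_zero: "C 0 = \<zero>"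
  using C_add[of 0 0] C_closed[of 0] by (simp add: add.r_cancel_one')

lemma hor_0: "hor 0 = \<zero>" by (simp add: horner_def)

lemma hor_pCons: "hor (pCons a p) = C a \<oplus> t \<otimes> hor p"
  by (cases "p = 0 \<and> a = 0") (auto simp: horner_def C_zero t_closed)

lemma hor_closed: "hor p \<in> carrier S"
  by (induction p) (simp_all add: hor_0 hor_pCons C_closed t_closed)

lemma hor_const: "hor [:c:] = C c"
  by (simp add: hor_pCons hor_0 C_closed t_closed)

lemma hor_x: "hor [:0, 1:] = t"
  by (simp add: hor_pCons hor_0 C_closed t_closed C_zero C_one)

lemma hor_1: "hor 1 = \<one>"
  using hor_const[of 1] by (simp add: one_pCons C_one)

lemma hor_add: "hor (p + q) = hor p \<oplus> hor q"
proof (induction p arbitrary: q)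
  case (pCons a p)
  obtain b q' where q: "q = pCons b q'" by (cases q)
  have "hor (pCons a p + q) = (C a \<oplus> C b) \<oplus> t \<otimes> (hor p \<oplus> hor q')"
    by (simp add: q hor_pCons pCons.IH C_add)
  also have "\<dots> = hor (pCons a p) \<oplus> hor q"
    by (simp add: q hor_pCons r_distr a_ac C_closed t_closed hor_closed)
  finally show ?case .
qed (simp add: hor_0 hor_closed)

lemma hor_smult: "hor (smult c p) = C c \<otimes> hor p"
proof (induction p)
  case (pCons a p)
  have "C c \<otimes> (t \<otimes> hor p) = t \<otimes> (C c \<otimes> hor p)"
    using C_comm by (simp add: C_closed t_closed hor_closed flip: m_assoc)
  then show ?case using pCons by (simp add: hor_pCons C_mult r_distr C_closed t_closed hor_closed)
qed (simp add: hor_0 C_closed)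

lemma hor_mult: "hor (p * q) = hor p \<otimes> hor q"
proof (induction p)
  case (pCons a p)
  then show ?case
    by (simp add: hor_add hor_smult hor_pCons C_zero l_distr m_assoc C_closed t_closed hor_closed)
qed (simp add: hor_0 hor_closed)

lemma hor_minus: "hor (- p) = \<ominus> hor p"
  using hor_add[of "- p" p] minus_equality[of "hor (- p)" "hor p"] by (simp add: hor_0 hor_closed)

lemma hor_inverse:
  assumes "hor (u * p) = \<one>"
  shows "inv (hor p) = hor u"
proof (rule inv_char)
  show "hor p \<otimes> hor u = \<one>" using assms by (simp add: mult.commute flip: hor_mult)
  show "hor u \<otimes> hor p = \<one>" using assms by (simp flip: hor_mult)
qed (simp_all add: hor_closed)

end

section \<open>The field \<open>F(\<pi>)\<close>\<close>

lemma ring_of_type_algebra_simps [simp]: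
  "carrier ring_of_type_algebra = UNIV" "x \<otimes>\<^bsub>ring_of_type_algebra\<^esub> y = x * y"
  "x \<oplus>\<^bsub>ring_of_type_algebra\<^esub> y = x + y" "\<one>\<^bsub>ring_of_type_algebra\<^esub> = 1" "\<zero>\<^bsub>ring_of_type_algebra\<^esub> = 0"
  by (simp_all add: ring_of_type_algebra_def)

lemma fract_cases_nz: obtains a b where "(x :: 'a::idom fract) = Fract a b" "b \<noteq> 0"
  by (cases x) auto

lemma PL_eq_0_iff: "PL p = 0 \<longleftrightarrow> p = 0"
  using PL_eq_iff[of p 0] by simp

lemma fract_to_fls_Fract': "b \<noteq> 0 \<Longrightarrow> fract_to_fls (Fract a b) = PL a / PL b"
  by (simp add: fract_to_fls_Fract PL_def)

lemma fract_to_fls_to_fract: "fract_to_fls (to_fract a) = PL (a :: 'a::field poly)"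
  by (simp add: to_fract_def fract_to_fls_Fract')

lemma fract_to_fls_add: "fract_to_fls (x + y) = fract_to_fls x + fract_to_fls (y :: 'a::field poly fract)"
proof -
  obtain a b c d where "x = Fract a b" "b \<noteq> 0" "y = Fract c d" "d \<noteq> 0" by (metis fract_cases_nz)
  then show ?thesis by (simp add: fract_to_fls_Fract' PL_add PL_mult PL_eq_0_iff add_frac_eq)
qed

lemma fract_to_fls_mult: "fract_to_fls (x * y) = fract_to_fls x * fract_to_fls (y :: 'a::field poly fract)"
proof -
  obtain a b c d where "x = Fract a b" "b \<noteq> 0" "y = Fract c d" "d \<noteq> 0" by (metis fract_cases_nz)
  then show ?thesis by (simp add: fract_to_fls_Fract' PL_mult)
qed

lemma fract_to_fls_0 [simp]: "fract_to_fls (0 :: 'a::field poly fract) = 0"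
  and fract_to_fls_1 [simp]: "fract_to_fls (1 :: 'a::field poly fract) = 1"
  using fract_to_fls_to_fract[of 0] fract_to_fls_to_fract[of 1] by simp_all

lemma fract_to_fls_eq_0_iff: "fract_to_fls x = 0 \<longleftrightarrow> (x :: 'a::field poly fract) = 0"
proof
  assume *: "fract_to_fls x = 0"
  show "x = 0"
  proof (rule ccontr)
    assume "x \<noteq> 0"
    then have "fract_to_fls (x * inverse x) = 1" by simp
    then show False unfolding fract_to_fls_mult * by simp
  qed
qed simp

context drinfeld
begin

lemma twisted_simps [simp]:
  "carrier (twisted_poly_ring CARD('q) :: 'k poly ring) = UNIV" "f \<otimes>\<^bsub>twisted_poly_ring CARD('q)\<^esub> g = tw f g"
  "f \<oplus>\<^bsub>twisted_poly_ring CARD('q)\<^esub> g = f + g" "\<one>\<^bsub>twisted_poly_ring CARD('q)\<^esub> = (1 :: 'k poly)"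
  "\<zero>\<^bsub>twisted_poly_ring CARD('q)\<^esub> = (0 :: 'k poly)"
  by (simp_all add: twisted_poly_ring_def)

lemma ring_twisted: "ring (twisted_poly_ring CARD('q) :: 'k poly ring)"
proof (rule ringI)
  show "abelian_group (twisted_poly_ring CARD('q) :: 'k poly ring)"
  proof (rule abelian_groupI)
    fix x :: "'k poly"
    show "\<exists>y\<in>carrier (twisted_poly_ring CARD('q)). y \<oplus>\<^bsub>twisted_poly_ring CARD('q)\<^esub> x = \<zero>\<^bsub>twisted_poly_ring CARD('q)\<^esub>"
      by (rule bexI[of _ "- x"]) simp_all
  qed (simp_all add: algebra_simps)
  show "Group.monoid (twisted_poly_ring CARD('q) :: 'k poly ring)"
    by (rule monoidI) (simp_all add: tw_assoc)
qed (simp_all add: tw_add_left tw_add_right)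

sublocale kt: tensor_product "ring_of_type_algebra :: 'q poly ring" "Fq_pi_incl \<gamma> n" to_fract
    "twisted_poly_ring CARD('q)" "ring_of_type_algebra :: 'q poly fract ring"
proof (rule tensor_product.intro)
  show "ring (twisted_poly_ring CARD('q) :: 'k poly ring)" by (rule ring_twisted)
  show "ring (ring_of_type_algebra :: 'q poly fract ring)" by (rule ring_from_type_algebra)
  fix a :: "'q poly" and m :: "'k poly"
  show "Fq_pi_incl \<gamma> n a \<otimes>\<^bsub>twisted_poly_ring CARD('q)\<^esub> m = m \<otimes>\<^bsub>twisted_poly_ring CARD('q)\<^esub> Fq_pi_incl \<gamma> n a"
    using tw_iota_left[of a m] tw_iota_right[of m a] by (simp add: iota_def)
qed (simp_all add: mult.commute)

section \<open>k(tau) and its additive embedding in k((tau))\<close>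

abbreviation KT where "KT \<equiv> ktau \<gamma> n"
abbreviation kten where "kten \<equiv> ktau_tensor \<gamma> n"

lemma ring_KT: "ring KT" using kt.ring_Q by (simp add: ktau_def)

sublocale KT: ring KT by (rule ring_KT)

lemma kten_closed [simp]: "kten f x \<in> carrier KT"
  using kt.pure_closed[of f x] by (simp add: ktau_def ktau_tensor_def)

lemma kten_add_left: "kten (f + g) x = kten f x \<oplus>\<^bsub>KT\<^esub> kten g x"
  using kt.pure_addM[of f g x] by (simp add: ktau_def ktau_tensor_def)

lemma kten_add_right: "kten f (x + y) = kten f x \<oplus>\<^bsub>KT\<^esub> kten f y"
  using kt.pure_addN[of f x y] by (simp add: ktau_def ktau_tensor_def)

lemma kten_scal: "kten (iota a * f) x = kten f (to_fract a * x)"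
  using kt.pure_scal[of a f x] by (simp add: ktau_def ktau_tensor_def tw_iota_left flip: iota_def)

lemma kten_mult: "kten f x \<otimes>\<^bsub>KT\<^esub> kten g y = kten (tw f g) (x * y)"
  using kt.pure_mult[of f g x y] by (simp add: ktau_def ktau_tensor_def)

lemma kten_1: "kten 1 1 = \<one>\<^bsub>KT\<^esub>"
  using kt.pure_one by (simp add: ktau_def ktau_tensor_def)

lemma kten_0: "kten 0 x = \<zero>\<^bsub>KT\<^esub>"
  using kt.pure_zeroM[of x] by (simp add: ktau_def ktau_tensor_def)

lemma KT_induct [consumes 1, case_names kten add]:
  assumes "y \<in> carrier KT" "\<And>f x. Q (kten f x)"
    "\<And>y z. y \<in> carrier KT \<Longrightarrow> z \<in> carrier KT \<Longrightarrow> Q y \<Longrightarrow> Q z \<Longrightarrow> Q (y \<oplus>\<^bsub>KT\<^esub> z)"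
  shows "Q y"
  using kt.Q_induct[of y Q] assms by (simp add: ktau_def ktau_tensor_def)

text \<open>Denominators come from F_q[pi], which is central, so a common denominator collapses a
  sum of tensors into one fraction.\<close>

lemma KT_cases:
  assumes "y \<in> carrier KT"
  shows "\<exists>f c. c \<noteq> 0 \<and> y = kten f (inverse (to_fract c))"
  using assms
proof (induction y rule: KT_induct)
  case (kten f x)
  obtain a b where "x = Fract a b" "b \<noteq> 0" by (rule fract_cases_nz)
  then have "x = to_fract a * inverse (to_fract b)" by (simp add: to_fract_def)
  then show ?case using kten_scal[of a f "inverse (to_fract b)"] \<open>b \<noteq> 0\<close> by metis
next
  case (add y z)
  then obtain f c g b where *: "c \<noteq> 0" "y = kten f (inverse (to_fract c))" "b \<noteq> 0" "z = kten g (inverse (to_fract b))"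
    by blast
  have "y = kten (iota b * f) (inverse (to_fract (b * c)))" "z = kten (iota c * g) (inverse (to_fract (b * c)))"
    using * by (simp_all add: kten_scal flip: mult.assoc, simp add: mult.commute[of "to_fract c"] mult.assoc)
  then have "y \<oplus>\<^bsub>KT\<^esub> z = kten (iota b * f + iota c * g) (inverse (to_fract (b * c)))"
    by (simp add: kten_add_left)
  then show ?case using * by (metis mult_eq_0_iff)
qed

text \<open>The embedding of k(tau) in k((tau)) as an additive map; it decides equality in the
  quotient that defines k(tau).\<close>

definition h1 :: "('q, 'k) ktau \<Rightarrow> 'k fls" where
  "h1 = (SOME h. (\<forall>y\<in>carrier KT. \<forall>z\<in>carrier KT. h (y \<oplus>\<^bsub>KT\<^esub> z) = h y + h z) \<and>
                 (\<forall>f x. h (kten f x) = PL f * iotaL (fract_to_fls x)))"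

lemma h1_add: "y \<in> carrier KT \<Longrightarrow> z \<in> carrier KT \<Longrightarrow> h1 (y \<oplus>\<^bsub>KT\<^esub> z) = h1 y + h1 z"
  and h1_kten: "h1 (kten f x) = PL f * iotaL (fract_to_fls x)"
proof -
  let ?b = "\<lambda>f x. PL f * iotaL (fract_to_fls x)"
  have "\<exists>h. (\<forall>y\<in>carrier kt.Q. \<forall>z\<in>carrier kt.Q. h (y \<oplus>\<^bsub>kt.Q\<^esub> z) = h y + h z) \<and>
      (\<forall>f\<in>carrier (twisted_poly_ring CARD('q)). \<forall>x\<in>carrier ring_of_type_algebra. h (kt.pure f x) = ?b f x)"
  proof (rule kt.ex_lift)
    fix a :: "'q poly" and f :: "'k poly" and x :: "'q poly fract"
    show "?b (Fq_pi_incl \<gamma> n a \<otimes>\<^bsub>twisted_poly_ring CARD('q)\<^esub> f) x = ?b f (to_fract a \<otimes>\<^bsub>ring_of_type_algebra\<^esub> x)"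
      using tw_iota_left[of a f]
      by (simp add: fract_to_fls_mult fract_to_fls_to_fract iotaL_mult iotaL_PL PL_mult flip: iota_def)
  qed (simp_all add: PL_add iotaL_add fract_to_fls_add algebra_simps)
  then have "\<exists>h. (\<forall>y\<in>carrier KT. \<forall>z\<in>carrier KT. h (y \<oplus>\<^bsub>KT\<^esub> z) = h y + h z) \<and> (\<forall>f x. h (kten f x) = ?b f x)"
    by (simp add: ktau_def ktau_tensor_def)
  from someI_ex[OF this] show "y \<in> carrier KT \<Longrightarrow> z \<in> carrier KT \<Longrightarrow> h1 (y \<oplus>\<^bsub>KT\<^esub> z) = h1 y + h1 z"
    and "h1 (kten f x) = ?b f x"
    unfolding h1_def by blast+
qed

text \<open>By \<open>KT_cases\<close> only a single fraction f / c has to be considered, and its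
  image is f times a nonzero element of F_q((pi)).\<close>

lemma h1_eq_0_iff:
  assumes "y \<in> carrier KT"
  shows "h1 y = 0 \<longleftrightarrow> y = \<zero>\<^bsub>KT\<^esub>"
proof -
  obtain f c where y: "c \<noteq> 0" "y = kten f (inverse (to_fract c))" using KT_cases[OF assms] by blast
  then have "iotaL (fract_to_fls (inverse (to_fract c))) \<noteq> 0" by (simp add: fract_to_fls_eq_0_iff)
  then have "h1 y = 0 \<longleftrightarrow> f = 0" by (simp add: y h1_kten PL_eq_0_iff)
  moreover have "f = 0 \<Longrightarrow> y = \<zero>\<^bsub>KT\<^esub>" by (simp add: y kten_0)
  moreover have "h1 \<zero>\<^bsub>KT\<^esub> = 0" using h1_kten[of 0 1] by (simp add: kten_0)
  ultimately show ?thesis by blast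
qed

lemma h1_zero [simp]: "h1 \<zero>\<^bsub>KT\<^esub> = 0" using h1_eq_0_iff[of "\<zero>\<^bsub>KT\<^esub>"] by simp

lemma h1_inj:
  assumes "y \<in> carrier KT" "z \<in> carrier KT" "h1 y = h1 z"
  shows "y = z"
proof -
  have "h1 y = h1 (y \<ominus>\<^bsub>KT\<^esub> z) + h1 z" using assms h1_add[of "y \<ominus>\<^bsub>KT\<^esub> z" z] by (simp add: KT.minus_eq KT.a_assoc KT.l_neg)
  then have "y \<ominus>\<^bsub>KT\<^esub> z = \<zero>\<^bsub>KT\<^esub>" using assms h1_eq_0_iff[of "y \<ominus>\<^bsub>KT\<^esub> z"] by simp
  then show ?thesis using assms by (simp add: KT.r_right_minus_eq)
qed

section \<open>F(pi), A[pi] and the degree of F(pi) over K\<close>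

definition TK :: "('q, 'k) ktau" where "TK = kten (\<phi> [:0, 1:]) 1"

sublocale eK: horner_map KT "K_incl \<gamma> n" TK
proof
  show "K_incl \<gamma> n a \<in> carrier KT" for a by (simp add: K_incl_def)
  show "TK \<in> carrier KT" by (simp add: TK_def)
  show "K_incl \<gamma> n (a + b) = K_incl \<gamma> n a \<oplus>\<^bsub>KT\<^esub> K_incl \<gamma> n b" for a b by (simp add: K_incl_def kten_add_right)
qed (simp_all add: K_incl_def TK_def kten_mult kten_1)

abbreviation evK where "evK \<equiv> horner KT (K_incl \<gamma> n) TK"

lemma evK_monom: "evK (monom c j) = kten (T j) c"
proof (induction j)
  case 0
  show ?case by (simp only: monom_0 T_0 eK.hor_const) (simp only: K_incl_def)
next
  case (Suc j)
  show ?case unfolding monom_Suc eK.hor_pCons Suc.IH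
    by (simp add: eK.C_zero TK_def kten_mult T_Suc)
qed

abbreviation liftF :: "'q poly fract poly \<Rightarrow> 'q fls poly" where "liftF \<equiv> map_poly fract_to_fls"

lemma liftF_add: "liftF (g + h) = liftF g + liftF h" and liftF_mult: "liftF (g * h) = liftF g * liftF h"
  by (simp_all add: map_poly_hom_add map_poly_hom_mult fract_to_fls_add fract_to_fls_mult)

lemma liftF_diff: "liftF (g - h) = liftF g - liftF h"
  using liftF_add[of "g - h" h] by simp

lemma liftF_liftP: "liftF (map_poly to_fract g) = liftP g"
  by (rule poly_eqI) (simp add: coeff_map_poly fract_to_fls_to_fract)

lemma degree_liftF [simp]: "degree (liftF g) = degree g"
  by (rule degree_map_poly) (simp add: fract_to_fls_eq_0_iff)

lemma liftF_eq_0_iff: "liftF g = 0 \<longleftrightarrow> g = 0"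
  by (simp add: poly_eq_iff coeff_map_poly fract_to_fls_eq_0_iff)

text \<open>Transfers questions about K[T] in k(tau) to \<open>Phi\<close>, where independence below
  degree N and the absence of zero divisors are known.\<close>

lemma h1_evK: "h1 (evK g) = Phi (liftF g)"
proof (induction g rule: poly_monom_induct)
  case (add p q)
  then show ?case by (simp add: eK.hor_add h1_add eK.hor_closed liftF_add Phi_add)
next
  case (monom c j)
  show ?case by (simp add: evK_monom h1_kten map_poly_monom Phi_monom mult.commute)
qed

lemma evK_to_fract: "evK (map_poly to_fract g) = kten (ev g) 1"
  by (rule h1_inj) (simp_all add: eK.hor_closed h1_evK liftF_liftP Phi_liftP h1_kten)

lemma evK_eq_0_iff: "evK g = \<zero>\<^bsub>KT\<^esub> \<longleftrightarrow> Phi (liftF g) = 0"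
  using h1_eq_0_iff[OF eK.hor_closed, of g] by (simp add: h1_evK)

text \<open>The kernel of \<open>Phi\<close> restricted to K[x] is a prime ideal without nonzero
  elements of degree less than N, so K[T] is a field.\<close>

lemma ex_evK_inverse:
  assumes "evK g \<noteq> \<zero>\<^bsub>KT\<^esub>"
  shows "\<exists>u. evK (u * g) = \<one>\<^bsub>KT\<^esub>"
proof -
  let ?p = "map_poly to_fract P"
  have dp: "degree ?p = N" using degree_map_poly[of to_fract P] by (simp add: degree_P)
  have "\<exists>u. Phi (liftF (u * g - 1)) = 0"
  proof (rule ex_inverse_mod_ideal[where p = ?p and Z = "\<lambda>g. Phi (liftF g) = 0"])
    show "Phi (liftF ?p) = 0" by (simp add: liftF_liftP Phi_P)
    show "?p \<noteq> 0" using dp N_pos by auto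
    show "Phi (liftF (b * a)) = 0" if "Phi (liftF a) = 0" for a b
      using Phi_mult_eq_0[OF that, of "liftF b"] by (simp add: liftF_mult mult.commute)
    show "Phi (liftF a) = 0 \<or> Phi (liftF b) = 0" if "Phi (liftF (a * b)) = 0" for a b
      using Phi_no_zero_divisors that by (simp add: liftF_mult)
    show "a = 0" if "Phi (liftF a) = 0" "degree a < degree ?p" for a
      using Phi_inj[of "liftF a"] that dp by (simp add: liftF_eq_0_iff)
  qed (use assms in \<open>auto simp: evK_eq_0_iff liftF_add Phi_add\<close>)
  then obtain u where "evK (u * g - 1) = \<zero>\<^bsub>KT\<^esub>" by (auto simp: evK_eq_0_iff)
  then have "evK (u * g - 1 + 1) = \<one>\<^bsub>KT\<^esub>" by (simp only: eK.hor_add eK.hor_1) simp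
  then show ?thesis by auto
qed

lemma inv_evK: "evK g \<noteq> \<zero>\<^bsub>KT\<^esub> \<Longrightarrow> inv\<^bsub>KT\<^esub> (evK g) \<in> range evK"
  using ex_evK_inverse eK.hor_inverse by (metis rangeI)

lemma kten_phi: "kten (\<phi> a) 1 = evK (map_poly to_fract (map_poly (\<lambda>c. [:c:]) a))"
  by (simp only: evK_to_fract ev_lift)

lemma kten_iota: "kten (iota a) 1 = K_incl \<gamma> n (to_fract a)"
  using kten_scal[of a 1 1] by (simp add: K_incl_def)

lemma frob_conv: "frob \<gamma> n = kten (iota [:0, 1:]) 1"
  using iota_X[of 1] by (simp add: frob_def monom_altdef)

lemma phi_nonzero: "b \<noteq> 0 \<Longrightarrow> kten (\<phi> b) 1 \<noteq> \<zero>\<^bsub>KT\<^esub>"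
  using h1_kten[of "\<phi> b" 1] drin by (auto simp: drinfeld_module_def PL_eq_0_iff)

lemma KT_one_nonzero: "\<one>\<^bsub>KT\<^esub> \<noteq> \<zero>\<^bsub>KT\<^esub>"
  using phi_nonzero[of 1] by (simp add: \<phi>_1 kten_1)

lemma phi_A_subset_phi_F: "kten (\<phi> a) 1 \<in> phi_F \<gamma> n \<phi>"
proof -
  have "kten (\<phi> a) 1 = kten (\<phi> a) 1 \<otimes>\<^bsub>KT\<^esub> inv\<^bsub>KT\<^esub> (kten (\<phi> 1) 1)"
    by (simp add: \<phi>_1 kten_1)
  then show ?thesis unfolding phi_F_def mem_Collect_eq by (intro exI[of _ a] exI[of _ 1]) simp
qed

text \<open>Both sides are K(T): since T is algebraic over K, polynomial expressions in T are closed
  under inversion by \<open>inv_evK\<close>.\<close>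

lemma F_tilde_eq: "F_tilde \<gamma> n \<phi> = range evK"
proof
  show "F_tilde \<gamma> n \<phi> \<subseteq> range evK"
  proof
    fix y assume "y \<in> F_tilde \<gamma> n \<phi>"
    then show "y \<in> range evK" unfolding F_tilde_def
    proof (induction rule: generate_field.induct)
      case one
      then show ?case by (metis eK.hor_1 rangeI)
    next
      case (incl y)
      then consider "y = frob \<gamma> n" | "y \<in> phi_F \<gamma> n \<phi>" by blast
      then show ?case
      proof cases
        case 1
        then show ?thesis by (metis frob_conv kten_iota eK.hor_const rangeI)
      next
        case 2
        then obtain a b where ab: "y = kten (\<phi> a) 1 \<otimes>\<^bsub>KT\<^esub> inv\<^bsub>KT\<^esub> (kten (\<phi> b) 1)" "b \<noteq> 0"
          unfolding phi_F_def by blast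
        have "inv\<^bsub>KT\<^esub> (kten (\<phi> b) 1) \<in> range evK"
          using inv_evK phi_nonzero[OF ab(2)] unfolding kten_phi by blast
        then obtain u where "inv\<^bsub>KT\<^esub> (kten (\<phi> b) 1) = evK u" by blast
        then show ?thesis unfolding ab(1) kten_phi[of a] by (simp flip: eK.hor_mult)
      qed
    next
      case (a_inv h)
      then show ?case by (auto simp flip: eK.hor_minus)
    next
      case (m_inv h)
      then show ?case using inv_evK by blast
    next
      case (eng_add h1 h2)
      then show ?case by (auto simp flip: eK.hor_add)
    next
      case (eng_mult h1 h2)
      then show ?case by (auto simp flip: eK.hor_mult)
    qed
  qed
  let ?G = "F_tilde \<gamma> n \<phi>"
  have one: "\<one>\<^bsub>KT\<^esub> \<in> ?G" unfolding F_tilde_def by (rule generate_field.one)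
  have phiA: "kten (\<phi> a) 1 \<in> ?G" for a
    unfolding F_tilde_def by (rule generate_field.incl) (simp add: phi_A_subset_phi_F)
  have fr: "kten (iota [:0, 1:]) 1 \<in> ?G" unfolding F_tilde_def by (rule generate_field.incl) (simp add: frob_conv)
  have add: "y \<oplus>\<^bsub>KT\<^esub> z \<in> ?G" and mult: "y \<otimes>\<^bsub>KT\<^esub> z \<in> ?G" if "y \<in> ?G" "z \<in> ?G" for y z
    using that unfolding F_tilde_def by (rule generate_field.eng_add generate_field.eng_mult)+
  \<comment> \<open>The constants come from phi(F_q) by \<open>\<phi>_const\<close> and pi from
    \<open>frob\<close>; together they generate F_q[pi].\<close>
  have io: "kten (iota a) 1 \<in> ?G" for a
  proof (induction a)
    case 0
    then show ?case using phiA[of 0] by simp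
  next
    case (pCons c a)
    have "pCons c a = [:c:] + [:0, 1:] * a" by simp
    then have "kten (iota (pCons c a)) 1 = kten (\<phi> [:c:]) 1 \<oplus>\<^bsub>KT\<^esub> kten (iota [:0, 1:]) 1 \<otimes>\<^bsub>KT\<^esub> kten (iota a) 1"
      by (simp only: iota_add iota_mult kten_add_left kten_mult tw_iota_left \<phi>_const mult_1)
    then show ?case using add mult phiA fr pCons by simp
  qed
  have K: "K_incl \<gamma> n x \<in> ?G" for x
  proof -
    obtain a b where ab: "x = Fract a b" "b \<noteq> 0" by (rule fract_cases_nz)
    have "kten (iota b) 1 \<noteq> \<zero>\<^bsub>KT\<^esub>" using ab(2) h1_kten[of "iota b" 1] by (auto simp: PL_eq_0_iff)
    then have inv: "inv\<^bsub>KT\<^esub> (kten (iota b) 1) \<in> ?G"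
      using io[of b] unfolding F_tilde_def by (rule generate_field.m_inv[rotated])
    have "inv\<^bsub>KT\<^esub> (kten (iota b) 1) = K_incl \<gamma> n (inverse (to_fract b))"
      unfolding kten_iota using ab(2)
      by (intro KT.inv_char) (simp_all add: eK.C_one eK.C_closed flip: eK.C_mult)
    moreover have "x = to_fract a * inverse (to_fract b)" by (simp add: ab to_fract_def)
    ultimately have "K_incl \<gamma> n x = kten (iota a) 1 \<otimes>\<^bsub>KT\<^esub> inv\<^bsub>KT\<^esub> (kten (iota b) 1)"
      by (simp only: eK.C_mult kten_iota)
    then show ?thesis using mult io inv by simp
  qed
  have "evK g \<in> ?G" for g
  proof (induction g)
    case 0
    then show ?case using K[of 0] by (simp add: eK.hor_0 eK.C_zero)
  next
    case (pCons a g)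
    then show ?case using add mult K phiA[of "[:0, 1:]"] by (simp add: eK.hor_pCons flip: TK_def)
  qed
  then show "range evK \<subseteq> ?G" by blast
qed

lemma A_pi_eq: "A_pi \<gamma> n \<phi> = range (\<lambda>g. evK (map_poly to_fract g))"
proof -
  define E where "E g = evK (map_poly to_fract g)" for g
  have E_add: "E (g + h) = E g \<oplus>\<^bsub>KT\<^esub> E h" and E_mult: "E (g * h) = E g \<otimes>\<^bsub>KT\<^esub> E h" for g h
    by (simp_all add: E_def map_poly_hom_add map_poly_hom_mult eK.hor_add eK.hor_mult)
  have E_closed: "E g \<in> carrier KT" for g by (simp add: E_def eK.hor_closed)
  have E_0: "E 0 = \<zero>\<^bsub>KT\<^esub>" by (simp add: E_def eK.hor_0)
  have E_minus: "E (- g) = \<ominus>\<^bsub>KT\<^esub> E g" for g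
    using E_add[of "- g" g] KT.minus_equality[of "E (- g)" "E g"] by (simp add: E_0 E_closed)
  have E_phi: "kten (\<phi> a) 1 = E (cst a)" for a by (simp add: E_def kten_phi)
  have E_iota: "kten (iota a) 1 = E [:a:]" for a by (simp only: E_def evK_to_fract ev_const)
  have "A_pi \<gamma> n \<phi> \<subseteq> range E"
  proof
    fix y assume "y \<in> A_pi \<gamma> n \<phi>"
    then show "y \<in> range E" unfolding A_pi_def
    proof (induction rule: generate_ring.induct)
      case one
      have "E 1 = \<one>\<^bsub>KT\<^esub>" by (simp add: E_def eK.hor_1)
      then show ?case by (metis rangeI)
    next
      case (incl y)
      then show ?case unfolding phi_A_def frob_conv E_phi E_iota by auto
    qed (auto simp flip: E_minus E_add E_mult)
  qed
  moreover have "E g \<in> A_pi \<gamma> n \<phi>" for g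
  proof -
    let ?G = "A_pi \<gamma> n \<phi>"
    have phiA: "kten (\<phi> a) 1 \<in> ?G" for a
      unfolding A_pi_def by (rule generate_ring.incl) (simp add: phi_A_def)
    have fr: "kten (iota [:0, 1:]) 1 \<in> ?G" unfolding A_pi_def by (rule generate_ring.incl) (simp add: frob_conv)
    have add: "y \<oplus>\<^bsub>KT\<^esub> z \<in> ?G" and mult: "y \<otimes>\<^bsub>KT\<^esub> z \<in> ?G" if "y \<in> ?G" "z \<in> ?G" for y z
      using that unfolding A_pi_def by (rule generate_ring.eng_add generate_ring.eng_mult)+
    have io: "kten (iota a) 1 \<in> ?G" for a
    proof (induction a)
      case 0
      then show ?case using phiA[of 0] by simp
    next
      case (pCons c a)
      have "pCons c a = [:c:] + [:0, 1:] * a" by simp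
      then have "kten (iota (pCons c a)) 1 = kten (\<phi> [:c:]) 1 \<oplus>\<^bsub>KT\<^esub> kten (iota [:0, 1:]) 1 \<otimes>\<^bsub>KT\<^esub> kten (iota a) 1"
        by (simp only: iota_add iota_mult kten_add_left kten_mult tw_iota_left \<phi>_const mult_1)
      then show ?case using add mult phiA fr pCons by simp
    qed
    show ?thesis
    proof (induction g)
      case 0
      then show ?case using phiA[of 0] by (simp add: E_0 kten_0)
    next
      case (pCons a g)
      have "E (pCons a g) = kten (iota a) 1 \<oplus>\<^bsub>KT\<^esub> kten (\<phi> [:0, 1:]) 1 \<otimes>\<^bsub>KT\<^esub> E g"
        by (simp add: E_def map_poly_pCons eK.hor_pCons kten_iota flip: TK_def)
      then show ?case using add mult io phiA pCons by simp
    qed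
  qed
  ultimately show ?thesis unfolding E_def by blast
qed

lemma subfield_K: "subfield (K_field \<gamma> n) KT"
proof -
  let ?F = "ring_of_type_algebra :: 'q poly fract ring"
  have F: "field ?F" by (rule field_from_type_algebra)
  have "ring_hom_ring ?F KT (K_incl \<gamma> n)"
    by (rule ring_hom_ringI2)
      (use ring_KT in \<open>auto intro!: ring_hom_memI simp: eK.C_closed eK.C_add eK.C_mult eK.C_one ring_from_type_algebra\<close>)
  then have "subfield (K_incl \<gamma> n ` carrier ?F) KT"
    by (rule ring_hom_ring.img_is_subfield(2)[OF _ field.carrier_is_subfield[OF F] KT_one_nonzero])
  then show ?thesis by (simp add: K_field_def)
qed

text \<open>The powers of T below N form a basis: they are independent by \<open>Phi_inj\<close> and
  span by division by P over K.\<close>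

lemma dim_F_tilde: "F_tilde_degree \<gamma> n \<phi> = N"
proof -
  \<comment> \<open>The list is reversed so that \<open>Us (Suc m)\<close> adds the new power at the
    head, matching the recursions of \<open>Span\<close> and \<open>independent\<close>.\<close>
  define Us where "Us m = map (\<lambda>j. evK (monom 1 j)) (rev [0..<m])" for m
  have span: "KT.Span (K_field \<gamma> n) (Us m) = evK ` {g. \<forall>i\<ge>m. coeff g i = 0}" for m
  proof (induction m)
    case 0
    have "{g :: 'q poly fract poly. \<forall>i\<ge>0. coeff g i = 0} = {0}" by (auto simp: poly_eq_iff)
    then show ?case by (simp add: Us_def eK.hor_0)
  next
    case (Suc m)
    have "KT.Span (K_field \<gamma> n) (Us (Suc m)) = KT.line_extension (K_field \<gamma> n) (evK (monom 1 m)) (KT.Span (K_field \<gamma> n) (Us m))"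
      by (simp add: Us_def)
    also have "\<dots> = evK ` {g. \<forall>i\<ge>Suc m. coeff g i = 0}" (is "?L = ?R")
    proof (rule Set.set_eqI)
      fix y
      have "y \<in> ?L \<longleftrightarrow> (\<exists>c g. (\<forall>i\<ge>m. coeff g i = 0) \<and> y = evK (smult c (monom 1 m) + g))"
        unfolding KT.line_extension_mem_iff Suc.IH unfolding K_field_def by (auto simp: eK.hor_add eK.hor_smult)
      also have "\<dots> \<longleftrightarrow> (\<exists>g. (\<forall>i\<ge>Suc m. coeff g i = 0) \<and> y = evK g)"
      proof safe
        fix c and g :: "'q poly fract poly" assume "\<forall>i\<ge>m. coeff g i = 0"
        then show "\<exists>g'. (\<forall>i\<ge>Suc m. coeff g' i = 0) \<and> evK (smult c (monom 1 m) + g) = evK g'"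
          by (intro exI[of _ "smult c (monom 1 m) + g"]) (auto simp: smult_monom)
      next
        fix g :: "'q poly fract poly" assume g: "\<forall>i\<ge>Suc m. coeff g i = 0"
        show "\<exists>c g'. (\<forall>i\<ge>m. coeff g' i = 0) \<and> evK g = evK (smult c (monom 1 m) + g')"
        proof (intro exI[of _ "coeff g m"] exI[of _ "g - smult (coeff g m) (monom 1 m)"] conjI allI impI)
          fix i assume "m \<le> i"
          then show "coeff (g - smult (coeff g m) (monom 1 m)) i = 0" using g by (cases "i = m") (auto simp: smult_monom)
        qed simp
      qed
      finally show "y \<in> ?L \<longleftrightarrow> y \<in> ?R" by auto
    qed
    finally show ?case .
  qed
  have indep: "KT.independent (K_field \<gamma> n) (Us m)" if "m \<le> N" for m
    using that
  proof (induction m)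
    case (Suc m)
    have "evK (monom 1 m) \<notin> KT.Span (K_field \<gamma> n) (Us m)"
    proof
      assume "evK (monom 1 m) \<in> KT.Span (K_field \<gamma> n) (Us m)"
      then obtain g where g: "\<forall>i\<ge>m. coeff g i = 0" "evK (monom 1 m) = evK g" unfolding span by blast
      then have "Phi (liftF (monom 1 m - g)) = 0" using h1_evK[of "monom 1 m"] h1_evK[of g] by (simp add: liftF_diff Phi_diff)
      moreover have "degree (monom 1 m - g) \<le> m" by (rule degree_le) (use g in auto)
      ultimately have "monom 1 m - g = 0"
        using Phi_inj[of "liftF (monom 1 m - g)"] Suc.prems by (simp add: liftF_eq_0_iff)
      then have "coeff (monom 1 m - g) m = 0" by simp
      then show False using g by simp
    qed
    moreover have "KT.independent (K_field \<gamma> n) (Us m)" using Suc by simp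
    ultimately have "KT.independent (K_field \<gamma> n) (evK (monom 1 m) # Us m)"
      using eK.hor_closed by (intro KT.li_Cons)
    then show ?case by (simp add: Us_def)
  qed (simp add: Us_def)
  have "KT.Span (K_field \<gamma> n) (Us N) = F_tilde \<gamma> n \<phi>"
  proof -
    have "evK g \<in> evK ` {g. \<forall>i\<ge>N. coeff g i = 0}" for g
    proof -
      let ?p = "map_poly to_fract P"
      have dp: "degree ?p = N" using degree_map_poly[of to_fract P] by (simp add: degree_P)
      then have pnz: "?p \<noteq> 0" using N_pos by auto
      have "evK ?p = \<zero>\<^bsub>KT\<^esub>" by (simp add: evK_to_fract ev_P kten_0)
      moreover have "evK g = evK (g div ?p * ?p + g mod ?p)" by (simp only: div_mult_mod_eq)
      ultimately have "evK g = evK (g mod ?p)" by (simp add: eK.hor_add eK.hor_mult eK.hor_closed)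
      moreover have "degree (g mod ?p) < N" using degree_mod_less[OF pnz, of g] dp N_pos by auto
      then have "\<forall>i\<ge>N. coeff (g mod ?p) i = 0" by (auto simp: coeff_eq_0)
      ultimately show ?thesis by blast
    qed
    then show ?thesis unfolding span F_tilde_eq by blast
  qed
  then have "KT.dimension (length (Us N)) (K_field \<gamma> n) (F_tilde \<gamma> n \<phi>)"
    using KT.dimensionI[OF subfield_K indep[OF order_refl]] by blast
  then have "KT.dim (K_field \<gamma> n) (F_tilde \<gamma> n \<phi>) = length (Us N)"
    using KT.dimI[OF subfield_K] by (simp add: over_def)
  then show ?thesis by (simp add: F_tilde_degree_def Us_def)
qed

end

section \<open>The completion\<close>

context drinfeld
begin

abbreviation FT where "FT \<equiv> F_tilde_ring \<gamma> n \<phi>"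

lemma FT_simps [simp]:
  "carrier FT = range evK" "y \<otimes>\<^bsub>FT\<^esub> z = y \<otimes>\<^bsub>KT\<^esub> z" "y \<oplus>\<^bsub>FT\<^esub> z = y \<oplus>\<^bsub>KT\<^esub> z"
  "\<one>\<^bsub>FT\<^esub> = \<one>\<^bsub>KT\<^esub>" "\<zero>\<^bsub>FT\<^esub> = \<zero>\<^bsub>KT\<^esub>"
  by (simp_all add: F_tilde_ring_def F_tilde_eq)

lemma ring_FT: "ring FT"
proof -
  have "subring (range evK) KT"
  proof (rule KT.subringI)
    show "range evK \<subseteq> carrier KT" using eK.hor_closed by blast
    show "\<one>\<^bsub>KT\<^esub> \<in> range evK" by (metis eK.hor_1 rangeI)
  qed (auto simp flip: eK.hor_minus eK.hor_add eK.hor_mult)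
  then show ?thesis unfolding F_tilde_ring_def F_tilde_eq by (rule KT.subring_is_ring)
qed

lemma K_incl_evK: "K_incl \<gamma> n a = evK [:a:]" by (simp only: eK.hor_const)

sublocale ct: tensor_product "ring_of_type_algebra :: 'q poly fract ring" "K_incl \<gamma> n" fract_to_fls
    FT "ring_of_type_algebra :: 'q fls ring"
proof (rule tensor_product.intro)
  show "ring FT" by (rule ring_FT)
  show "ring (ring_of_type_algebra :: 'q fls ring)" by (rule ring_from_type_algebra)
  fix a :: "'q poly fract" and y assume "y \<in> carrier FT"
  then obtain g where "y = evK g" by auto
  then show "K_incl \<gamma> n a \<otimes>\<^bsub>FT\<^esub> y = y \<otimes>\<^bsub>FT\<^esub> K_incl \<gamma> n a"
    by (simp add: K_incl_evK mult.commute flip: eK.hor_mult)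
qed (auto simp: K_incl_evK mult.commute)

abbreviation L where "L \<equiv> completion \<gamma> n \<phi>"
abbreviation cten where "cten \<equiv> completion_tensor \<gamma> n \<phi>"

lemma ring_L: "ring L" using ct.ring_Q by (simp add: completion_def)

sublocale L: ring L by (rule ring_L)

lemma cten_closed [simp]: "cten (evK g) f \<in> carrier L"
  using ct.pure_closed[of "evK g" f] by (simp add: completion_def completion_tensor_def)

lemma cten_add_left: "cten (evK (g + h)) f = cten (evK g) f \<oplus>\<^bsub>L\<^esub> cten (evK h) f"
  using ct.pure_addM[of "evK g" "evK h" f] by (simp add: completion_def completion_tensor_def eK.hor_add)

lemma cten_add_right: "cten (evK g) (e + f) = cten (evK g) e \<oplus>\<^bsub>L\<^esub> cten (evK g) f"
  using ct.pure_addN[of "evK g" e f] by (simp add: completion_def completion_tensor_def)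

lemma cten_scal: "cten (evK (smult a g)) f = cten (evK g) (fract_to_fls a * f)"
  using ct.pure_scal[of a "evK g" f] by (simp add: completion_def completion_tensor_def eK.hor_smult)

lemma cten_mult: "cten (evK g) e \<otimes>\<^bsub>L\<^esub> cten (evK h) f = cten (evK (g * h)) (e * f)"
  using ct.pure_mult[of "evK g" "evK h" e f] by (simp add: completion_def completion_tensor_def eK.hor_mult)

lemma cten_1: "cten (evK 1) 1 = \<one>\<^bsub>L\<^esub>"
  using ct.pure_one by (simp add: completion_def completion_tensor_def eK.hor_1)

lemma cten_0: "cten \<zero>\<^bsub>KT\<^esub> f = \<zero>\<^bsub>L\<^esub>"
  using ct.pure_zeroM[of f] by (simp add: completion_def completion_tensor_def)

lemma one_KT: "\<one>\<^bsub>KT\<^esub> = evK 1" by (simp add: eK.hor_1)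

sublocale eL: horner_map L "cten \<one>\<^bsub>KT\<^esub>" "cten TK 1"
proof
  fix a b :: "'q fls"
  show "cten \<one>\<^bsub>KT\<^esub> a \<in> carrier L" by (simp only: one_KT cten_closed)
  show "cten TK 1 \<in> carrier L" using cten_closed[of "[:0, 1:]" 1] by (simp only: eK.hor_x)
  show "cten \<one>\<^bsub>KT\<^esub> (a + b) = cten \<one>\<^bsub>KT\<^esub> a \<oplus>\<^bsub>L\<^esub> cten \<one>\<^bsub>KT\<^esub> b" by (simp only: one_KT cten_add_right)
  show "cten \<one>\<^bsub>KT\<^esub> (a * b) = cten \<one>\<^bsub>KT\<^esub> a \<otimes>\<^bsub>L\<^esub> cten \<one>\<^bsub>KT\<^esub> b" by (simp only: one_KT cten_mult mult_1_left)
  show "cten \<one>\<^bsub>KT\<^esub> 1 = \<one>\<^bsub>L\<^esub>" by (simp only: one_KT cten_1)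
  show "cten \<one>\<^bsub>KT\<^esub> a \<otimes>\<^bsub>L\<^esub> cten TK 1 = cten TK 1 \<otimes>\<^bsub>L\<^esub> cten \<one>\<^bsub>KT\<^esub> a"
    using cten_mult[of 1 a "[:0, 1:]" 1] cten_mult[of "[:0, 1:]" 1 1 a] by (simp add: eK.hor_x eK.hor_1)
qed

abbreviation evL where "evL \<equiv> horner L (cten \<one>\<^bsub>KT\<^esub>) (cten TK 1)"

lemma evL_monom: "evL (monom c j) = cten (evK (monom 1 j)) c"
proof (induction j)
  case 0
  show ?case by (simp only: monom_0 eL.hor_const) (simp only: one_KT one_pCons)
next
  case (Suc j)
  have "evL (monom c (Suc j)) = cten TK 1 \<otimes>\<^bsub>L\<^esub> cten (evK (monom 1 j)) c"
    unfolding monom_Suc eL.hor_pCons Suc.IH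
    using cten_mult[of "[:0, 1:]" 1 "monom 1 j" c] by (simp add: eL.C_zero eK.hor_x)
  also have "\<dots> = cten (evK (monom 1 (Suc j))) c"
    using cten_mult[of "[:0, 1:]" 1 "monom 1 j" c] by (simp add: eK.hor_x monom_Suc)
  finally show ?case .
qed

lemma cten_evK: "cten (evK g) f = evL (smult f (liftF g))"
proof (induction g rule: poly_monom_induct)
  case (add p q)
  then show ?case by (simp add: cten_add_left liftF_add smult_add_right eL.hor_add)
next
  case (monom c j)
  have "cten (evK (smult c (monom 1 j))) f = evL (monom (fract_to_fls c * f) j)"
    unfolding cten_scal evL_monom ..
  then show ?case by (simp add: smult_monom map_poly_monom mult.commute)
qed

lemma evL_closed: "evL g \<in> carrier L" by (rule eL.hor_closed)

lemma carrier_L: "carrier L = range evL"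
proof
  show "carrier L \<subseteq> range evL"
  proof
    fix y assume "y \<in> carrier L"
    then have "y \<in> carrier ct.Q" by (simp add: completion_def)
    then show "y \<in> range evL"
    proof (induction y rule: ct.Q_induct)
      case (pure m x)
      then obtain g where "m = evK g" by auto
      then have "ct.pure m x = evL (smult x (liftF g))" using cten_evK by (simp add: completion_tensor_def)
      then show ?case by blast
    next
      case (add U V)
      then obtain g h where "U = evL g" "V = evL h" by blast
      then have "U \<oplus>\<^bsub>ct.Q\<^esub> V = evL (g + h)" by (simp add: eL.hor_add) (simp add: completion_def)
      then show ?case by blast
    qed
  qed
  show "range evL \<subseteq> carrier L" using evL_closed by blast
qed

text \<open>This additive map to k((tau)) shows that the tensor product does not collapse: an
  element that is zero in the completion has \<open>Phi\<close> equal to zero.\<close>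

lemma ex_h2: "\<exists>h. (\<forall>y\<in>carrier L. \<forall>z\<in>carrier L. h (y \<oplus>\<^bsub>L\<^esub> z) = h y + h z) \<and>
    (\<forall>g f. h (cten (evK g) f) = Phi (liftF g) * iotaL f)"
proof -
  let ?b = "\<lambda>y f. h1 y * iotaL f"
  have "\<exists>h. (\<forall>y\<in>carrier ct.Q. \<forall>z\<in>carrier ct.Q. h (y \<oplus>\<^bsub>ct.Q\<^esub> z) = h y + h z) \<and>
      (\<forall>y\<in>carrier FT. \<forall>x\<in>carrier ring_of_type_algebra. h (ct.pure y x) = ?b y x)"
  proof (rule ct.ex_lift)
    fix a y and f :: "'q fls" assume "y \<in> carrier FT"
    then obtain g where "y = evK g" by auto
    moreover have "liftF (smult a g) = smult (fract_to_fls a) (liftF g)"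
      by (rule poly_eqI) (simp add: coeff_map_poly fract_to_fls_mult)
    ultimately show "?b (K_incl \<gamma> n a \<otimes>\<^bsub>FT\<^esub> y) f = ?b y (fract_to_fls a \<otimes>\<^bsub>ring_of_type_algebra\<^esub> f)"
      by (simp add: h1_evK Phi_smult iotaL_mult flip: eK.hor_smult)
  next
    fix y z and f :: "'q fls" assume "y \<in> carrier FT" "z \<in> carrier FT"
    then show "?b (y \<oplus>\<^bsub>FT\<^esub> z) f = ?b y f + ?b z f"
      by (auto simp: h1_add eK.hor_closed distrib_right)
  qed (simp add: iotaL_add distrib_left)
  then show ?thesis unfolding completion_def completion_tensor_def by (auto simp: h1_evK)
qed

lemma evL_zero_imp: "evL g = \<zero>\<^bsub>L\<^esub> \<Longrightarrow> Phi g = 0"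
proof -
  obtain h where h: "\<And>y z. y \<in> carrier L \<Longrightarrow> z \<in> carrier L \<Longrightarrow> h (y \<oplus>\<^bsub>L\<^esub> z) = h y + h z"
    "\<And>g f. h (cten (evK g) f) = Phi (liftF g) * iotaL f" using ex_h2 by blast
  have *: "h (evL g) = Phi g" for g
  proof (induction g rule: poly_monom_induct)
    case (add p q)
    then show ?case by (simp add: eL.hor_add h(1) evL_closed Phi_add)
  next
    case (monom c j)
    show ?case by (simp add: evL_monom h(2) map_poly_monom Phi_monom mult.commute)
  qed
  show "Phi g = 0" if "evL g = \<zero>\<^bsub>L\<^esub>"
    using *[of g] *[of 0] that by (simp add: eL.hor_0)
qed

lemma evL_P: "evL (liftP P) = \<zero>\<^bsub>L\<^esub>"
proof -
  have "evL (smult 1 (liftF (map_poly to_fract P))) = cten (kten (ev P) 1) 1"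
    unfolding cten_evK[symmetric] evK_to_fract ..
  then show ?thesis by (simp add: liftF_liftP ev_P kten_0 cten_0)
qed

text \<open>The completion is F_q((pi))[x] modulo P: the kernel of \<open>Phi\<close> is generated
  by P, and P(T) is zero already in k(tau).\<close>

lemma evL_eq_iff: "evL g = evL h \<longleftrightarrow> Phi g = Phi h"
proof -
  have d: "evL (g - h) \<oplus>\<^bsub>L\<^esub> evL h = evL g" by (simp flip: eL.hor_add)
  have "evL g = evL h \<longleftrightarrow> evL (g - h) = \<zero>\<^bsub>L\<^esub>"
    using d evL_closed L.add.r_cancel_one[of "evL h" "evL (g - h)"] by auto
  also have "\<dots> \<longleftrightarrow> Phi (g - h) = 0"
  proof
    assume "Phi (g - h) = 0"
    then obtain k where "g - h = liftP P * k" unfolding Phi_eq_0_iff by blast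
    then show "evL (g - h) = \<zero>\<^bsub>L\<^esub>" by (simp add: eL.hor_mult evL_P evL_closed)
  qed (rule evL_zero_imp)
  finally show ?thesis by (simp add: Phi_diff)
qed

lemma low_cong: "Phi g = Phi h \<Longrightarrow> low m g \<longleftrightarrow> low m h"
  by (simp add: low_def)

lemma evL_inverse:
  assumes "Phi (u * g) = 1"
  shows "inv\<^bsub>L\<^esub> (evL g) = evL u"
  by (rule eL.hor_inverse) (use assms evL_eq_iff[of "u * g" 1] eL.hor_1 in simp)

lemma range_cten_one:
  "range (cten \<one>\<^bsub>KT\<^esub>) = range (\<lambda>f. evL [:f:])"
  "range (\<lambda>f. cten \<one>\<^bsub>KT\<^esub> (fps_to_fls f)) = range (\<lambda>f. evL [:fps_to_fls f:])"
  by (simp_all add: eL.hor_const)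

lemma evL_const_range: "evL [:f:] \<in> range (\<lambda>f. evL [:fps_to_fls f:]) \<longleftrightarrow> f \<in> range fps_to_fls"
proof -
  have "iotaL f = iotaL g \<longleftrightarrow> f = g" for f g
    using iotaL_eq_0_iff[of "f - g"] by (simp add: iotaL_diff)
  then show ?thesis by (auto simp: evL_eq_iff Phi_const)
qed

text \<open>The definite description is resolved in two halves: \<open>low_valuation\<close> makes
  the integral elements a valuation ring, and \<open>valuation_unique\<close> compares any other
  candidate with it.\<close>

lemma completion_integers_eq: "completion_integers \<gamma> n \<phi> = {evL g | g. low 0 g}"
  unfolding completion_integers_def range_cten_one
proof (rule the_equality)
  let ?V = "{evL g | g. low 0 g}"
  have mem: "evL g \<in> ?V \<longleftrightarrow> low 0 g" for g
  proof
    assume "evL g \<in> ?V"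
    then obtain h where h: "evL g = evL h" "low 0 h" by blast
    then show "low 0 g" using low_cong[of g h 0] by (simp add: evL_eq_iff)
  qed blast
  have "subring ?V L"
  proof (rule L.subringI)
    show "?V \<subseteq> carrier L" using evL_closed by blast
    show "\<one>\<^bsub>L\<^esub> \<in> ?V" using mem[of 1] low_1 by (simp add: eL.hor_1)
    show "\<ominus>\<^bsub>L\<^esub> h \<in> ?V" if hV: "h \<in> ?V" for h
    proof -
      obtain g where "h = evL g" "low 0 g" using hV by blast
      moreover from this have "low 0 (- g)" by (simp add: low_def Phi_minus)
      ultimately show ?thesis using mem[of "- g"] by (simp add: eL.hor_minus)
    qed
    show "h \<otimes>\<^bsub>L\<^esub> h' \<in> ?V" and "h \<oplus>\<^bsub>L\<^esub> h' \<in> ?V" if hV: "h \<in> ?V" "h' \<in> ?V" for h h'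
    proof -
      obtain g g' where g: "h = evL g" "low 0 g" "h' = evL g'" "low 0 g'" using hV by blast
      then show "h \<otimes>\<^bsub>L\<^esub> h' \<in> ?V" using mem[of "g * g'"] low_mult[of 0 g 0 g'] by (simp add: eL.hor_mult)
      show "h \<oplus>\<^bsub>L\<^esub> h' \<in> ?V" using g mem[of "g + g'"] low_add[of 0 g g'] by (simp add: eL.hor_add)
    qed
  qed
  moreover have "inv\<^bsub>L\<^esub> x \<in> ?V" if x: "x \<in> carrier L" "x \<notin> ?V" for x
  proof -
    obtain g where g: "x = evL g" using x(1) unfolding carrier_L by blast
    then have "\<not> low 0 g" using x(2) mem by blast
    then obtain u where "low 0 u" "Phi (u * g) = 1" using low_valuation by blast
    then show ?thesis unfolding g using evL_inverse mem by simp
  qed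
  ultimately have "valuation_subring ?V L" by (simp add: valuation_subring_def)
  moreover have "?V \<inter> range (\<lambda>f. evL [:f:]) = range (\<lambda>f. evL [:fps_to_fls f:])"
  proof -
    have iff: "evL [:f:] \<in> ?V \<longleftrightarrow> evL [:f:] \<in> range (\<lambda>f. evL [:fps_to_fls f:])" for f
      unfolding mem low_const_iff evL_const_range ..
    show ?thesis
    proof (intro equalityI subsetI)
      fix x assume x: "x \<in> ?V \<inter> range (\<lambda>f. evL [:f:])"
      then obtain f where f: "x = evL [:f:]" by (elim IntE imageE)
      have "x \<in> ?V" using x by (rule IntD1)
      then show "x \<in> range (\<lambda>f. evL [:fps_to_fls f:])" unfolding f iff .
    next
      fix x assume x: "x \<in> range (\<lambda>f. evL [:fps_to_fls f:])"
      then obtain f where f: "x = evL [:fps_to_fls f:]" by (elim imageE)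
      have "x \<in> ?V" using x unfolding f iff .
      moreover have "x \<in> range (\<lambda>f. evL [:f:])" unfolding f by (rule rangeI)
      ultimately show "x \<in> ?V \<inter> range (\<lambda>f. evL [:f:])" by (rule IntI)
    qed
  qed
  ultimately show "valuation_subring ?V L \<and> ?V \<inter> range (\<lambda>f. evL [:f:]) = range (\<lambda>f. evL [:fps_to_fls f:])" ..
next
  fix V assume *: "valuation_subring V L \<and> V \<inter> range (\<lambda>f. evL [:f:]) = range (\<lambda>f. evL [:fps_to_fls f:])"
  then have sub: "subring V L" and val: "\<And>x. x \<in> carrier L \<Longrightarrow> x \<notin> V \<Longrightarrow> inv\<^bsub>L\<^esub> x \<in> V"
    by (auto simp: valuation_subring_def)
  note subringE = subringE[OF sub]
  have "evL g \<in> V \<longleftrightarrow> low 0 g" for g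
  \<comment> \<open>The candidate \<open>V\<close> is pulled back to polynomials along
    \<open>evL\<close>.\<close>
  proof (rule valuation_unique[where v = "\<lambda>g. evL g \<in> V"])
    show "evL (g + h) \<in> V" "evL (g * h) \<in> V" if "evL g \<in> V" "evL h \<in> V" for g h
      using that subringE by (simp_all add: eL.hor_add eL.hor_mult)
    show "evL (- g) \<in> V" if "evL g \<in> V" for g using that subringE by (simp add: eL.hor_minus)
    show "evL h \<in> V" if "Phi g = Phi h" "evL g \<in> V" for g h using that evL_eq_iff by metis
    show "evL [:f:] \<in> V \<longleftrightarrow> f \<in> range fps_to_fls" for f
      using * evL_const_range[of f] by blast
    fix g assume nv: "evL g \<notin> V"
    \<comment> \<open>Zero lies in \<open>V\<close>, so an element outside \<open>V\<close> has an
      inverse to which the valuation property applies.\<close>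
    have "Phi g \<noteq> 0"
    proof
      assume "Phi g = 0"
      then have "evL g = \<zero>\<^bsub>L\<^esub>" using evL_eq_iff[of g 0] by (simp add: eL.hor_0)
      then show False using nv subringE(2) by simp
    qed
    then obtain u where u: "Phi (u * g) = 1" using ex_Phi_inverse by blast
    have "evL u \<in> V" using val[OF evL_closed nv] evL_inverse[OF u] by simp
    then show "\<exists>u. evL u \<in> V \<and> Phi (u * g) = 1" using u by blast
  qed
  moreover have "V \<subseteq> range evL" using subringE(1) carrier_L by simp
  ultimately show "V = {evL g | g. low 0 g}" by blast
qed

text \<open>A pure tensor of g(T) and a power series f gives f g(T) with power series coefficients,
  and conversely each monomial f T^j is such a tensor, as T^j lies in A[pi].\<close>

lemma order_completion_eq: "order_completion \<gamma> n \<phi> (A_pi \<gamma> n \<phi>) = range (\<lambda>w. evL (liftS w))"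
proof -
  let ?S = "{cten x (fps_to_fls f) | x f. x \<in> A_pi \<gamma> n \<phi>}"
  have S: "cten (evK (map_poly to_fract g)) (fps_to_fls f) = evL (liftS (smult f (map_poly fps_of_poly g)))" for g f
    by (simp add: cten_evK liftF_liftP liftS_smult liftP_conv_liftS)
  have S_sub: "y \<in> range (\<lambda>w. evL (liftS w))" if "y \<in> ?S" for y
    using that S unfolding A_pi_eq by auto
  have minus: "\<ominus>\<^bsub>L\<^esub> evL (liftS w) = evL (liftS (- w))" for w
    using liftS_diff[of 0 w] by (simp add: eL.hor_minus)
  show ?thesis
  proof
    show "order_completion \<gamma> n \<phi> (A_pi \<gamma> n \<phi>) \<subseteq> range (\<lambda>w. evL (liftS w))"
    proof
      fix y assume "y \<in> order_completion \<gamma> n \<phi> (A_pi \<gamma> n \<phi>)"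
      then show "y \<in> range (\<lambda>w. evL (liftS w))" unfolding order_completion_def
      proof (induction rule: generate.induct)
        case one
        have "evL (liftS 0) = \<one>\<^bsub>add_monoid L\<^esub>" by (simp add: eL.hor_0)
        then show ?case by (metis rangeI)
      next
        case (incl h)
        then show ?case by (rule S_sub)
      next
        case (inv h)
        from S_sub[OF inv] obtain w where "h = evL (liftS w)" by blast
        then have "inv\<^bsub>add_monoid L\<^esub> h = evL (liftS (- w))" using minus by (simp add: a_inv_def)
        then show ?case by blast
      next
        case (eng h h')
        then obtain w w' where "h = evL (liftS w)" "h' = evL (liftS w')" by blast
        then have "h \<otimes>\<^bsub>add_monoid L\<^esub> h' = evL (liftS (w + w'))" by (simp add: eL.hor_add liftS_add)
        then show ?case by blast
      qed
    qed
    have "evL (liftS w) \<in> generate (add_monoid L) ?S" for w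
    proof (induction w rule: poly_monom_induct)
      case (add p q)
      then show ?case using generate.eng[OF add] by (simp add: liftS_add eL.hor_add)
    next
      case (monom f j)
      have "liftS (monom f j) = liftS (smult f (map_poly fps_of_poly (monom 1 j)))"
        by (simp add: map_poly_monom smult_monom)
      then have "evL (liftS (monom f j)) \<in> ?S" unfolding S[symmetric] A_pi_eq by (auto simp flip: S)
      then show ?case by (rule generate.incl)
    qed
    then show "range (\<lambda>w. evL (liftS w)) \<subseteq> order_completion \<gamma> n \<phi> (A_pi \<gamma> n \<phi>)"
      unfolding order_completion_def by blast
  qed
qed

lemma locally_maximal_iff: "locally_maximal \<gamma> n \<phi> (A_pi \<gamma> n \<phi>) \<longleftrightarrow> integrally_closed"
proof -
  have "range (\<lambda>w. evL (liftS w)) \<subseteq> {evL g | g. low 0 g}" using low_liftS by blast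
  then have "locally_maximal \<gamma> n \<phi> (A_pi \<gamma> n \<phi>) \<longleftrightarrow> {evL g | g. low 0 g} \<subseteq> range (\<lambda>w. evL (liftS w))"
    unfolding locally_maximal_def order_completion_eq completion_integers_eq by blast
  also have "\<dots> \<longleftrightarrow> (\<forall>g. low 0 g \<longrightarrow> (\<exists>w. evL g = evL (liftS w)))" by blast
  finally show ?thesis unfolding evL_eq_iff integrally_closed_iff_Phi .
qed

end

theorem theorem2p6:
  fixes \<gamma> :: "'q::{finite,field} poly \<Rightarrow> 'k::{finite,field}"
    and \<pp> :: "'q poly" and \<phi> :: "'q poly \<Rightarrow> 'k poly"
    and d n r H :: nat
  assumes "prime_elem \<pp>" and "lead_coeff \<pp> = 1" and "degree \<pp> = d"
    and "\<gamma> \<in> ring_hom ring_of_type_algebra ring_of_type_algebra"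
    and "\<forall>a. \<gamma> a = 0 \<longleftrightarrow> \<pp> dvd a"
    and "CARD('k) = CARD('q) ^ n"
    and "drinfeld_module \<gamma> r \<phi>"
    and "has_height \<phi> \<pp> H"
  shows "real_of_int \<lceil>real n / real (H * d)\<rceil> \<le> real (F_tilde_degree \<gamma> n \<phi>) / real d \<and>
         (real_of_int \<lceil>real n / real (H * d)\<rceil> = real (F_tilde_degree \<gamma> n \<phi>) / real d \<longleftrightarrow>
           locally_maximal \<gamma> n \<phi> (A_pi \<gamma> n \<phi>))"
proof -
  interpret drinfeld \<gamma> \<pp> \<phi> d n r H
    by (rule drinfeld.intro) (fact assms)+
  show ?thesis
    unfolding dim_F_tilde locally_maximal_iff using ceiling_le_and_eq_iff by blast
qed

end
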